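(* Let $0<p<\infty$, $k\in\mathbb{N}$ and $\omega\in\mathcal{B}_\infty(\mathcal{D})$. Let $$\widetilde{\omega}(z)=\frac{\int_{S(z)}\omega(\zeta)\,dA(\zeta)}{(1-|z|)^2},\quad z\in\mathbb{D}\setminus\{0\}.$$ Then $$\|f\|^p_{A^p_\omega}\asymp\|f\|^p_{A^p_{\widetilde{\omega}}}\asymp\int_{\mathbb{D}}|f^{(k)}(z)|^p(1-|z|)^{kp}\widetilde{\omega}(z)\,dA(z)+\sum_{j=0}^{k-1}|f^{(j)}(0)|^p,\quad f\in\mathcal{H}(\mathbb{D}).$$
   Context: $\mathbb{D}$ is the open unit disc in $\mathbb{C}$, $\mathcal{H}(\mathbb{D})$ the space of analytic functions in $\mathbb{D}$, $dA=\frac{dx\,dy}{\pi}$, and $\mathbb{N}=\{1,2,\dots\}$. A weight is a nonnegative function on $\mathbb{D}$ integrable with respect to $dA$; it is radial if $\omega(z)=\omega(|z|)$ for all $z\in\mathbb{D}$ and $\int_0^1\omega(s)\,ds<\infty$. Write $\omega(E)=\int_E\omega\,dA$. For a nonnegative function $\omega$, $\|f\|_{A^p_\omega}^p=\int_{\mathbb{D}}|f|^p\omega\,dA$ and $A^p_\omega=\{f\in\mathcal{H}(\mathbb{D}):\|f\|_{A^p_\omega}<\infty\}$. For $a\in\mathbb{D}\setminus\{0\}$ let $I_a=\{e^{i\theta}:|\arg(ae^{-i\theta})|\le\frac{1-|a|}{2}\}$; the Carleson square induced by $a$ is $S(a)=\{re^{it}\in\mathbb{D}:r\ge|a|,\ e^{it}\in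 I_a\}$. All weights are assumed to satisfy $\omega(S(a))>0$ for all $a\in\mathbb{D}\setminus\{0\}$. For a radial weight $\nu$ put $\widehat{\nu}(r)=\int_r^1\nu(s)\,ds$. Then $\nu\in\widehat{\mathcal{D}}$ if there is $C>1$ with $\widehat{\nu}(r)\le C\widehat{\nu}(\frac{1+r}{2})$ for all $0\le r<1$; $\nu\in\check{\mathcal{D}}$ if there are $K>1$ and $C>1$ with $\widehat{\nu}(r)\ge C\widehat{\nu}(1-\frac{1-r}{K})$ for all $0\le r<1$; and $\mathcal{D}=\widehat{\mathcal{D}}\cap\check{\mathcal{D}}$. For $1<q<\infty$, $q'=\frac{q}{q-1}$, and a weight $\nu$, a function $W\ge0$ with $W\nu$ integrable belongs to $B_q(\nu)$ if $$\sup_S\frac{\left(\int_S W\nu\,dA\right)^{1/q}\left(\int_S W^{-q'/q}\nu\,dA\right)^{1/q'}}{\int_S\nu\,dA}<\infty,$$ the supremum being over all Carleson squares $S$. Thus, for a weight $\omega$, $\frac{\omega}{\nu}\in B_q(\nu)$ means $\left(\int_S\omega\,dA\right)^{1/q}\left(\int_S(\nu\,\omega^{-1/q})^{q'}dA\right)^{1/q'}\le C\nu(S)$ for all $S$, where the integrand in the second integral is taken to be $0$ where $\nu=0$ and $+\infty$ where $\omega=0<\nu$. Set $\mathcal{B}_\infty(\nu)=\bigcup_{1<q<\infty}\{\omega:\frac{\omega}{\nu}\in B_q(\nu)\}$ and $\mathcal{B}_\infty(\mathcal{D})=\bigcup_{\nu\in\mathcal{D}}\mathcal{B}_\infty(\nu)$.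 $X\asymp Y$ means $C^{-1}Y\le X\le CY$ with a constant $C>0$ independent of $f$ (depending only on $\omega,p,k$); both sides may be $+\infty$. *)

theory Defs
  imports "HOL-Analysis.Analysis"
begin

abbreviation unit_disc :: "complex set" where
  "unit_disc \<equiv> ball 0 1"

text \<open>The normalised area measure \<open>dA = dx dy / \<pi>\<close>.\<close>

definition area_measure :: "complex measure" where
  "area_measure = density lebesgue (\<lambda>_. ennreal (1 / pi))"

definition weight_mass :: "(complex \<Rightarrow> real) \<Rightarrow> complex set \<Rightarrow> real" where
  "weight_mass \<omega> E = (LINT z:E|area_measure. \<omega> z)"


subsection \<open>Carleson squares and weights\<close>

definition carleson_arc :: "complex \<Rightarrow> complex set" where
  "carleson_arc a = {cis \<theta> |\<theta>. \<bar>Arg (a * cis (- \<theta>))\<bar> \<le> (1 - cmod a) / 2}"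

text \<open>Only used for \<open>a\<close> in the punctured unit disc, apart from the null set \<open>{0}\<close> in
  \<open>weight_tilde\<close> below. (As \<open>Arg 0 = 0\<close>, the formula gives the whole disc at \<open>a = 0\<close>.)\<close>

definition carleson_square :: "complex \<Rightarrow> complex set" where
  "carleson_square a =
     {z \<in> unit_disc. \<exists>r t. z = of_real r * cis t \<and> r \<ge> cmod a \<and> cis t \<in> carleson_arc a}"

text \<open>Functions on the disc are total functions on \<open>complex\<close> whose values outside
  the disc are never used. Positivity on all Carleson squares is part of being a weight.\<close>

definition weight :: "(complex \<Rightarrow> real) \<Rightarrow> bool" where
  "weight \<omega> \<longleftrightarrow>
     (\<forall>z\<in>unit_disc. \<omega> z \<ge> 0) \<and>
     set_integrable area_measure unit_disc \<omega> \<and>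
     (\<forall>a\<in>unit_disc - {0}. weight_mass \<omega> (carleson_square a) > 0)"

definition radial_weight :: "(complex \<Rightarrow> real) \<Rightarrow> bool" where
  "radial_weight \<nu> \<longleftrightarrow>
     weight \<nu> \<and>
     (\<forall>z\<in>unit_disc. \<nu> z = \<nu> (of_real (cmod z))) \<and>
     set_integrable lebesgue {0..<1} (\<lambda>s::real. \<nu> (of_real s))"

definition weight_hat :: "(complex \<Rightarrow> real) \<Rightarrow> real \<Rightarrow> real" where
  "weight_hat \<nu> r = (LINT s:{r..<1}|lebesgue. \<nu> (of_real s))"

definition D_hat :: "(complex \<Rightarrow> real) set" where
  "D_hat = {\<nu>. radial_weight \<nu> \<and>
     (\<exists>C>1. \<forall>r. 0 \<le> r \<and> r < 1 \<longrightarrow> weight_hat \<nu> r \<le> C * weight_hat \<nu> ((1 + r) / 2))}"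

definition D_check :: "(complex \<Rightarrow> real) set" where
  "D_check = {\<nu>. radial_weight \<nu> \<and>
     (\<exists>K>1. \<exists>C>1. \<forall>r. 0 \<le> r \<and> r < 1 \<longrightarrow>
        weight_hat \<nu> r \<ge> C * weight_hat \<nu> (1 - (1 - r) / K))}"

definition D_class :: "(complex \<Rightarrow> real) set" where
  "D_class = D_hat \<inter> D_check"


subsection \<open>Bekolle--Bonami type classes\<close>

text \<open>Positive real powers on \<open>[0,\<infinity>]\<close>; only meant for exponents \<open>a > 0\<close>.\<close>

definition ennreal_powr :: "ennreal \<Rightarrow> real \<Rightarrow> ennreal" where
  "ennreal_powr x a = (if x = top then top else ennreal (enn2real x powr a))"

text \<open>The function \<open>(\<nu> \<omega>^(-1/q))^q'\<close> with \<open>q' = q/(q - 1)\<close>, which is what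
  \<open>W^(-q'/q) \<nu>\<close> becomes for \<open>W = \<omega>/\<nu>\<close>.\<close>

definition dual_integrand ::
    "real \<Rightarrow> (complex \<Rightarrow> real) \<Rightarrow> (complex \<Rightarrow> real) \<Rightarrow> complex \<Rightarrow> ennreal" where
  "dual_integrand q \<omega> \<nu> z =
     (if \<nu> z = 0 then 0
      else if \<omega> z = 0 then top
      else ennreal ((\<nu> z * \<omega> z powr (- 1 / q)) powr (q / (q - 1))))"

text \<open>The condition \<open>\<omega>/\<nu> \<in> B\<^sub>q(\<nu>)\<close>. The product \<open>(\<omega>/\<nu>) \<nu>\<close> is read as \<open>\<omega>\<close> also where
  \<open>\<nu>\<close> vanishes, so the quotient itself is never formed.\<close>

definition ratio_in_Bq :: "real \<Rightarrow> (complex \<Rightarrow> real) \<Rightarrow> (complex \<Rightarrow> real) \<Rightarrow> bool" where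
  "ratio_in_Bq q \<omega> \<nu> \<longleftrightarrow>
     (\<exists>C::real. \<forall>a\<in>unit_disc - {0}.
        ennreal (weight_mass \<omega> (carleson_square a) powr (1 / q)) *
        ennreal_powr (\<integral>\<^sup>+ z \<in> carleson_square a. dual_integrand q \<omega> \<nu> z \<partial>area_measure)
          (1 / (q / (q - 1)))
        \<le> ennreal (C * weight_mass \<nu> (carleson_square a)))"

definition B_infty :: "(complex \<Rightarrow> real) \<Rightarrow> (complex \<Rightarrow> real) set" where
  "B_infty \<nu> = (\<Union>q\<in>{1<..}. {\<omega>. weight \<omega> \<and> ratio_in_Bq q \<omega> \<nu>})"

definition B_infty_D :: "(complex \<Rightarrow> real) set" where
  "B_infty_D = (\<Union>\<nu>\<in>D_class. B_infty \<nu>)"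


subsection \<open>Bergman norms\<close>

text \<open>The \<open>p\<close>-th power of the norm of \<open>f\<close> in \<open>A\<^sup>p\<^sub>\<omega>\<close>, possibly infinite.\<close>

definition bergman_norm_pow ::
    "real \<Rightarrow> (complex \<Rightarrow> real) \<Rightarrow> (complex \<Rightarrow> complex) \<Rightarrow> ennreal" where
  "bergman_norm_pow p \<omega> f =
     (\<integral>\<^sup>+ z \<in> unit_disc. ennreal (cmod (f z) powr p * \<omega> z) \<partial>area_measure)"

definition weight_tilde :: "(complex \<Rightarrow> real) \<Rightarrow> complex \<Rightarrow> real" where
  "weight_tilde \<omega> z = weight_mass \<omega> (carleson_square z) / (1 - cmod z)\<^sup>2"

definition derivative_norm_pow ::
    "real \<Rightarrow> nat \<Rightarrow> (complex \<Rightarrow> real) \<Rightarrow> (complex \<Rightarrow> complex) \<Rightarrow> ennreal" where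
  "derivative_norm_pow p k \<omega> f =
     (\<integral>\<^sup>+ z \<in> unit_disc.
        ennreal (cmod ((deriv ^^ k) f z) powr p * (1 - cmod z) powr (real k * p) * \<omega> z)
        \<partial>area_measure)
     + ennreal (\<Sum>j<k. cmod ((deriv ^^ j) f 0) powr p)"

text \<open>\<open>X \<asymp> Y\<close> with a constant that is uniform over \<open>F\<close>; both sides may be infinite.\<close>

definition comparable_on :: "'a set \<Rightarrow> ('a \<Rightarrow> ennreal) \<Rightarrow> ('a \<Rightarrow> ennreal) \<Rightarrow> bool" where
  "comparable_on F X Y \<longleftrightarrow>
     (\<exists>C::real. C > 0 \<and>
        (\<forall>f\<in>F. ennreal (inverse C) * Y f \<le> X f \<and> X f \<le> ennreal C * Y f))"

end

theory Submission
  imports Defs "HOL-Complex_Analysis.Complex_Analysis"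
begin

text \<open>
  Write \<open>dA\<close> for normalised area, \<open>gap z = 1 - |z|\<close>, and let \<open>\<nu>\<close> be the radial weight with \<open>\<omega>/\<nu> \<in> B\<^sub>q(\<nu>)\<close>.
  Carleson squares are awkward near the origin, so the argument uses the tents
  \<open>tent z s\<close>, the intersections of the disc with the discs of radius \<open>s\<close> about \<open>z\<close>, for \<open>s \<ge> 2 gap z\<close>.
  They are comparable to Carleson squares near the boundary, and the whole disc is a tent.

  \<^bold>\<open>What the hypothesis gives.\<close> The conditions on \<open>\<nu>\<close> say that the mass \<open>N u\<close> of the collar
  \<open>1 - u \<le> |x| < 1\<close> is doubling (\<open>N_doubling\<close>) and that thin collars carry little of it (\<open>N_decay\<close>).
  As \<open>\<nu>\<close> is radial, a tent of size \<open>s\<close> has \<open>\<nu>\<close>-mass about \<open>s N(s)\<close>. Hoelder's inequality and the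
  \<open>B\<^sub>q\<close> condition turn this into statements on \<open>\<omega>\<close>: a part of a tent that carries a fixed
  proportion of its \<open>\<nu>\<close>-mass carries a fixed proportion of its \<open>\<omega>\<close>-mass (\<open>mu_proportion\<close>). Hence \<open>\<omega>\<close> is
  doubling on tents, it charges the part of a tent that stays away from the boundary, and
  \<open>(1 - |x|)\<^sup>-\<^sup>\<eta>\<close> is \<open>\<omega>\<close>-integrable over tents, with the natural bound, for some \<open>\<eta> > 0\<close>
  (\<open>negative_power_integrable\<close>). In particular \<open>\<omega>\<close>-averages over squares and over tents agree up to constants, so
  the averaged weight of the theorem may be replaced by its analogue \<open>V\<close> for tents,
  which varies slowly on the hyperbolic scale.

  \<^bold>\<open>The norm for \<open>\<omega>\<close> is at most the norm for \<open>V\<close>.\<close> Bound \<open>|f(z)|\<^sup>p\<close> by its mean over the disc of radius \<open>gap z / 2\<close>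
  and interchange the integrals (\<open>mu_norm_le_V_norm\<close>). The same computation, with the Cauchy
  inequality, bounds the derivatives of \<open>f\<close> (\<open>derivative_norm_le_V_norm\<close>).

  \<^bold>\<open>The norm for \<open>V\<close> is at most the norm for \<open>\<omega>\<close>.\<close> This is the main point, as \<open>\<omega>\<close> may vanish on large sets.
  The power \<open>|f|\<^sup>\<alpha>\<close>, \<open>\<alpha> = p/q\<close>, is subharmonic; applied to \<open>f\<close> times a function that peaks at \<open>z\<close>, this
  bounds \<open>|f(z)|\<^sup>\<alpha>\<close> by a rapidly decaying average over every circle of radius
  larger than \<open>|z|\<close>. Integrate over the circles in a collar \<open>A\<close> at distance comparable to \<open>gap z\<close> from the boundary, against
  \<open>\<nu>\<close>. Hoelder's inequality and the \<open>B\<^sub>q\<close> condition on the dyadic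
  enlargements of the tent of \<open>z\<close> give
  \<open>|f(z)|\<^sup>p \<omega>(tent) \<le> C \<integral>\<^sub>A |f|\<^sup>p K d\<omega>\<close> with a kernel \<open>K\<close> that decays fast (\<open>pointwise_le_mu_average\<close>).
  Since \<open>A\<close> stays away from the boundary, dividing by \<open>(gap z)\<^sup>2\<close> and integrating in \<open>z\<close> costs
  only a constant (\<open>V_norm_le_mu_norm\<close>).

  \<^bold>\<open>The norm for \<open>V\<close> is at most the derivative norm.\<close> Integrating \<open>f'\<close> along a radius, with a loss of a small power
  \<open>\<eta>\<close> of the ratio of the gaps, bounds \<open>|f(z) - f(0)|\<^sup>p\<close> by an average of
  \<open>|f'|\<^sup>p\<close> over a nontangential region (\<open>increment_le_nontangential_average\<close>). After an interchange of integrals the loss is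
  absorbed by the integrability of \<open>(1 - |x|)\<^sup>-\<^sup>\<eta>\<close> (\<open>nontangential_V_integral\<close>). The extra weight
  \<open>(1 - |z|)\<^sup>\<beta>\<close> does no harm, so the step can be iterated \<open>k\<close> times (\<open>V_norm_le_derivative_norm\<close>).

  Since \<open>\<omega>\<close> and \<open>\<nu>\<close> are only Lebesgue measurable, all this is done for Borel representatives; the
  last section passes from one to the other.
\<close>

section \<open>Powers of holomorphic functions are subharmonic\<close>

text \<open>On the unit circle \<open>w\<close> and \<open>cnj w\<close> are inverse to each other, so negative powers of \<open>w\<close>
  have the same real parts as positive powers with conjugated coefficients.\<close>

lemma Re_poly_cnj_poly_on_circle:
  fixes p q :: "complex poly"
  shows "\<exists>r. \<forall>w. cmod w = 1 \<longrightarrow> Re (poly p w * cnj (poly q w)) = Re (poly r w)"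
proof (induction p q rule: poly_induct2)
  case 0
  show ?case by (rule exI[of _ 0]) simp
next
  case (pCons a p b q)
  then obtain r where r: "\<And>w. cmod w = 1 \<Longrightarrow> Re (poly p w * cnj (poly q w)) = Re (poly r w)"
    by auto
  let ?r = "[:a * cnj b:] + smult (cnj a) (pCons 0 q) + smult (cnj b) (pCons 0 p) + r"
  have "Re (poly (pCons a p) w * cnj (poly (pCons b q) w)) = Re (poly ?r w)" if w: "cmod w = 1" for w
  proof -
    have ww: "w * cnj w = 1"
      using w by (simp add: complex_norm_square[symmetric])
    have "poly (pCons a p) w * cnj (poly (pCons b q) w) =
        a * cnj b + a * cnj (w * poly q w) + cnj b * (w * poly p w) + (w * cnj w) * (poly p w * cnj (poly q w))"
      by (simp add: algebra_simps)
    moreover have "Re (a * cnj (w * poly q w)) = Re (cnj a * (w * poly q w))"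
      by (metis complex_cnj_cnj complex_cnj_mult cnj.simps(1))
    moreover have "poly ?r w = a * cnj b + cnj a * (w * poly q w) + cnj b * (w * poly p w) + poly r w"
      by (simp add: algebra_simps)
    ultimately show ?thesis
      using r[OF w] ww by (simp only: plus_complex.simps mult_1)
  qed
  then show ?case by blast
qed

text \<open>By the previous lemma real parts of polynomials form an algebra on the circle, because
  \<open>Re a Re b = Re (a b + a cnj b) / 2\<close>; the Stone--Weierstrass theorem applies.\<close>

lemma Re_poly_dense_on_circle:
  fixes u :: "complex \<Rightarrow> real"
  assumes "continuous_on (sphere 0 1) u" "e > 0"
  obtains p :: "complex poly" where "\<And>w. cmod w = 1 \<Longrightarrow> \<bar>Re (poly p w) - u w\<bar> < e"
proof -
  define R where "R = {v :: complex \<Rightarrow> real. continuous_on (sphere 0 1) v \<and>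
     (\<exists>p. \<forall>w. cmod w = 1 \<longrightarrow> v w = Re (poly p w))}"
  interpret function_ring_on R "sphere 0 1"
  proof
    show "compact (sphere (0::complex) 1)" by simp
    fix f g assume f: "f \<in> R" and g: "g \<in> R"
    from f show "continuous_on (sphere 0 1) f" by (simp add: R_def)
    from f obtain p where p: "\<And>w. cmod w = 1 \<Longrightarrow> f w = Re (poly p w)" by (auto simp: R_def)
    from g obtain q where q: "\<And>w. cmod w = 1 \<Longrightarrow> g w = Re (poly q w)" by (auto simp: R_def)
    show "(\<lambda>x. f x + g x) \<in> R"
      using f g unfolding R_def
      by (auto intro!: continuous_intros exI[of _ "p + q"] simp: p q)
    obtain r where r: "\<And>w. cmod w = 1 \<Longrightarrow> Re (poly p w * cnj (poly q w)) = Re (poly r w)"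
      using Re_poly_cnj_poly_on_circle by blast
    have "f w * g w = Re (poly (smult (1/2) (p * q + r)) w)" if "cmod w = 1" for w
      using r[OF that] p[OF that] q[OF that] by simp
    then show "(\<lambda>x. f x * g x) \<in> R"
      using f g unfolding R_def
      by (auto intro!: continuous_intros exI[of _ "smult (1/2) (p * q + r)"])
  next
    show "(\<lambda>_. c) \<in> R" for c
      unfolding R_def by (auto intro!: exI[of _ "[:of_real c:]"])
  next
    fix x y :: complex assume "x \<in> sphere 0 1" "y \<in> sphere 0 1" "x \<noteq> y"
    have "Re \<in> R" unfolding R_def
      by (auto intro!: continuous_intros exI[of _ "[:0, 1:]"])
    moreover have "(\<lambda>w. Im w) \<in> R" unfolding R_def
      by (auto intro!: continuous_intros exI[of _ "[:0, -\<i>:]"])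
    ultimately show "\<exists>f\<in>R. f x \<noteq> f y"
      using \<open>x \<noteq> y\<close> by (metis complex_eqI)
  qed
  obtain F where F: "F \<in> UNIV \<rightarrow> R" "uniform_limit (sphere 0 1) F u sequentially"
    using Stone_Weierstrass[OF assms(1)] by blast
  from uniform_limitD[OF F(2) assms(2)] obtain n where n: "\<forall>x\<in>sphere 0 1. dist (F n x) (u x) < e"
    by (auto simp: eventually_sequentially)
  have "F n \<in> R" using F(1) by auto
  then obtain p where "\<And>w. cmod w = 1 \<Longrightarrow> F n w = Re (poly p w)" by (auto simp: R_def)
  with n have "\<And>w. cmod w = 1 \<Longrightarrow> \<bar>Re (poly p w) - u w\<bar> < e"
    by (simp add: dist_real_def)
  then show thesis by (rule that)
qed

text \<open>The parameter runs over \<open>[0,1]\<close>, so that integrals over \<open>t\<close> are averages over the circle.\<close>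

definition unit_circle :: "real \<Rightarrow> complex" where
  "unit_circle t = cis (2 * pi * t)"

lemma norm_unit_circle [simp]: "cmod (unit_circle t) = 1"
  by (simp add: unit_circle_def)

lemma continuous_on_unit_circle [continuous_intros]:
  "continuous_on A f \<Longrightarrow> continuous_on A (\<lambda>t. unit_circle (f t))"
  unfolding unit_circle_def by (intro continuous_intros)

text \<open>Cauchy's formula with the contour integral written out as an average.\<close>

lemma Cauchy_formula_circle_mean:
  assumes "continuous_on (cball 0 \<rho>) F" "F holomorphic_on ball 0 \<rho>" "cmod z < \<rho>"
  shows "((\<lambda>t. F (\<rho> * unit_circle t) * (\<rho> * unit_circle t) / (\<rho> * unit_circle t - z))
     has_integral F z) {0..1}"
proof -
  have "((\<lambda>u. F u / (u - z)) has_contour_integral (2 * of_real pi * \<i> * F z)) (circlepath 0 \<rho>)"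
    using assms by (intro Cauchy_integral_circlepath) auto
  then have "((\<lambda>t. F (circlepath 0 \<rho> t) / (circlepath 0 \<rho> t - z) *
      (vector_derivative (circlepath 0 \<rho>) (at t within {0..1}))) has_integral (2 * of_real pi * \<i> * F z)) {0..1}"
    by (simp add: has_contour_integral_def)
  then have "((\<lambda>t. F (\<rho> * unit_circle t) / (\<rho> * unit_circle t - z) * (2 * pi * \<i> * \<rho> * unit_circle t))
      has_integral (2 * of_real pi * \<i> * F z)) {0..1}"
  proof (rule has_integral_eq[rotated])
    fix t :: real assume t: "t \<in> {0..1}"
    have e: "exp (2 * complex_of_real pi * \<i> * complex_of_real t) = unit_circle t"
      unfolding unit_circle_def by (simp add: cis_conv_exp mult_ac)
    have "circlepath 0 \<rho> t = \<rho> * unit_circle t"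
      unfolding circlepath e by simp
    moreover have "vector_derivative (circlepath 0 \<rho>) (at t within {0..1}) = 2 * pi * \<i> * \<rho> * unit_circle t"
      using t e by (subst vector_derivative_circlepath01) auto
    ultimately show "F (circlepath 0 \<rho> t) / (circlepath 0 \<rho> t - z) *
          vector_derivative (circlepath 0 \<rho>) (at t within {0..1}) =
          F (\<rho> * unit_circle t) / (\<rho> * unit_circle t - z) * (2 * pi * \<i> * \<rho> * unit_circle t)"
      by simp
  qed
  from has_integral_mult_right[OF this, of "1 / (2 * pi * \<i>)"]
  show ?thesis
    by (rule has_integral_eq_rhs[OF has_integral_eq[rotated]]) (auto simp: field_simps)
qed

text \<open>On the circle of radius \<open>\<rho>\<close> the reflected factor \<open>\<rho>\<^sup>2 - cnj z w\<close>, which has no zero in the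
  closed disc, has the same size as \<open>w - z\<close> up to the factor \<open>\<rho>\<close>.\<close>

lemma norm_reflected_difference:
  assumes "cmod w = \<rho>"
  shows "cmod (of_real (\<rho>\<^sup>2) - cnj z * w) = \<rho> * cmod (w - z)"
proof -
  have "of_real (\<rho>\<^sup>2) - cnj z * w = w * cnj (w - z)"
    using complex_norm_square[of w] assms by (simp add: algebra_simps)
  then show ?thesis
    using assms by (metis norm_mult complex_mod_cnj)
qed

lemma continuous_on_norm_powr:
  assumes "continuous_on A g" "0 < a"
  shows "continuous_on A (\<lambda>x. norm (g x) powr a)"
  using assms by (intro continuous_on_powr' continuous_intros) auto

text \<open>For a function \<open>F\<close> in place of \<open>|f|\<^sup>a\<close> with \<open>F = |exp P|\<close> for a holomorphic \<open>P\<close>, this is Cauchy's formula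
  for \<open>exp P g\<close>, where \<open>g(w) = ((\<rho>\<^sup>2 - |z|\<^sup>2) / (\<rho>\<^sup>2 - cnj z w))\<^sup>L\<close> is \<open>1\<close> at \<open>z\<close>. In general \<open>log (|f|\<^sup>a + \<epsilon>)\<close> is
  continuous on the circle, hence uniformly close to the real part of a polynomial \<open>P\<close>, chosen slightly too
  large. Then \<open>|f exp (- P / a)| \<le> 1\<close> on the circle, so by the maximum principle
  \<open>|f|\<^sup>a \<le> |exp P|\<close> also at \<open>z\<close>. This avoids factoring out the zeros of \<open>f\<close>.\<close>

lemma subharmonic_kernel_bound:
  fixes L :: nat
  assumes holf: "f holomorphic_on ball 0 R" and z: "cmod z < \<rho>" and \<rho>: "\<rho> < R" and a: "0 < a"
  shows "cmod (f z) powr a \<le> integral {0..1} (\<lambda>t. cmod (f (\<rho> * unit_circle t)) powr a *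
     (\<rho> / cmod (\<rho> * unit_circle t - z)) * ((\<rho>\<^sup>2 - (cmod z)\<^sup>2) / (\<rho> * cmod (\<rho> * unit_circle t - z))) ^ L)"
proof -
  have \<rho>0: "\<rho> > 0" using z norm_ge_zero[of z] by linarith
  define k where "k = (\<lambda>t. (\<rho> / cmod (\<rho> * unit_circle t - z)) *
      ((\<rho>\<^sup>2 - (cmod z)\<^sup>2) / (\<rho> * cmod (\<rho> * unit_circle t - z))) ^ L)"
  define v where "v = (\<lambda>t. cmod (f (\<rho> * unit_circle t)) powr a)"
  have ne: "\<rho> * unit_circle t - z \<noteq> 0" for t
  proof
    assume "\<rho> * unit_circle t - z = 0"
    then have "cmod z = \<rho>" using \<rho>0 by (metis eq_iff_diff_eq_0 norm_mult norm_of_real norm_unit_circle mult.right_neutral abs_of_pos)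
    with z show False by simp
  qed
  have mem: "\<rho> * unit_circle t \<in> ball 0 R" for t
    using \<rho> \<rho>0 by (simp add: norm_mult)
  have contk: "continuous_on {0..1} k"
    unfolding k_def using ne \<rho>0 by (intro continuous_intros) auto
  have contf: "continuous_on (ball 0 R) f"
    using holf by (rule holomorphic_on_imp_continuous_on)
  have contv: "continuous_on {0..1} v"
    unfolding v_def
    by (intro continuous_on_norm_powr a continuous_on_compose2[OF contf] continuous_intros) (use mem in auto)
  have zsq: "(cmod z)\<^sup>2 < \<rho>\<^sup>2"
    using z by (simp add: power_strict_mono)
  have k0: "k t \<ge> 0" for t
    unfolding k_def using \<rho>0 zsq z by (intro mult_nonneg_nonneg divide_nonneg_nonneg zero_le_power) auto
  have v0: "v t \<ge> 0" for t by (simp add: v_def)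
  have main: "cmod (f z) powr a \<le> exp (2 * \<delta>) * integral {0..1} (\<lambda>t. (v t + \<epsilon>) * k t)"
    if eps: "\<epsilon> > 0" and del: "\<delta> > 0" for \<epsilon> \<delta> :: real
  proof -
    define u where "u = (\<lambda>w::complex. ln (cmod (f (\<rho> * w)) powr a + \<epsilon>))"
    have pos: "0 < cmod x powr a + \<epsilon>" for x
      using eps by (simp add: add_nonneg_pos)
    have "continuous_on (sphere 0 1) u"
      unfolding u_def
      by (intro continuous_on_ln continuous_on_add continuous_on_norm_powr a continuous_on_const
           continuous_on_compose2[OF contf])
         (use \<rho> \<rho>0 less_imp_neq[OF pos] in \<open>auto simp: norm_mult intro!: continuous_intros\<close>)
    then obtain p where p: "\<And>w. cmod w = 1 \<Longrightarrow> \<bar>Re (poly p w) - u w\<bar> < \<delta>"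
      using del by (rule Re_poly_dense_on_circle) blast
    \<comment> \<open>The shift by \<open>\<delta>\<close> makes \<open>Re P\<close> an upper bound for the logarithm.\<close>
    define P where "P = (\<lambda>w::complex. poly p (w / \<rho>) + \<delta>)"
    have holP: "P holomorphic_on A" for A
      unfolding P_def using \<rho>0 by (intro holomorphic_intros) auto
    have Pw: "cmod (f w) powr a + \<epsilon> \<le> exp (Re (P w))"
       "exp (Re (P w)) \<le> exp (2 * \<delta>) * (cmod (f w) powr a + \<epsilon>)" if "cmod w = \<rho>" for w
    proof -
      have "cmod (w / \<rho>) = 1" using that \<rho>0 by (simp add: norm_divide)
      then have "\<bar>Re (poly p (w/\<rho>)) - ln (cmod (f w) powr a + \<epsilon>)\<bar> < \<delta>"
        using p[of "w/\<rho>"] \<rho>0 by (simp add: u_def)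
      then have *: "ln (cmod (f w) powr a + \<epsilon>) \<le> Re (P w)" "Re (P w) \<le> 2 * \<delta> + ln (cmod (f w) powr a + \<epsilon>)"
        by (auto simp: P_def)
      from *(1) show "cmod (f w) powr a + \<epsilon> \<le> exp (Re (P w))"
        using pos by (simp add: ln_le_cancel_iff[symmetric] del: ln_le_cancel_iff) 
      have "exp (Re (P w)) \<le> exp (2 * \<delta> + ln (cmod (f w) powr a + \<epsilon>))"
        using *(2) by simp
      then show "exp (Re (P w)) \<le> exp (2 * \<delta>) * (cmod (f w) powr a + \<epsilon>)"
        using pos by (simp add: exp_add)
    qed
    define G where "G = (\<lambda>w. f w * exp (- P w / of_real a))"
    have fcb: "f holomorphic_on cball 0 \<rho>"
      using holf \<rho> by (rule_tac holomorphic_on_subset) auto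
    have holG: "G holomorphic_on cball 0 \<rho>"
      unfolding G_def using fcb a by (intro holomorphic_intros holP) auto
    have normG: "cmod (G w) = cmod (f w) / exp (Re (P w) / a)" for w
    proof -
      have "Re (- P w / of_real a) = - (Re (P w) / a)"
        by (simp add: Re_divide_of_real)
      then show ?thesis
        by (simp only: G_def norm_mult norm_exp_eq_Re exp_minus divide_inverse)
    qed
    have Gz: "cmod (G z) \<le> 1"
    proof (rule maximum_modulus_frontier[of G "cball 0 \<rho>"])
      show "G holomorphic_on interior (cball 0 \<rho>)"
        using holG by (rule holomorphic_on_subset) auto
      show "continuous_on (closure (cball 0 \<rho>)) G"
        using holG by (simp add: holomorphic_on_imp_continuous_on)
      show "bounded (cball (0::complex) \<rho>)" by simp
      show "z \<in> cball 0 \<rho>" using z by simp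
      fix w :: complex assume "w \<in> frontier (cball 0 \<rho>)"
      then have w: "cmod w = \<rho>" using \<rho>0 by simp
      have "cmod (f w) powr a \<le> exp (Re (P w))" using Pw(1)[OF w] eps by linarith
      then have "(cmod (f w) powr a) powr (1/a) \<le> exp (Re (P w)) powr (1/a)"
        using a by (intro powr_mono2) auto
      then have "cmod (f w) \<le> exp (Re (P w) / a)"
        using a by (simp add: powr_powr exp_powr_real)
      then show "cmod (G w) \<le> 1"
        by (simp add: normG)
    qed
    have "cmod (f z) \<le> exp (Re (P z) / a)"
      using Gz by (simp add: normG)
    then have "cmod (f z) powr a \<le> exp (Re (P z) / a) powr a"
      using a by (intro powr_mono2) auto
    then have fz: "cmod (f z) powr a \<le> exp (Re (P z))"
      using a by (simp add: powr_def)
    define g where "g = (\<lambda>w. (of_real (\<rho>\<^sup>2 - (cmod z)\<^sup>2) / (of_real (\<rho>\<^sup>2) - cnj z * w)) ^ L)"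
    define F where "F = (\<lambda>w. exp (P w) * g w)"
    have den: "of_real (\<rho>\<^sup>2) - cnj z * w \<noteq> 0" if "cmod w \<le> \<rho>" for w
    proof
      assume "of_real (\<rho>\<^sup>2) - cnj z * w = 0"
      then have "cmod (of_real (\<rho>\<^sup>2)) = cmod z * cmod w"
        by (metis complex_mod_cnj eq_iff_diff_eq_0 norm_mult)
      then have "\<rho>\<^sup>2 = cmod z * cmod w" by (simp add: norm_power)
      moreover have "cmod z * cmod w < \<rho> * \<rho>"
        using mult_left_mono[OF that norm_ge_zero[of z]] mult_strict_right_mono[OF z \<rho>0] by linarith
      ultimately show False by (simp add: power2_eq_square)
    qed
    have holF: "F holomorphic_on cball 0 \<rho>"
      unfolding F_def g_def using den by (intro holomorphic_intros holP) auto
    have "complex_of_real (\<rho>\<^sup>2 - (cmod z)\<^sup>2) = of_real (\<rho>\<^sup>2) - cnj z * z"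
      using complex_norm_square[of z] by (simp add: mult.commute)
    then have gz: "g z = 1"
      unfolding g_def using den[of z] z by simp
    have int: "((\<lambda>t. F (\<rho> * unit_circle t) * (\<rho> * unit_circle t) / (\<rho> * unit_circle t - z))
       has_integral F z) {0..1}"
      using holF z by (intro Cauchy_formula_circle_mean holomorphic_on_imp_continuous_on)
        (auto intro: holomorphic_on_subset)
    have "cmod (F z) \<le> integral {0..1} (\<lambda>t. exp (2 * \<delta>) * ((v t + \<epsilon>) * k t))"
    proof -
      have "cmod (integral {0..1} (\<lambda>t. F (\<rho> * unit_circle t) * (\<rho> * unit_circle t) / (\<rho> * unit_circle t - z)))
        \<le> integral {0..1} (\<lambda>t. exp (2 * \<delta>) * ((v t + \<epsilon>) * k t))"
      proof (rule integral_norm_bound_integral)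
        show "(\<lambda>t. F (\<rho> * unit_circle t) * (\<rho> * unit_circle t) / (\<rho> * unit_circle t - z)) integrable_on {0..1}"
          using int by (rule has_integral_integrable)
        show "(\<lambda>t. exp (2 * \<delta>) * ((v t + \<epsilon>) * k t)) integrable_on {0..1}"
          by (intro integrable_continuous_real continuous_intros contv contk)
        fix t :: real
        let ?w = "\<rho> * unit_circle t"
        have w: "cmod ?w = \<rho>" using \<rho>0 by (simp add: norm_mult)
        have "cmod (F ?w * ?w / (?w - z)) = exp (Re (P ?w)) * k t"
          unfolding F_def g_def k_def norm_divide norm_mult norm_power norm_reflected_difference[OF w] norm_of_real
          using \<rho>0 zsq abs_of_pos[of "\<rho>\<^sup>2 - (cmod z)\<^sup>2"] by (simp add: norm_mult)
        also have "\<dots> \<le> (exp (2 * \<delta>) * (v t + \<epsilon>)) * k t"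
          using Pw(2)[OF w] k0 by (intro mult_right_mono) (auto simp: v_def)
        finally show "cmod (F ?w * ?w / (?w - z)) \<le> exp (2 * \<delta>) * ((v t + \<epsilon>) * k t)"
          by (simp add: mult.assoc)
      qed
      with int show ?thesis by (simp add: integral_unique)
    qed
    moreover have "cmod (F z) = exp (Re (P z))" by (simp add: F_def gz)
    ultimately show ?thesis using fz by simp
  qed
  have I: "integral {0..1} (\<lambda>t. (v t + \<epsilon>) * k t) = integral {0..1} (\<lambda>t. v t * k t) + \<epsilon> * integral {0..1} k" for \<epsilon>
    unfolding distrib_right
    by (subst integral_add) (auto intro!: integrable_continuous_real continuous_intros contv contk)
  have "((\<lambda>e. exp (2 * e) * (integral {0..1} (\<lambda>t. v t * k t) + e * integral {0..1} k)) \<longlongrightarrow>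
      exp (2 * 0) * (integral {0..1} (\<lambda>t. v t * k t) + 0 * integral {0..1} k)) (at_right (0::real))"
    by (intro tendsto_intros)
  then have "cmod (f z) powr a \<le> exp (2 * 0) * (integral {0..1} (\<lambda>t. v t * k t) + 0 * integral {0..1} k)"
    by (rule tendsto_lowerbound)
      (use main I in \<open>auto simp: eventually_at_right_less intro!: eventually_mono[OF eventually_at_right_less]\<close>)
  then show ?thesis
    unfolding v_def k_def by (simp add: mult.assoc)
qed

text \<open>The same bound for the circle through a given point \<open>x\<close>, parametrised from \<open>x\<close>. In this form it can be
  integrated over \<open>x\<close> against any rotation invariant measure.\<close>

lemma subharmonic_rotation_mean:
  fixes L :: nat
  assumes holf: "f holomorphic_on ball 0 R" and z: "cmod z < cmod x" and x: "cmod x < R" and a: "0 < a"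
  shows "ennreal (cmod (f z) powr a) \<le> (\<integral>\<^sup>+ t\<in>{0..1}. ennreal (cmod (f (unit_circle t * x)) powr a *
     (cmod x / cmod (unit_circle t * x - z)) *
     (((cmod x)\<^sup>2 - (cmod z)\<^sup>2) / (cmod x * cmod (unit_circle t * x - z))) ^ L) \<partial>lborel)"
proof -
  define \<rho> where "\<rho> = cmod x"
  have \<rho>: "\<rho> > 0" using z norm_ge_zero[of z] unfolding \<rho>_def by linarith
  define u where "u = x / \<rho>"
  have u: "cmod u = 1" using \<rho> by (simp add: u_def norm_divide) (simp add: \<rho>_def)
  have u0: "u \<noteq> 0" using u by auto
  define g where "g = (\<lambda>w. f (u * w))"
  have holg: "g holomorphic_on ball 0 R"
    unfolding g_def
    by (rule holomorphic_on_compose_gen[OF _ holf, unfolded o_def])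
       (auto intro!: holomorphic_intros simp: norm_mult u)
  have zu: "cmod (z / u) < \<rho>" using z u by (simp add: norm_divide \<rho>_def)
  have contf: "continuous_on (ball 0 R) f"
    using holf by (rule holomorphic_on_imp_continuous_on)
  define h where "h = (\<lambda>t. cmod (f (unit_circle t * x)) powr a *
     (cmod x / cmod (unit_circle t * x - z)) *
     (((cmod x)\<^sup>2 - (cmod z)\<^sup>2) / (cmod x * cmod (unit_circle t * x - z))) ^ L)"
  have dist: "cmod (\<rho> * unit_circle t - z / u) = cmod (unit_circle t * x - z)" for t
  proof -
    have "unit_circle t * x - z = u * (\<rho> * unit_circle t - z / u)"
      using u0 \<rho> by (simp add: u_def field_simps)
    then show ?thesis using u by (simp add: norm_mult)
  qed
  have ne: "cmod (unit_circle t * x - z) > 0" for t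
  proof -
    have "cmod (unit_circle t * x) \<noteq> cmod z" using z by (simp add: norm_mult)
    then have "unit_circle t * x \<noteq> z" by metis
    then show ?thesis by simp
  qed
  have g_eq: "g (\<rho> * unit_circle t) = f (unit_circle t * x)" for t
    unfolding g_def u_def using \<rho> by (simp add: mult_ac)
  have "continuous_on {0..1} h"
    unfolding h_def
    by (intro continuous_intros continuous_on_norm_powr a continuous_on_compose2[OF contf])
       (use ne x z \<rho> in \<open>auto simp: norm_mult \<rho>_def dest: less_imp_neq\<close>)
  then have hi: "(h has_integral integral {0..1} h) {0..1}"
    by (intro integrable_integral integrable_continuous_real)
  have zsq: "(cmod z)\<^sup>2 \<le> (cmod x)\<^sup>2"
    using z by (simp add: power_mono)
  have h0: "0 \<le> h t" for t
    unfolding h_def using zsq by simp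
  have "cmod (f z) powr a = cmod (g (z / u)) powr a"
    using u0 by (simp add: g_def)
  also have "\<dots> \<le> integral {0..1} (\<lambda>t. cmod (g (\<rho> * unit_circle t)) powr a *
     (\<rho> / cmod (\<rho> * unit_circle t - z / u)) *
     ((\<rho>\<^sup>2 - (cmod (z / u))\<^sup>2) / (\<rho> * cmod (\<rho> * unit_circle t - z / u))) ^ L)"
    by (rule subharmonic_kernel_bound[OF holg zu _ a]) (use x in \<open>simp add: \<rho>_def\<close>)
  also have "\<dots> = integral {0..1} h"
    unfolding dist g_eq h_def using u by (simp add: \<rho>_def norm_divide)
  finally have "ennreal (cmod (f z) powr a) \<le> ennreal (integral {0..1} h)"
    by (rule ennreal_leI)
  also have "\<dots> = (\<integral>\<^sup>+ t\<in>{0..1}. ennreal (h t) \<partial>lborel)"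
    using nn_integral_has_integral_lebesgue'[OF h0 hi] by simp
  finally show ?thesis unfolding h_def .
qed

section \<open>Area measure, rotations and dyadic annuli\<close>

text \<open>The measure \<open>dA\<close> on the Borel sets; \<^const>\<open>area_measure\<close> is its completion.\<close>

definition area :: "complex measure" where
  "area = density lborel (\<lambda>_. ennreal (1 / pi))"

lemma sets_area [simp, measurable_cong]: "sets area = sets borel"
  by (simp add: area_def)

lemma space_area [simp]: "space area = UNIV"
  by (simp add: area_def)

lemma borel_measurable_area [simp]: "borel_measurable area = borel_measurable borel"
  by (rule measurable_cong_sets) simp_all

lemma nn_integral_area:
  assumes [measurable]: "f \<in> borel_measurable borel"
  shows "(\<integral>\<^sup>+x. f x \<partial>area) = ennreal (1/pi) * (\<integral>\<^sup>+x. f x \<partial>lborel)"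
  unfolding area_def by (subst nn_integral_density) (auto simp: nn_integral_cmult)

interpretation area: sigma_finite_measure area
  unfolding area_def by (subst sigma_finite_measure.sigma_finite_iff_density_finite[OF sigma_finite_lborel]) auto

lemma emeasure_area_ball:
  assumes "r \<ge> 0"
  shows "emeasure area (ball c r) = ennreal (r\<^sup>2)"
proof -
  have "emeasure area (ball c r) = ennreal (1/pi) * emeasure lborel (ball c r)"
    using nn_integral_area[OF borel_measurable_indicator, of "ball c r"] by simp
  also have "\<dots> = ennreal (1/pi) * ennreal (pi * r\<^sup>2)"
    using assms by (simp add: emeasure_ball unit_ball_vol_2)
  also have "\<dots> = ennreal (r\<^sup>2)"
    by (simp add: ennreal_mult'[symmetric])
  finally show ?thesis .
qed

lemma nn_integral_lborel_translate:
  fixes f :: "complex \<Rightarrow> ennreal"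
  assumes [measurable]: "f \<in> borel_measurable borel"
  shows "(\<integral>\<^sup>+x. f (c + x) \<partial>lborel) = (\<integral>\<^sup>+x. f x \<partial>lborel)"
  using nn_integral_distr[of "(+) c" lborel borel f] by (simp add: lborel_distr_plus)

lemma nn_integral_lborel_reflect:
  fixes f :: "complex \<Rightarrow> ennreal"
  assumes [measurable]: "f \<in> borel_measurable borel"
  shows "(\<integral>\<^sup>+x. f (c - x) \<partial>lborel) = (\<integral>\<^sup>+x. f x \<partial>lborel)"
proof -
  have "(\<integral>\<^sup>+x. f x \<partial>lborel) = (\<integral>\<^sup>+x. f x \<partial>(distr lborel borel (\<lambda>x. c + (-1) *\<^sub>R x)))"
    using lborel_affine[of "-1" c] by (simp add: density_1)
  also have "\<dots> = (\<integral>\<^sup>+x. f (c - x) \<partial>lborel)"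
    by (subst nn_integral_distr) auto
  finally show ?thesis ..
qed

text \<open>A translation invariant measure is a multiple of Lebesgue measure: integrating \<open>1\<^sub>A(c x) 1\<^sub>B(y - c x)\<close>
  over \<open>x\<close> and \<open>y\<close> in both orders gives \<open>\<mu>(A) \<lambda>(B) = \<lambda>(A) \<mu>(B)\<close>, where \<open>\<mu>\<close> is the rotated measure \<open>\<lambda>\<close>. With \<open>B\<close> the unit
  disc, which the rotation preserves, the multiple is \<open>1\<close>.\<close>

lemma nn_integral_lborel_rotate_indicator:
  fixes c :: complex
  assumes c: "cmod c = 1" and [measurable]: "A \<in> sets borel"
  shows "(\<integral>\<^sup>+x. indicator A (c * x) \<partial>lborel) = emeasure lborel A"
proof -
  note Fubini' = lborel_pair.Fubini'[where 'a = complex and 'b = complex]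
  have c0: "c \<noteq> 0" using c by auto
  define B :: "complex set" where "B = ball 0 1"
  have [measurable]: "B \<in> sets borel" by (simp add: B_def)
  have Bc: "(\<integral>\<^sup>+x. indicator B (c * x) \<partial>lborel) = emeasure lborel B"
  proof -
    have "(\<lambda>x. indicator B (c * x) :: ennreal) = indicator B"
      using c by (auto simp: fun_eq_iff B_def norm_mult indicator_def)
    then show ?thesis by simp
  qed
  have Bpi: "emeasure lborel B = ennreal pi"
    by (simp add: B_def emeasure_ball unit_ball_vol_2)
  have "emeasure lborel B * (\<integral>\<^sup>+x. indicator A (c * x) \<partial>lborel)
      = (\<integral>\<^sup>+x. indicator A (c * x) * emeasure lborel B \<partial>lborel)"
    by (subst nn_integral_multc) (simp_all only: mult.commute, measurable)
  also have "\<dots> = (\<integral>\<^sup>+x. (\<integral>\<^sup>+y. indicator A (c * x) * indicator B (y - c * x) \<partial>lborel) \<partial>lborel)"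
  proof (rule nn_integral_cong)
    fix x :: complex
    have "(\<integral>\<^sup>+y. indicator B (y - c * x) \<partial>lborel) = emeasure lborel B"
      using nn_integral_lborel_translate[of "indicator B" "- c * x"] by simp
    then show "indicator A (c * x) * emeasure lborel B =
       (\<integral>\<^sup>+y. indicator A (c * x) * indicator B (y - c * x) \<partial>lborel)"
      by (simp add: nn_integral_cmult)
  qed
  also have "\<dots> = (\<integral>\<^sup>+y. (\<integral>\<^sup>+x. indicator A (c * x) * indicator B (y - c * x) \<partial>lborel) \<partial>lborel)"
    by (rule Fubini'[symmetric]) measurable
  also have "\<dots> = (\<integral>\<^sup>+y. (\<integral>\<^sup>+x. indicator A (y - c * x) * indicator B (c * x) \<partial>lborel) \<partial>lborel)"
  proof (rule nn_integral_cong)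
    fix y :: complex
    show "(\<integral>\<^sup>+x. indicator A (c * x) * indicator B (y - c * x) \<partial>lborel) =
       (\<integral>\<^sup>+x. indicator A (y - c * x) * indicator B (c * x) \<partial>lborel)"
      using nn_integral_lborel_reflect[of "\<lambda>x. indicator A (c * x) * indicator B (y - c * x)" "y / c"] c0
      by (simp add: right_diff_distrib)
  qed
  also have "\<dots> = (\<integral>\<^sup>+x. (\<integral>\<^sup>+y. indicator A (y - c * x) * indicator B (c * x) \<partial>lborel) \<partial>lborel)"
    by (rule Fubini') measurable
  also have "\<dots> = (\<integral>\<^sup>+x. emeasure lborel A * indicator B (c * x) \<partial>lborel)"
  proof (rule nn_integral_cong)
    fix x :: complex
    have "(\<integral>\<^sup>+y. indicator A (y - c * x) \<partial>lborel) = emeasure lborel A"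
      using nn_integral_lborel_translate[of "indicator A" "- c * x"] by simp
    then show "(\<integral>\<^sup>+y. indicator A (y - c * x) * indicator B (c * x) \<partial>lborel) =
       emeasure lborel A * indicator B (c * x)"
      by (simp add: nn_integral_multc)
  qed
  also have "\<dots> = emeasure lborel B * emeasure lborel A"
    using Bc by (subst nn_integral_cmult) (simp_all add: mult.commute)
  finally show ?thesis
    unfolding Bpi by (simp add: ennreal_mult_cancel_left)
qed

lemma nn_integral_area_rotate:
  assumes c: "cmod c = 1" and [measurable]: "f \<in> borel_measurable borel"
  shows "(\<integral>\<^sup>+x. f (c * x) \<partial>area) = (\<integral>\<^sup>+x. f x \<partial>area)"
proof -
  have "distr lborel borel (\<lambda>x. c * x) = lborel"
  proof (rule measure_eqI)
    fix A assume "A \<in> sets (distr lborel borel (\<lambda>x. c * x))"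
    then have [measurable]: "A \<in> sets borel" by simp
    have "emeasure (distr lborel borel (\<lambda>x. c * x)) A = (\<integral>\<^sup>+x. indicator A (c * x) \<partial>lborel)"
    proof -
      have "emeasure (distr lborel borel (\<lambda>x. c * x)) A = (\<integral>\<^sup>+x. indicator A x \<partial>(distr lborel borel (\<lambda>x. c * x)))"
        by simp
      also have "\<dots> = (\<integral>\<^sup>+x. indicator A (c * x) \<partial>lborel)"
        by (rule nn_integral_distr) measurable
      finally show ?thesis .
    qed
    then show "emeasure (distr lborel borel (\<lambda>x. c * x)) A = emeasure lborel A"
      using nn_integral_lborel_rotate_indicator[OF c] by simp
  qed simp
  moreover have "(\<integral>\<^sup>+x. f x \<partial>(distr lborel borel (\<lambda>x. c * x))) = (\<integral>\<^sup>+x. f (c * x) \<partial>lborel)"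
    by (subst nn_integral_distr) auto
  ultimately show ?thesis by (simp add: nn_integral_area)
qed

lemma measurable_unit_circle [measurable]: "unit_circle \<in> borel_measurable borel"
  by (intro borel_measurable_continuous_onI continuous_intros)

text \<open>A radial weight allows one to replace a function by its means over circles.\<close>

lemma nn_integral_area_rotation_average:
  assumes [measurable]: "n \<in> borel_measurable borel" "f \<in> borel_measurable borel"
  shows "(\<integral>\<^sup>+x. n (cmod x) * (\<integral>\<^sup>+t\<in>{0..1}. f (unit_circle t * x) \<partial>lborel) \<partial>area)
     = (\<integral>\<^sup>+x. n (cmod x) * f x \<partial>area)"
proof -
  interpret pair_sigma_finite "lborel :: real measure" area ..
  have "(\<integral>\<^sup>+x. n (cmod x) * (\<integral>\<^sup>+t\<in>{0..1}. f (unit_circle t * x) \<partial>lborel) \<partial>area)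
     = (\<integral>\<^sup>+x. (\<integral>\<^sup>+t. n (cmod x) * (f (unit_circle t * x) * indicator {0..1} t) \<partial>lborel) \<partial>area)"
    by (simp add: nn_integral_cmult)
  also have "\<dots> = (\<integral>\<^sup>+t. (\<integral>\<^sup>+x. n (cmod x) * (f (unit_circle t * x) * indicator {0..1} t) \<partial>area) \<partial>lborel)"
    by (rule Fubini') measurable
  also have "\<dots> = (\<integral>\<^sup>+t. (\<integral>\<^sup>+x. n (cmod x) * f x \<partial>area) * indicator {0..1::real} t \<partial>lborel)"
  proof (intro nn_integral_cong)
    fix t :: real
    have "(\<integral>\<^sup>+x. n (cmod x) * f (unit_circle t * x) \<partial>area) = (\<integral>\<^sup>+x. n (cmod x) * f x \<partial>area)"
      using nn_integral_area_rotate[of "unit_circle t" "\<lambda>x. n (cmod x) * f x"] by (simp add: norm_mult)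
    then show "(\<integral>\<^sup>+x. n (cmod x) * (f (unit_circle t * x) * indicator {0..1} t) \<partial>area) =
       (\<integral>\<^sup>+x. n (cmod x) * f x \<partial>area) * indicator {0..1} t"
      by (simp add: nn_integral_multc mult.assoc[symmetric])
  qed
  also have "\<dots> = (\<integral>\<^sup>+x. n (cmod x) * f x \<partial>area)"
    by (simp add: nn_integral_cmult)
  finally show ?thesis .
qed

text \<open>Polar coordinates for radial functions: both sides are integrals of \<open>h\<close> with respect to measures on the
  line, which agree because a disc of radius \<open>r\<close> has normalised area \<open>r\<^sup>2\<close>.\<close>

lemma nn_integral_area_radial:
  assumes [measurable]: "h \<in> borel_measurable borel"
  shows "(\<integral>\<^sup>+x\<in>ball 0 1. h (cmod x) \<partial>area) = (\<integral>\<^sup>+r\<in>{0<..<1}. ennreal (2 * r) * h r \<partial>lborel)"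
proof -
  let ?M = "distr (density area (indicator (ball 0 1))) borel cmod"
  let ?N = "density lborel (\<lambda>r. ennreal (2 * r) * indicator {0<..<1} r)"
  have M: "emeasure ?M {a<..} = ennreal (1 - (max a 0)\<^sup>2)" if "a \<le> 1" for a
  proof -
    have "emeasure ?M {a<..} = (\<integral>\<^sup>+x. indicator (ball 0 1) x * indicator (cmod -` {a<..}) x \<partial>area)"
      by (subst emeasure_distr, measurable, subst emeasure_density)
         (auto simp: measurable_sets_borel[of cmod borel] intro!: borel_measurable_indicator)
    also have "\<dots> = (\<integral>\<^sup>+x. indicator (ball 0 1 - cball 0 a) x \<partial>area)"
      by (intro nn_integral_cong) (auto simp: indicator_def)
    also have "\<dots> = emeasure area (ball 0 1 - cball 0 a)" by simp
    also have "\<dots> = emeasure area (ball 0 1) - emeasure area (cball 0 a)"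
    proof (cases "a < 1")
      case True
      then have "cball (0::complex) a \<subseteq> ball 0 1" by auto
      moreover have "emeasure area (cball 0 a) \<noteq> \<infinity>"
        using emeasure_mono[OF \<open>cball (0::complex) a \<subseteq> ball 0 1\<close>, of area] emeasure_area_ball[of 1 0]
        by (auto simp: top_unique)
      ultimately show ?thesis by (intro emeasure_Diff) auto
    next
      case False
      then have a: "a = 1" using that by simp
      have e: "ball 0 1 - cball 0 a = ({} :: complex set)" using a by auto
      have "emeasure area (ball 0 1) \<le> emeasure area (cball 0 a)"
        using a by (intro emeasure_mono) auto
      then have "emeasure area (ball 0 1) - emeasure area (cball 0 a) = 0"
        using emeasure_area_ball[of 1 0] by (intro diff_eq_0_ennreal) auto
      then show ?thesis by (simp only: e emeasure_empty)
    qed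
    also have "emeasure area (cball 0 a) = ennreal ((max a 0)\<^sup>2)"
    proof (cases "a \<ge> 0")
      case True
      have "emeasure area (cball 0 a) = ennreal (1/pi) * emeasure lborel (cball (0::complex) a)"
        using nn_integral_area[OF borel_measurable_indicator, of "cball 0 a"] by simp
      also have "\<dots> = ennreal (a\<^sup>2)"
        using True by (simp add: emeasure_cball unit_ball_vol_2 ennreal_mult'[symmetric])
      finally show ?thesis using True by (simp add: max_def)
    qed (simp add: max_def)
    finally show ?thesis
      by (simp add: emeasure_area_ball ennreal_minus flip: ennreal_1)
  qed
  have M1: "emeasure ?M {a<..} = 0" if "a > 1" for a
  proof -
    have "emeasure ?M {a<..} \<le> emeasure ?M {1<..}"
      using that by (intro emeasure_mono) auto
    then show ?thesis using M[of 1] by simp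
  qed
  have N: "emeasure ?N {a<..} = ennreal (1 - (max a 0)\<^sup>2)" if "a \<le> 1" for a
  proof -
    have "emeasure ?N {a<..} = (\<integral>\<^sup>+r. ennreal (2 * r) * indicator {0<..<1} r * indicator {a<..} r \<partial>lborel)"
      by (subst emeasure_density) auto
    also have "\<dots> = (\<integral>\<^sup>+r. ennreal (2 * r) * indicator {max a 0..1} r \<partial>lborel)"
    proof (intro nn_integral_cong_AE)
      have "AE r in lborel. r \<noteq> max a 0" "AE r in lborel. r \<noteq> (1::real)"
        by (rule AE_lborel_singleton)+
      then show "AE r in lborel. ennreal (2 * r) * indicator {0<..<1} r * indicator {a<..} r =
         ennreal (2 * r) * indicator {max a 0..1} r"
        by eventually_elim (auto simp: indicator_def)
    qed
    also have "\<dots> = ennreal (1\<^sup>2 - (max a 0)\<^sup>2)"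
      using that by (intro nn_integral_FTC_Icc) (auto intro!: derivative_eq_intros simp: max_def split: if_splits)
    finally show ?thesis by simp
  qed
  have N1: "emeasure ?N {a<..} = 0" if "a > 1" for a
  proof -
    have "emeasure ?N {a<..} \<le> emeasure ?N {1<..}"
      using that by (intro emeasure_mono) auto
    then show ?thesis using N[of 1] by simp
  qed
  have "?M = ?N"
  proof (rule measure_eqI_lessThan)
    fix a :: real
    show "emeasure ?M {a<..} < \<infinity>"
      by (cases "a \<le> 1") (auto simp: M M1)
    show "emeasure ?M {a<..} = emeasure ?N {a<..}"
      by (cases "a \<le> 1") (auto simp: M M1 N N1)
  qed auto
  then have "(\<integral>\<^sup>+r. h r \<partial>?M) = (\<integral>\<^sup>+r. h r \<partial>?N)" by simp
  moreover have "(\<integral>\<^sup>+r. h r \<partial>?M) = (\<integral>\<^sup>+x\<in>ball 0 1. h (cmod x) \<partial>area)"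
    by (subst nn_integral_distr, simp, simp, subst nn_integral_density)
       (auto simp: mult.commute intro!: borel_measurable_indicator)
  moreover have "(\<integral>\<^sup>+r. h r \<partial>?N) = (\<integral>\<^sup>+r\<in>{0<..<1}. ennreal (2 * r) * h r \<partial>lborel)"
    by (subst nn_integral_density) (auto simp: mult_ac)
  ultimately show ?thesis by simp
qed

lemma ennreal_le_suminf: "f n \<le> (\<Sum>n. f n)" for f :: "nat \<Rightarrow> ennreal"
proof -
  have "sum f {n} \<le> suminf f" by (rule sum_le_suminf) auto
  then show ?thesis by simp
qed

text \<open>On the annulus \<open>2\<^sup>n r \<le> |y - x| < 2\<^sup>n\<^sup>+\<^sup>1 r\<close> the integrand is at most \<open>2\<^sup>-\<^sup>n\<^sup>e\<close>.\<close>

lemma nn_integral_dyadic: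
  fixes x :: complex
  assumes [measurable_cong]: "sets M = sets borel" and r: "r > 0" and e: "e > 0"
  shows "(\<integral>\<^sup>+y. ennreal ((r / cmod (y - x)) powr e) * indicator {y. r \<le> cmod (y - x)} y \<partial>M)
     \<le> (\<Sum>n. ennreal (2 powr (- (real n * e))) * emeasure M (ball x (2 ^ (n + 1) * r)))"
proof -
  have [measurable]: "ball x s \<in> sets M" for s by (simp add: assms(1))
  have "(\<integral>\<^sup>+y. ennreal ((r / cmod (y - x)) powr e) * indicator {y. r \<le> cmod (y - x)} y \<partial>M)
     \<le> (\<integral>\<^sup>+y. (\<Sum>n. ennreal (2 powr (- (real n * e))) * indicator (ball x (2 ^ (n + 1) * r)) y) \<partial>M)"
  proof (intro nn_integral_mono)
    fix y
    show "ennreal ((r / cmod (y - x)) powr e) * indicator {y. r \<le> cmod (y - x)} y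
       \<le> (\<Sum>n. ennreal (2 powr (- (real n * e))) * indicator (ball x (2 ^ (n + 1) * r)) y)"
    proof (cases "r \<le> cmod (y - x)")
      case True
      define q where "q = cmod (y - x) / r"
      have q: "q \<ge> 1" using True r by (simp add: q_def)
      define n where "n = nat \<lfloor>log 2 q\<rfloor>"
      have l: "log 2 q \<ge> 0" using q by simp
      have n: "real n \<le> log 2 q" "log 2 q < real (n + 1)"
        using l unfolding n_def by linarith+
      have q1: "2 powr real n \<le> q"
        using n(1) q by (simp add: le_log_iff)
      have q2: "q < 2 ^ (n + 1)"
      proof -
        have "q < 2 powr real (n + 1)" using n(2) q by (subst (asm) log_less_iff) auto
        then show ?thesis by (subst (asm) powr_realpow) auto
      qed
      have mem: "y \<in> ball x (2 ^ (n + 1) * r)"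
        using q2 r by (simp add: q_def dist_norm norm_minus_commute pos_divide_less_eq)
      have "(r / cmod (y - x)) powr e = (1 / q) powr e" by (simp add: q_def)
      also have "\<dots> \<le> (2 powr - real n) powr e"
        using q1 q e by (intro powr_mono2) (auto simp: powr_minus field_simps)
      also have "\<dots> = 2 powr (- (real n * e))" by (simp add: powr_powr)
      finally have "ennreal ((r / cmod (y - x)) powr e) \<le> ennreal (2 powr (- (real n * e))) * indicator (ball x (2 ^ (n + 1) * r)) y"
        using mem by (simp add: ennreal_leI)
      also have "\<dots> \<le> (\<Sum>n. ennreal (2 powr (- (real n * e))) * indicator (ball x (2 ^ (n + 1) * r)) y)"
        by (rule ennreal_le_suminf)
      finally show ?thesis using True by simp
    qed simp
  qed
  also have "\<dots> = (\<Sum>n. (\<integral>\<^sup>+y. ennreal (2 powr (- (real n * e))) * indicator (ball x (2 ^ (n + 1) * r)) y \<partial>M))"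
    by (intro nn_integral_suminf) measurable
  also have "\<dots> = (\<Sum>n. ennreal (2 powr (- (real n * e))) * emeasure M (ball x (2 ^ (n + 1) * r)))"
    by (subst nn_integral_cmult_indicator) auto
  finally show ?thesis .
qed

text \<open>The dyadic pieces have area about \<open>4\<^sup>n g\<^sup>2\<close>, so the sum is geometric precisely for \<open>e > 2\<close>.\<close>

lemma nn_integral_area_kernel_tail:
  assumes g: "0 < g" and e: "2 < e"
  shows "(\<integral>\<^sup>+z. ennreal ((g / cmod (z - y)) powr e) * indicator {z. g \<le> cmod (z - y)} z \<partial>area)
    \<le> ennreal (4 / (1 - 2 powr (2 - e)) * g\<^sup>2)"
proof -
  define d where "d = 2 powr (2 - e)"
  have d: "0 < d" "d < 1" using e by (auto simp: d_def powr_less_one)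
  have "(\<integral>\<^sup>+z. ennreal ((g / cmod (z - y)) powr e) * indicator {z. g \<le> cmod (z - y)} z \<partial>area) \<le>
     (\<Sum>k. ennreal (2 powr (- (real k * e))) * emeasure area (ball y (2 ^ (k + 1) * g)))"
    by (rule nn_integral_dyadic) (use g e in auto)
  also have "\<dots> \<le> (\<Sum>k. ennreal (4 * g\<^sup>2 * d ^ k))"
  proof (intro suminf_le)
    fix k
    have "2 powr (- (real k * e)) * (2 ^ (k + 1) * g)\<^sup>2 = 4 * g\<^sup>2 * d ^ k"
    proof -
      have "2 powr (- (real k * e)) = (2 powr (- 2)) ^ k * d ^ k"
        by (simp add: d_def powr_realpow[symmetric] powr_powr powr_add[symmetric] algebra_simps)
      moreover have "((2::real) powr (- 2)) ^ k * (2 ^ k)\<^sup>2 = 1"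
      proof -
        have "(2 ^ k)\<^sup>2 = ((2::real)\<^sup>2) ^ k" by (simp only: power_mult[symmetric] mult.commute)
        then have "((2::real) powr (- 2)) ^ k * (2 ^ k)\<^sup>2 = (2 powr (- 2) * 2\<^sup>2) ^ k"
          by (simp only: power_mult_distrib)
        then show ?thesis by (simp add: powr_minus)
      qed
      moreover have "2 powr (- (real k * e)) * (2 ^ (k + 1) * g)\<^sup>2 = 2 powr (- (real k * e)) * (2 ^ k)\<^sup>2 * (4 * g\<^sup>2)"
        by (simp add: power_mult_distrib)
      ultimately show ?thesis by (simp add: mult_ac)
    qed
    then show "ennreal (2 powr (- (real k * e))) * emeasure area (ball y (2 ^ (k + 1) * g)) \<le> ennreal (4 * g\<^sup>2 * d ^ k)"
      using g by (subst emeasure_area_ball) (auto simp: ennreal_mult'[symmetric] ennreal_leI)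
  qed auto
  also have "(\<Sum>k. ennreal (4 * g\<^sup>2 * d ^ k)) = ennreal (\<Sum>k. 4 * g\<^sup>2 * d ^ k)"
    using d by (intro suminf_ennreal2 summable_mult summable_geometric) auto
  also have "(\<Sum>k. 4 * g\<^sup>2 * d ^ k) = 4 / (1 - d) * g\<^sup>2"
    using d by (subst suminf_mult) (auto simp: suminf_geometric)
  finally show ?thesis unfolding d_def .
qed

section \<open>Mean values over discs\<close>

lemma holomorphic_borel_measurable_on_open:
  assumes "f holomorphic_on S" "open S"
  shows "(\<lambda>x. f x * indicator S x) \<in> borel_measurable borel"
proof -
  have "(\<lambda>x. indicator S x *\<^sub>R f x) \<in> borel_measurable borel"
    using assms by (intro borel_measurable_continuous_on_indicator holomorphic_on_imp_continuous_on) auto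
  then show ?thesis
    by (rule back_subst[of "\<lambda>g. g \<in> borel_measurable borel"]) (auto simp: indicator_def)
qed

lemma nn_integral_area_translate:
  assumes [measurable]: "f \<in> borel_measurable borel"
  shows "(\<integral>\<^sup>+x. f (c + x) \<partial>area) = (\<integral>\<^sup>+x. f x \<partial>area)"
  by (simp add: nn_integral_area nn_integral_lborel_translate)

text \<open>The circle means of the previous section, with \<open>z\<close> the centre and no peaking factor, integrated over all
  radii below \<open>R\<close>.\<close>

lemma area_submean:
  assumes holf: "f holomorphic_on ball c R" and R: "R > 0" and p: "p > 0"
  shows "ennreal (cmod (f c) powr p * R\<^sup>2) \<le> (\<integral>\<^sup>+x\<in>ball c R. ennreal (cmod (f x) powr p) \<partial>area)"
proof -
  define g where "g = (\<lambda>x. f (c + x) * indicator (ball 0 R) x)"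
  have holg: "(\<lambda>x. f (c + x)) holomorphic_on ball 0 R"
    by (rule holomorphic_on_compose_gen[OF _ holf, unfolded o_def])
       (auto intro!: holomorphic_intros simp: dist_norm)
  have [measurable]: "g \<in> borel_measurable borel"
    unfolding g_def by (rule holomorphic_borel_measurable_on_open[OF holg]) simp
  have "ennreal (cmod (f c) powr p * R\<^sup>2) = ennreal (cmod (f c) powr p) * emeasure area (ball 0 R)"
    using R by (simp add: emeasure_area_ball ennreal_mult)
  also have "\<dots> = (\<integral>\<^sup>+x. ennreal (cmod (f c) powr p) * indicator (ball 0 R) x \<partial>area)"
    by (simp add: nn_integral_cmult_indicator)
  also have "\<dots> \<le> (\<integral>\<^sup>+x. indicator {r. r < R} (cmod x) *
        (\<integral>\<^sup>+t\<in>{0..1}. ennreal (cmod (g (unit_circle t * x)) powr p) \<partial>lborel) \<partial>area)"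
  proof (rule nn_integral_mono_AE)
    have "emeasure area {0} = 0"
      using nn_integral_area[OF borel_measurable_indicator, of "{0}"] by simp
    then have "AE x in area. x \<noteq> 0"
      by (intro AE_I[of _ _ "{0}"]) auto
    then show "AE x in area. ennreal (cmod (f c) powr p) * indicator (ball 0 R) x
       \<le> indicator {r. r < R} (cmod x) *
        (\<integral>\<^sup>+t\<in>{0..1}. ennreal (cmod (g (unit_circle t * x)) powr p) \<partial>lborel)"
    proof eventually_elim
      case (elim x)
      show ?case
      proof (cases "cmod x < R")
        case True
        have "ennreal (cmod (f (c + 0)) powr p) \<le> (\<integral>\<^sup>+t\<in>{0..1}. ennreal (cmod (f (c + unit_circle t * x)) powr p *
           (cmod x / cmod (unit_circle t * x - 0)) * (((cmod x)\<^sup>2 - (cmod 0)\<^sup>2) /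
           (cmod x * cmod (unit_circle t * x - 0))) ^ 0) \<partial>lborel)"
          using True elim by (intro subharmonic_rotation_mean[OF holg _ _ p]) auto
        also have "\<dots> = (\<integral>\<^sup>+t\<in>{0..1}. ennreal (cmod (g (unit_circle t * x)) powr p) \<partial>lborel)"
          using True elim by (intro nn_integral_cong) (auto simp: g_def norm_mult indicator_def)
        finally show ?thesis using True by simp
      qed simp
    qed
  qed
  also have "\<dots> = (\<integral>\<^sup>+x. indicator {r. r < R} (cmod x) * ennreal (cmod (g x) powr p) \<partial>area)"
    by (rule nn_integral_area_rotation_average) measurable
  also have "\<dots> = (\<integral>\<^sup>+x. ennreal (cmod (g x) powr p) \<partial>area)"
    using p by (intro nn_integral_cong) (auto simp: g_def indicator_def)
  also have "\<dots> = (\<integral>\<^sup>+x. ennreal (cmod (g (- c + x)) powr p) \<partial>area)"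
    by (rule nn_integral_area_translate[symmetric]) measurable
  also have "\<dots> = (\<integral>\<^sup>+x\<in>ball c R. ennreal (cmod (f x) powr p) \<partial>area)"
    using p by (intro nn_integral_cong) (auto simp: g_def indicator_def dist_norm norm_minus_commute)
  finally show ?thesis .
qed

text \<open>The Cauchy inequality on the circle of radius \<open>R/2\<close>, where \<open>f\<close> is bounded by means over discs of radius \<open>R/2\<close>.\<close>

lemma area_submean_deriv:
  fixes p :: real
  assumes p: "p > 0"
  obtains C :: real where "C > 0"
    "\<And>f c R. f holomorphic_on ball c R \<Longrightarrow> R > 0 \<Longrightarrow>
       ennreal (cmod ((deriv ^^ k) f c) powr p * R powr (real k * p)) * ennreal (R\<^sup>2)
         \<le> ennreal C * (\<integral>\<^sup>+x\<in>ball c R. ennreal (cmod (f x) powr p) \<partial>area)"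
proof
  define C :: real where "C = 4 * (fact k * 2 ^ k) powr p"
  show "C > 0" by (simp add: C_def)
  fix f :: "complex \<Rightarrow> complex" and c :: complex and R :: real
  assume holf: "f holomorphic_on ball c R" and R: "R > 0"
  define I where "I = (\<integral>\<^sup>+x\<in>ball c R. ennreal (cmod (f x) powr p) \<partial>area)"
  show "ennreal (cmod ((deriv ^^ k) f c) powr p * R powr (real k * p)) * ennreal (R\<^sup>2) \<le> ennreal C * I"
  proof (cases "I = top")
    case True
    then show ?thesis using \<open>C > 0\<close> by (simp add: ennreal_mult_top)
  next
    case False
    define J where "J = enn2real I"
    have J: "I = ennreal J" "J \<ge> 0" using False by (simp_all add: J_def less_top)
    define B where "B = (4 * J / R\<^sup>2) powr (1 / p)"
    have bd: "cmod (f x) \<le> B" if x: "cmod (c - x) = R / 2" for x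
    proof -
      have sub: "ball x (R/2) \<subseteq> ball c R"
      proof
        fix y assume "y \<in> ball x (R/2)"
        then have "dist x y < R / 2" by simp
        with dist_triangle[of c y x] x show "y \<in> ball c R" by (simp add: dist_norm)
      qed
      have "ennreal (cmod (f x) powr p * (R/2)\<^sup>2) \<le> (\<integral>\<^sup>+x\<in>ball x (R/2). ennreal (cmod (f x) powr p) \<partial>area)"
        using R by (intro area_submean p holomorphic_on_subset[OF holf] sub) auto
      also have "\<dots> \<le> I"
        unfolding I_def using sub by (intro nn_integral_mono) (auto simp: indicator_def)
      finally have "cmod (f x) powr p * (R/2)\<^sup>2 \<le> J" using J by simp
      then have "cmod (f x) powr p \<le> 4 * J / R\<^sup>2"
        using R by (simp add: field_simps power2_eq_square)
      then have "(cmod (f x) powr p) powr (1/p) \<le> B"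
        unfolding B_def using p by (intro powr_mono2) auto
      then show ?thesis using p by (simp add: powr_powr)
    qed
    have "cmod ((deriv ^^ k) f c) \<le> fact k * B / (R/2)^k"
      using R holf
      by (intro Cauchy_inequality bd continuous_on_subset[OF holomorphic_on_imp_continuous_on[OF holf]]
          holomorphic_on_subset[OF holf]) auto
    also have "\<dots> = fact k * 2 ^ k * B / R powr real k"
      using R by (simp add: power_divide powr_realpow)
    finally have "cmod ((deriv ^^ k) f c) * R powr real k \<le> fact k * 2 ^ k * B"
      using R by (simp add: pos_le_divide_eq)
    then have "(cmod ((deriv ^^ k) f c) * R powr real k) powr p \<le> (fact k * 2 ^ k * B) powr p"
      using p by (intro powr_mono2) auto
    then have "cmod ((deriv ^^ k) f c) powr p * R powr (real k * p) \<le> (fact k * 2 ^ k) powr p * B powr p"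
      by (simp add: powr_mult powr_powr B_def)
    also have "B powr p = 4 * J / R\<^sup>2"
      using p J by (simp add: B_def powr_powr)
    finally have "cmod ((deriv ^^ k) f c) powr p * R powr (real k * p) * R\<^sup>2 \<le> C * J"
      using R by (simp add: C_def field_simps)
    then show ?thesis
      using J \<open>C > 0\<close> by (simp add: ennreal_mult'[symmetric] ennreal_leI)
  qed
qed

section \<open>Arcs of the unit circle\<close>

lemma chord_length: "cmod (cis a - cis b) = 2 * \<bar>sin ((a - b) / 2)\<bar>"
proof -
  define c where "c = (a - b) / 2"
  have ab: "a - b = 2 * c" by (simp add: c_def)
  have "(cmod (cis a - cis b))\<^sup>2 = (cos a - cos b)\<^sup>2 + (sin a - sin b)\<^sup>2"
    by (simp add: cmod_power2)
  also have "\<dots> = ((cos a)\<^sup>2 + (sin a)\<^sup>2) + ((cos b)\<^sup>2 + (sin b)\<^sup>2) - 2 * (cos a * cos b + sin a * sin b)"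
    by (simp add: power2_eq_square algebra_simps)
  also have "\<dots> = 2 - 2 * cos (2 * c)"
    using cos_diff[of a b] ab by simp
  also have "\<dots> = (2 * \<bar>sin c\<bar>)\<^sup>2"
    by (subst cos_double_sin) (simp add: power_mult_distrib)
  finally show ?thesis unfolding c_def
    by (rule power2_eq_imp_eq) auto
qed

text \<open>A crude form of Jordan's inequality.\<close>

lemma sin_ge_half:
  assumes "0 \<le> x" "x \<le> pi / 2"
  shows "x / 2 \<le> sin x"
proof (cases "x \<le> pi / 3")
  case True
  have "sin 0 - 0 / 2 \<le> sin x - x / 2"
  proof (rule DERIV_nonneg_imp_nondecreasing[OF assms(1)])
    fix y :: real assume y: "0 \<le> y" "y \<le> x"
    have "cos (pi / 3) \<le> cos y"
      using y True by (intro cos_monotone_0_pi_le) auto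
    then have "0 \<le> cos y - 1 / 2" by (simp add: cos_60)
    then show "\<exists>D. ((\<lambda>x. sin x - x / 2) has_real_derivative D) (at y) \<and> 0 \<le> D"
      by (intro exI[of _ "cos y - 1 / 2"]) (auto intro!: derivative_eq_intros)
  qed
  then show ?thesis by simp
next
  case False
  have "sin (pi / 3) \<le> sin x"
    using False assms by (intro sin_monotone_2pi_le) auto
  moreover have "sqrt 3 \<ge> 1.6" by (rule real_le_rsqrt) (simp add: power2_eq_square)
  ultimately show ?thesis
    using assms pi_less_4 pi_approx by (simp add: sin_60)
qed

lemma unit_circle_dist_upper: "cmod (unit_circle t - unit_circle t') \<le> 7 * \<bar>t - t'\<bar>"
proof -
  have "cmod (unit_circle t - unit_circle t') = 2 * \<bar>sin (pi * (t - t'))\<bar>"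
    by (simp add: unit_circle_def chord_length right_diff_distrib[symmetric])
  also have "\<dots> \<le> 2 * (pi * \<bar>t - t'\<bar>)"
    using abs_sin_x_le_abs_x[of "pi * (t - t')"] by (simp add: abs_mult)
  also have "\<dots> = (2 * pi) * \<bar>t - t'\<bar>" by simp
  also have "\<dots> \<le> 7 * \<bar>t - t'\<bar>"
    using pi_approx by (intro mult_right_mono) auto
  finally show ?thesis .
qed

lemma unit_circle_dist_lower:
  assumes "t \<in> {0..1}" "t' \<in> {0..1}"
  shows "3 * min \<bar>t - t'\<bar> (1 - \<bar>t - t'\<bar>) \<le> cmod (unit_circle t - unit_circle t')"
proof -
  define d where "d = \<bar>t - t'\<bar>"
  define m where "m = min d (1 - d)"
  have d: "0 \<le> d" "d \<le> 1" using assms by (auto simp: d_def)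
  then have m: "0 \<le> m" "m \<le> 1/2" unfolding m_def min_def by auto
  have "\<bar>sin (pi * (t - t'))\<bar> = sin (pi * d)"
  proof -
    have "0 \<le> sin (pi * d)" using d by (intro sin_ge_zero) (auto simp: mult_left_le)
    moreover have "sin (pi * d) = sin (pi * (t - t')) \<or> sin (pi * d) = - sin (pi * (t - t'))"
    proof -
      have "d = t - t' \<or> d = - (t - t')" by (auto simp: d_def abs_if)
      then show ?thesis by (elim disjE) (simp_all only: mult_minus_right sin_minus simp_thms)
    qed
    ultimately show ?thesis by auto
  qed
  also have "sin (pi * d) = sin (pi * m)"
    by (auto simp: m_def min_def right_diff_distrib)
  finally have eq: "cmod (unit_circle t - unit_circle t') = 2 * sin (pi * m)"
    by (simp add: unit_circle_def chord_length right_diff_distrib[symmetric])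
  have "pi * m / 2 \<le> sin (pi * m)"
    using m by (intro sin_ge_half) auto
  moreover have "3 * m \<le> pi * m"
    using m pi_approx by (intro mult_right_mono) auto
  ultimately show ?thesis unfolding eq by (simp add: m_def d_def)
qed

text \<open>Any two parameters in the set differ by less than \<open>2 s\<close> modulo \<open>1\<close>, so the set lies in an interval of length
  \<open>4 s\<close> and two end pieces of length \<open>2 s\<close>.\<close>

lemma rotation_arc_upper:
  assumes x: "1 / 2 \<le> cmod x" and s: "0 \<le> s"
  shows "(\<integral>\<^sup>+t\<in>{0..1}. indicator (ball z s) (unit_circle t * x) \<partial>lborel) \<le> ennreal (8 * s)"
proof (cases "\<exists>t0\<in>{0..1}. unit_circle t0 * x \<in> ball z s")
  case False
  then have "(\<integral>\<^sup>+t\<in>{0..1}. indicator (ball z s) (unit_circle t * x) \<partial>lborel) = (\<integral>\<^sup>+t. 0 \<partial>(lborel :: real measure))"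
    by (intro nn_integral_cong) (auto simp: indicator_def)
  then show ?thesis by simp
next
  case True
  then obtain t0 where t0: "t0 \<in> {0..1}" "unit_circle t0 * x \<in> ball z s" by blast
  define U where "U = {t0 - 2 * s..t0 + 2 * s} \<union> {0..max 0 (t0 - 1 + 2 * s)} \<union> {min 1 (t0 + 1 - 2 * s)..1}"
  have "(\<integral>\<^sup>+t\<in>{0..1}. indicator (ball z s) (unit_circle t * x) \<partial>lborel) \<le> (\<integral>\<^sup>+t. indicator U t \<partial>lborel)"
  proof (intro nn_integral_mono)
    fix t :: real
    show "indicator (ball z s) (unit_circle t * x) * indicator {0..1} t \<le> (indicator U t :: ennreal)"
    proof (cases "t \<in> {0..1} \<and> unit_circle t * x \<in> ball z s")
      case True
      have "dist (unit_circle t * x) (unit_circle t0 * x) < s + s"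
        using True t0 dist_triangle_less_add[of "unit_circle t * x" z s "unit_circle t0 * x" s]
        by (simp add: dist_commute)
      also have "dist (unit_circle t * x) (unit_circle t0 * x) = cmod (unit_circle t - unit_circle t0) * cmod x"
        by (simp add: dist_norm left_diff_distrib[symmetric] norm_mult)
      finally have "cmod (unit_circle t - unit_circle t0) * cmod x < 2 * s" by simp
      moreover have "cmod (unit_circle t - unit_circle t0) * (1/2) \<le> cmod (unit_circle t - unit_circle t0) * cmod x"
        using x by (intro mult_left_mono) auto
      ultimately have "cmod (unit_circle t - unit_circle t0) < 4 * s" by simp
      with unit_circle_dist_lower[of t t0] True t0(1)
      have m: "min \<bar>t - t0\<bar> (1 - \<bar>t - t0\<bar>) < 2 * s" using s by auto
      have "t \<in> U"
        using m True t0(1) unfolding U_def by (auto simp: min_def max_def abs_if split: if_splits)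
      then show ?thesis by (simp add: indicator_def)
    qed (auto simp: indicator_def)
  qed
  also have "\<dots> = emeasure lborel U" by (simp add: U_def)
  also have "\<dots> \<le> emeasure lborel {t0 - 2 * s..t0 + 2 * s} + emeasure lborel {0..max 0 (t0 - 1 + 2 * s)}
      + emeasure lborel {min 1 (t0 + 1 - 2 * s)..1}"
    unfolding U_def
    by (intro order_trans[OF emeasure_subadditive] add_right_mono emeasure_subadditive) auto
  also have "\<dots> = ennreal (4 * s + max 0 (t0 - 1 + 2 * s) + (1 - min 1 (t0 + 1 - 2 * s)))"
    using s by (simp add: ennreal_plus[symmetric] del: ennreal_plus)
  also have "\<dots> \<le> ennreal (8 * s)"
    using t0(1) s by (intro ennreal_leI) (auto simp: max_def min_def)
  finally show ?thesis .
qed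

text \<open>The interval of radius \<open>d\<close> about \<open>t0\<close> may stick out of \<open>[0,1]\<close>, but at least on one side it does not.\<close>

lemma rotation_arc_lower:
  assumes "t0 \<in> {0..1}" "0 \<le> d" "d \<le> 1"
    and "\<And>t. t \<in> {0..1} \<Longrightarrow> \<bar>t - t0\<bar> \<le> d \<Longrightarrow> unit_circle t * x \<in> E"
  shows "ennreal d \<le> (\<integral>\<^sup>+t\<in>{0..1}. indicator E (unit_circle t * x) \<partial>lborel)"
proof -
  have "ennreal d \<le> emeasure lborel {max 0 (t0 - d)..min 1 (t0 + d)}"
    using assms(1-3) by (auto simp: max_def min_def intro!: ennreal_leI)
  also have "\<dots> = (\<integral>\<^sup>+t. indicator {max 0 (t0 - d)..min 1 (t0 + d)} t \<partial>lborel)" by simp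
  also have "\<dots> \<le> (\<integral>\<^sup>+t\<in>{0..1}. indicator E (unit_circle t * x) \<partial>lborel)"
    using assms(4) by (intro nn_integral_mono) (auto simp: indicator_def)
  finally show ?thesis .
qed

lemma rotate_onto_ray:
  obtains t0 where "t0 \<in> {0..1}" "unit_circle t0 * x * of_real (cmod z) = of_real (cmod x) * z"
proof -
  have "\<exists>t0\<in>{0..1}. unit_circle t0 = c" if "cmod c = 1" for c
  proof (intro bexI)
    show "unit_circle (Arg2pi c / (2 * pi)) = c"
      using Arg2pi_eq[of c] that by (simp add: unit_circle_def cis_conv_exp mult.commute)
    show "Arg2pi c / (2 * pi) \<in> {0..1}"
      using Arg2pi_ge_0[of c] Arg2pi_lt_2pi[of c] by simp
  qed note ex = this
  show thesis
  proof (cases "x = 0 \<or> z = 0")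
    case True
    then show thesis by (intro that[of 0]) auto
  next
    case False
    obtain t0 where "t0 \<in> {0..1}" "unit_circle t0 = (cmod x * z) / (x * cmod z)"
      using ex[of "(cmod x * z) / (x * cmod z)"] False by (auto simp: norm_divide norm_mult)
    then show thesis using False by (intro that[of t0]) auto
  qed
qed

section \<open>Radial weights\<close>

text \<open>A closed condition on \<open>|x|\<close>, so that \<open>collar (1 - |z|)\<close> contains the Carleson square of \<open>z\<close>.\<close>

definition collar :: "real \<Rightarrow> complex set" where
  "collar u = {x \<in> ball 0 1. 1 - u \<le> cmod x}"

lemma ball_borel [measurable]: "ball (x :: complex) r \<in> sets borel"
  by simp

lemma collar_borel [measurable]: "collar u \<in> sets borel"
  unfolding collar_def by measurable

lemma collar_mono: "u \<le> v \<Longrightarrow> collar u \<subseteq> collar v"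
  by (auto simp: collar_def)

lemma collar_eq_disc: "1 \<le> u \<Longrightarrow> collar u = ball 0 1"
  unfolding collar_def by (auto intro: order_trans[OF _ norm_ge_zero])

definition tent :: "complex \<Rightarrow> real \<Rightarrow> complex set" where
  "tent z s = ball 0 1 \<inter> ball z s"

lemma tent_borel [measurable]: "tent z s \<in> sets borel"
  by (simp add: tent_def)

lemma tent_mono: "s \<le> s' \<Longrightarrow> tent z s \<subseteq> tent z s'"
  by (auto simp: tent_def)

text \<open>The weight is \<open>x \<mapsto> n |x|\<close>; only the values of \<open>n\<close> on \<open>[0,1)\<close> enter.\<close>

locale radial_profile =
  fixes n :: "real \<Rightarrow> real"
  assumes n_borel [measurable]: "n \<in> borel_measurable borel"
    and n_nonneg: "\<And>r. 0 \<le> n r"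
    and n_finite: "(\<integral>\<^sup>+r\<in>{0..<1}. ennreal (n r) \<partial>lborel) < \<infinity>"
begin

definition hat :: "real \<Rightarrow> real" where
  "hat r = enn2real (\<integral>\<^sup>+s\<in>{r..<1}. ennreal (n s) \<partial>lborel)"

definition nu :: "complex measure" where
  "nu = density area (\<lambda>x. ennreal (n (cmod x)) * indicator (ball 0 1) x)"

definition N :: "real \<Rightarrow> real" where
  "N u = measure nu (collar u)"

lemma sets_nu [simp, measurable_cong]: "sets nu = sets borel"
  by (simp add: nu_def)

lemma space_nu [simp]: "space nu = UNIV"
  by (simp add: nu_def)

lemma hat_finite: "0 \<le> r \<Longrightarrow> (\<integral>\<^sup>+s\<in>{r..<1}. ennreal (n s) \<partial>lborel) < \<infinity>"
  using n_finite by (rule le_less_trans[rotated]) (auto intro!: nn_integral_mono simp: indicator_def)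

lemma hat_nonneg [simp]: "0 \<le> hat r"
  by (simp add: hat_def)

lemma ennreal_hat: "0 \<le> r \<Longrightarrow> ennreal (hat r) = (\<integral>\<^sup>+s\<in>{r..<1}. ennreal (n s) \<partial>lborel)"
  using hat_finite by (simp add: hat_def)

lemma hat_antimono: "0 \<le> r \<Longrightarrow> r \<le> r' \<Longrightarrow> hat r' \<le> hat r"
  unfolding hat_def using hat_finite[of r]
  by (intro enn2real_mono nn_integral_mono) (auto simp: indicator_def)

lemma emeasure_nu_collar:
  "emeasure nu (collar u) = (\<integral>\<^sup>+r\<in>{0<..<1}. ennreal (2 * r) * (ennreal (n r) * indicator {1 - u..} r) \<partial>lborel)"
proof -
  have "emeasure nu (collar u) =
      (\<integral>\<^sup>+x. ennreal (n (cmod x)) * indicator (ball 0 1) x * indicator (collar u) x \<partial>area)"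
    unfolding nu_def by (subst emeasure_density) auto
  also have "\<dots> = (\<integral>\<^sup>+x\<in>ball 0 1. (\<lambda>r. ennreal (n r) * indicator {1 - u..} r) (cmod x) \<partial>area)"
    by (intro nn_integral_cong) (auto simp: indicator_def collar_def)
  also have "\<dots> = (\<integral>\<^sup>+r\<in>{0<..<1}. ennreal (2 * r) * (ennreal (n r) * indicator {1 - u..} r) \<partial>lborel)"
    by (rule nn_integral_area_radial) measurable
  finally show ?thesis .
qed

lemma emeasure_nu_collar_le:
  assumes "u \<le> 1"
  shows "emeasure nu (collar u) \<le> ennreal (2 * hat (1 - u))"
proof -
  have "emeasure nu (collar u) \<le> (\<integral>\<^sup>+r. ennreal 2 * (ennreal (n r) * indicator {1 - u..<1} r) \<partial>lborel)"
    unfolding emeasure_nu_collar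
  proof (intro nn_integral_mono)
    fix r :: real
    have "ennreal (2 * r) * ennreal (n r) \<le> ennreal 2 * ennreal (n r)" if "r < 1"
      using that by (intro mult_right_mono ennreal_leI) auto
    then show "ennreal (2 * r) * (ennreal (n r) * indicator {1 - u..} r) * indicator {0<..<1} r
      \<le> ennreal 2 * (ennreal (n r) * indicator {1 - u..<1} r)"
      by (auto simp: indicator_def)
  qed
  also have "\<dots> = ennreal 2 * (\<integral>\<^sup>+r. ennreal (n r) * indicator {1 - u..<1} r \<partial>lborel)"
    by (rule nn_integral_cmult) measurable
  also have "\<dots> = ennreal (2 * hat (1 - u))"
    using assms by (simp add: ennreal_hat ennreal_mult)
  finally show ?thesis .
qed

sublocale nu: finite_measure nu
proof
  have "emeasure nu (space nu) = emeasure nu (collar 1)"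
    unfolding nu_def by (subst (1 2) emeasure_density) (auto simp: collar_eq_disc indicator_def intro!: nn_integral_cong)
  also have "\<dots> < \<infinity>"
    using emeasure_nu_collar_le[of 1] by (simp add: le_less_trans)
  finally show "emeasure nu (space nu) \<noteq> \<infinity>" by simp
qed

lemma N_nonneg: "0 \<le> N u" by (simp add: N_def)

lemma N_mono: "u \<le> v \<Longrightarrow> N u \<le> N v"
  unfolding N_def by (intro nu.finite_measure_mono collar_mono) auto

lemma N_le_hat: "u \<le> 1 \<Longrightarrow> N u \<le> 2 * hat (1 - u)"
  using emeasure_nu_collar_le[of u] by (simp add: N_def nu.emeasure_eq_measure hat_def)

lemma hat_le_N:
  assumes "0 < u" "u \<le> 1 / 2"
  shows "hat (1 - u) \<le> N u"
proof -
  have "ennreal (hat (1 - u)) = (\<integral>\<^sup>+s\<in>{1 - u..<1}. ennreal (n s) \<partial>lborel)"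
    using assms by (intro ennreal_hat) auto
  also have "\<dots> \<le> emeasure nu (collar u)"
    unfolding emeasure_nu_collar
  proof (intro nn_integral_mono)
    fix r
    show "ennreal (n r) * indicator {1 - u..<1} r \<le>
      ennreal (2 * r) * (ennreal (n r) * indicator {1 - u..} r) * indicator {0<..<1} r"
    proof (cases "r \<in> {1 - u..<1}")
      case True
      then have "1 * ennreal (n r) \<le> ennreal (2 * r) * ennreal (n r)"
        using assms by (intro mult_right_mono) auto
      then show ?thesis using True assms by (auto simp: indicator_def)
    qed auto
  qed
  finally show ?thesis
    by (simp add: N_def nu.emeasure_eq_measure)
qed

text \<open>The mass of a set is computed from the proportion of each circle that it covers.\<close>

lemma emeasure_nu_rotation:
  assumes [measurable]: "E \<in> sets borel"
  shows "emeasure nu E = (\<integral>\<^sup>+x. ennreal (n (cmod x)) * indicator (ball 0 1) x *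
     (\<integral>\<^sup>+t\<in>{0..1}. indicator E (unit_circle t * x) \<partial>lborel) \<partial>area)"
proof -
  have i: "indicator (ball 0 1) x = (indicator {..<1} (cmod x) :: ennreal)" for x :: complex
    by (auto simp: indicator_def)
  have "emeasure nu E = (\<integral>\<^sup>+x. (\<lambda>r. ennreal (n r) * indicator {..<1} r) (cmod x) * indicator E x \<partial>area)"
    unfolding nu_def i by (subst emeasure_density) auto
  also have "\<dots> = (\<integral>\<^sup>+x. (\<lambda>r. ennreal (n r) * indicator {..<1} r) (cmod x) *
     (\<integral>\<^sup>+t\<in>{0..1}. indicator E (unit_circle t * x) \<partial>lborel) \<partial>area)"
    by (rule nn_integral_area_rotation_average[symmetric]) measurable
  finally show ?thesis unfolding i .
qed

lemma emeasure_nu_collar':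
  "emeasure nu (collar u) = (\<integral>\<^sup>+x. ennreal (n (cmod x)) * indicator (ball 0 1) x * indicator (collar u) x \<partial>area)"
  unfolding nu_def by (subst emeasure_density) auto

lemma nu_le_N:
  assumes [measurable]: "E \<in> sets borel" and E: "E \<subseteq> collar u" and c: "0 \<le> c"
    and le: "\<And>x. x \<in> collar u \<Longrightarrow> (\<integral>\<^sup>+t\<in>{0..1}. indicator E (unit_circle t * x) \<partial>lborel) \<le> ennreal c"
  shows "measure nu E \<le> c * N u"
proof -
  have "emeasure nu E \<le> (\<integral>\<^sup>+x. ennreal c *
      (ennreal (n (cmod x)) * indicator (ball 0 1) x * indicator (collar u) x) \<partial>area)"
    unfolding emeasure_nu_rotation[OF assms(1)]
  proof (intro nn_integral_mono)
    fix x :: complex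
    have "(\<integral>\<^sup>+t\<in>{0..1}. indicator E (unit_circle t * x) \<partial>lborel) \<le> ennreal c * indicator (collar u) x"
      if "x \<in> ball 0 1"
    proof (cases "x \<in> collar u")
      case False
      then have "unit_circle t * x \<notin> E" for t
        using E that by (auto simp: collar_def norm_mult)
      then show ?thesis by simp
    qed (use le in auto)
    then have "ennreal (n (cmod x)) * indicator (ball 0 1) x *
         (\<integral>\<^sup>+t\<in>{0..1}. indicator E (unit_circle t * x) \<partial>lborel)
       \<le> ennreal (n (cmod x)) * indicator (ball 0 1) x * (ennreal c * indicator (collar u) x)"
      by (cases "x \<in> ball 0 1") (auto intro!: mult_left_mono)
    then show "ennreal (n (cmod x)) * indicator (ball 0 1) x *
         (\<integral>\<^sup>+t\<in>{0..1}. indicator E (unit_circle t * x) \<partial>lborel)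
       \<le> ennreal c * (ennreal (n (cmod x)) * indicator (ball 0 1) x * indicator (collar u) x)"
      by (simp add: mult_ac)
  qed
  also have "\<dots> = ennreal c * emeasure nu (collar u)"
    unfolding emeasure_nu_collar' by (rule nn_integral_cmult) measurable
  finally show ?thesis
    using c by (simp add: N_def nu.emeasure_eq_measure ennreal_mult'[symmetric])
qed

lemma nu_ge_N:
  assumes [measurable]: "E \<in> sets borel" and c: "0 \<le> c"
    and ge: "\<And>x. x \<in> collar u \<Longrightarrow> ennreal c \<le> (\<integral>\<^sup>+t\<in>{0..1}. indicator E (unit_circle t * x) \<partial>lborel)"
  shows "c * N u \<le> measure nu E"
proof -
  have "ennreal c * emeasure nu (collar u) = (\<integral>\<^sup>+x. ennreal c *
      (ennreal (n (cmod x)) * indicator (ball 0 1) x * indicator (collar u) x) \<partial>area)"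
    unfolding emeasure_nu_collar' by (rule nn_integral_cmult[symmetric]) measurable
  also have "\<dots> \<le> emeasure nu E"
    unfolding emeasure_nu_rotation[OF assms(1)]
  proof (intro nn_integral_mono)
    fix x :: complex
    have "ennreal c * indicator (collar u) x \<le> (\<integral>\<^sup>+t\<in>{0..1}. indicator E (unit_circle t * x) \<partial>lborel)"
      using ge by (auto simp: indicator_def)
    then have "ennreal (n (cmod x)) * indicator (ball 0 1) x * (ennreal c * indicator (collar u) x)
       \<le> ennreal (n (cmod x)) * indicator (ball 0 1) x *
         (\<integral>\<^sup>+t\<in>{0..1}. indicator E (unit_circle t * x) \<partial>lborel)"
      by (rule mult_left_mono) simp
    then show "ennreal c * (ennreal (n (cmod x)) * indicator (ball 0 1) x * indicator (collar u) x)
       \<le> ennreal (n (cmod x)) * indicator (ball 0 1) x *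
         (\<integral>\<^sup>+t\<in>{0..1}. indicator E (unit_circle t * x) \<partial>lborel)"
      by (simp add: mult_ac)
  qed
  finally show ?thesis
    using c by (simp add: N_def nu.emeasure_eq_measure ennreal_mult'[symmetric])
qed

end

text \<open>The defining inequalities of \<^const>\<open>D_hat\<close> and \<^const>\<open>D_check\<close>, for a Borel profile.\<close>

locale D_profile = radial_profile +
  assumes hat_doubling: "\<exists>C. \<forall>r. 0 \<le> r \<and> r < 1 \<longrightarrow> hat r \<le> C * hat ((1 + r) / 2)"
    and hat_decay: "\<exists>K>1. \<exists>C>1. \<forall>r. 0 \<le> r \<and> r < 1 \<longrightarrow> C * hat (1 - (1 - r) / K) \<le> hat r"
    and N_pos: "\<And>u. 0 < u \<Longrightarrow> 0 < N u"
begin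

text \<open>For \<open>u \<le> 1/2\<close> the factor \<open>2 r\<close> of polar coordinates lies between \<open>1\<close> and \<open>2\<close> on the collar, so \<open>N u\<close> is
  comparable to \<open>hat (1 - u)\<close>. For larger \<open>u\<close> both sides lie between \<open>N (1/2)\<close> and \<open>N 1\<close>.\<close>

lemma N_doubling: obtains C where "C \<ge> 1" "\<And>u. 0 < u \<Longrightarrow> N (2 * u) \<le> C * N u"
proof -
  obtain C0 where C0: "\<And>r. 0 \<le> r \<Longrightarrow> r < 1 \<Longrightarrow> hat r \<le> C0 * hat ((1 + r) / 2)"
    using hat_doubling by blast
  define C where "C = max 1 (2 * C0)"
  have small: "N (2 * u) \<le> C * N u" if "0 < u" "u \<le> 1 / 2" for u
  proof -
    have "N (2 * u) \<le> 2 * hat (1 - 2 * u)" using that by (intro N_le_hat) auto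
    also have "hat (1 - 2 * u) \<le> C0 * hat (1 - u)" using C0[of "1 - 2 * u"] that by (simp add: add_divide_distrib diff_divide_distrib)
    finally have "N (2 * u) \<le> (2 * C0) * hat (1 - u)" by simp
    also have "\<dots> \<le> C * hat (1 - u)"
      by (intro mult_right_mono) (auto simp: C_def hat_def)
    also have "\<dots> \<le> C * N u"
      using hat_le_N[OF that] by (intro mult_left_mono) (auto simp: C_def)
    finally show ?thesis .
  qed
  have "N (2 * u) \<le> C * N u" if "0 < u" for u
  proof (cases "u \<le> 1 / 2")
    case False
    have "N (2 * u) = N (2 * (1 / 2))"
      using False by (simp add: N_def collar_eq_disc)
    also have "\<dots> \<le> C * N (1 / 2)" by (rule small) auto
    also have "\<dots> \<le> C * N u" using False by (intro mult_left_mono N_mono) (auto simp: C_def)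
    finally show ?thesis .
  qed (use small that in auto)
  then show thesis by (intro that[of C]) (auto simp: C_def)
qed

lemma N_doubling_le:
  obtains C where "C \<ge> 1" "\<And>u v. 0 < u \<Longrightarrow> v \<le> \<Lambda> * u \<Longrightarrow> N v \<le> C * N u"
proof -
  obtain C where C: "C \<ge> 1" "\<And>u. 0 < u \<Longrightarrow> N (2 * u) \<le> C * N u"
    using N_doubling by blast
  obtain m :: nat where m: "\<Lambda> < 2 ^ m" using real_arch_pow[of 2 \<Lambda>] by auto
  have it: "N (2 ^ j * u) \<le> C ^ j * N u" if "0 < u" for u j
  proof (induction j)
    case (Suc j)
    have "N (2 ^ Suc j * u) \<le> C * N (2 ^ j * u)"
      using C(2)[of "2 ^ j * u"] that by (simp add: mult.assoc)
    also have "\<dots> \<le> C * (C ^ j * N u)" using Suc C(1) by (intro mult_left_mono) auto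
    finally show ?case by (simp add: mult.assoc)
  qed simp
  show thesis
  proof (rule that[of "C ^ m"])
    show "1 \<le> C ^ m" using C(1) by simp
    fix u v :: real assume uv: "0 < u" "v \<le> \<Lambda> * u"
    then have "v \<le> 2 ^ m * u" using m by (intro order_trans[OF uv(2)] mult_right_mono) auto
    then show "N v \<le> C ^ m * N u" using N_mono it[OF uv(1)] by (blast intro: order_trans)
  qed
qed

text \<open>Iterating the lower condition gives \<open>C\<^sup>m hat (1 - u / K\<^sup>m) \<le> hat (1 - u)\<close>, and \<open>C > 1\<close>.\<close>

lemma N_decay:
  assumes "\<epsilon> > 0"
  obtains \<delta> where "0 < \<delta>" "\<delta> < 1" "\<And>u. 0 < u \<Longrightarrow> u \<le> 1 \<Longrightarrow> N (\<delta> * u) \<le> \<epsilon> * N u"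
proof -
  obtain K C where K: "K > 1" and C: "C > 1"
    and dec: "\<And>r. 0 \<le> r \<Longrightarrow> r < 1 \<Longrightarrow> C * hat (1 - (1 - r) / K) \<le> hat r"
    using hat_decay by blast
  obtain C0 where C0: "\<And>r. 0 \<le> r \<Longrightarrow> r < 1 \<Longrightarrow> hat r \<le> C0 * hat ((1 + r) / 2)"
    using hat_doubling by blast
  define C1 where "C1 = max 1 C0"
  have h: "hat (1 - u) \<le> C1 * N u" if "0 < u" "u \<le> 1" for u
  proof (cases "u \<le> 1 / 2")
    case True
    have "hat (1 - u) \<le> 1 * N u" using hat_le_N[of u] True that by simp
    also have "\<dots> \<le> C1 * N u" by (intro mult_right_mono) (auto simp: C1_def N_nonneg)
    finally show ?thesis .
  next
    case False
    have "hat (1 - u) \<le> hat 0" using that by (intro hat_antimono) auto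
    also have "\<dots> \<le> C0 * hat (1 - 1 / 2)" using C0[of 0] by simp
    also have "\<dots> \<le> C1 * hat (1 - 1 / 2)"
      by (intro mult_right_mono) (auto simp: C1_def hat_def)
    also have "\<dots> \<le> C1 * N u"
      using hat_le_N[of "1/2"] N_mono[of "1/2" u] False by (intro mult_left_mono) (auto simp: C1_def)
    finally show ?thesis .
  qed
  have it: "C ^ m * hat (1 - u / K ^ m) \<le> hat (1 - u)" if "0 < u" "u \<le> 1" for u m
  proof (induction m)
    case (Suc m)
    have "1 \<le> K ^ m" using K by (simp add: one_le_power)
    then have "0 \<le> 1 - u / K ^ m" "1 - u / K ^ m < 1"
      using order_trans[OF that(2) \<open>1 \<le> K ^ m\<close>] that K by (auto simp: divide_le_eq)
    from dec[OF this] have "C ^ m * (C * hat (1 - u / K ^ m / K)) \<le> C ^ m * hat (1 - u / K ^ m)"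
      using C by (intro mult_left_mono) auto
    with Suc show ?case by (simp add: mult_ac)
  qed simp
  obtain m0 where m0: "2 * C1 / \<epsilon> < C ^ m0" using real_arch_pow[OF C] by blast
  define m where "m = Suc m0"
  have "C ^ m0 \<le> C ^ m" using C unfolding m_def by (intro power_increasing) auto
  then have "\<epsilon> * C ^ m0 \<le> \<epsilon> * C ^ m" using assms by (intro mult_left_mono) auto
  moreover have "2 * C1 < \<epsilon> * C ^ m0" using m0 assms by (simp add: field_simps)
  ultimately have m: "2 * C1 \<le> \<epsilon> * C ^ m" by linarith
  show thesis
  proof (rule that[of "1 / K ^ m"])
    show "0 < 1 / K ^ m" using K by simp
    show "1 / K ^ m < 1" using K unfolding m_def by (simp add: one_less_power del: power_Suc)
    fix u :: real assume u: "0 < u" "u \<le> 1"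
    have "1 \<le> K ^ m" using K by (simp add: one_le_power)
    then have "u / K ^ m \<le> 1" using u by (simp add: divide_le_eq)
    then have "C ^ m * N (1 / K ^ m * u) \<le> C ^ m * (2 * hat (1 - u / K ^ m))"
      using N_le_hat[of "u / K ^ m"] C by (intro mult_left_mono) auto
    also have "\<dots> \<le> 2 * hat (1 - u)" using it[OF u, of m] by simp
    also have "\<dots> \<le> 2 * C1 * N u" using h[OF u] by simp
    also have "\<dots> \<le> (\<epsilon> * C ^ m) * N u" using m by (intro mult_right_mono N_nonneg)
    finally have "C ^ m * N (1 / K ^ m * u) \<le> C ^ m * (\<epsilon> * N u)" by (simp add: mult_ac)
    then show "N (1 / K ^ m * u) \<le> \<epsilon> * N u" using C by (simp add: mult_le_cancel_left)
  qed
qed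

end

section \<open>Carleson squares and tents\<close>

text \<open>Replaces the argument by an inner product: \<open>|Arg w| \<le> \<phi>\<close> means \<open>|w| cos \<phi> \<le> Re w\<close>, as \<open>\<phi> \<le> \<pi>\<close>.\<close>

lemma carleson_square_iff:
  assumes "z \<in> ball 0 1" "z \<noteq> 0"
  shows "x \<in> carleson_square z \<longleftrightarrow>
    x \<in> ball 0 1 \<and> cmod z \<le> cmod x \<and> cmod z * cmod x * cos ((1 - cmod z) / 2) \<le> Re (z * cnj x)"
proof -
  define \<phi> where "\<phi> = (1 - cmod z) / 2"
  have \<phi>: "0 \<le> \<phi>" "\<phi> \<le> pi" using assms pi_gt3 norm_ge_zero[of z] unfolding \<phi>_def by (simp, argo)
  have Re_Arg: "Re w = cmod w * cos \<bar>Arg w\<bar>" for w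
    using rcis_cmod_Arg[of w] by (metis Re_rcis cos_abs_real)
  have arc: "\<bar>Arg w\<bar> \<le> \<phi> \<longleftrightarrow> cmod w * cos \<phi> \<le> Re w" if "w \<noteq> 0" for w
  proof -
    have "\<bar>Arg w\<bar> \<le> pi" using Arg_bounded[of w] by auto
    then have "cos \<phi> \<le> cos \<bar>Arg w\<bar> \<longleftrightarrow> \<bar>Arg w\<bar> \<le> \<phi>"
      using \<phi> by (intro cos_mono_le_eq) auto
    then show ?thesis using that unfolding Re_Arg[of w] by (simp del: cos_abs_real)
  qed
  have mem: "x \<in> carleson_square z \<longleftrightarrow>
    x \<in> ball 0 1 \<and> (\<exists>r \<theta>. x = of_real r * cis \<theta> \<and> cmod z \<le> r \<and> \<bar>Arg (z * cis (- \<theta>))\<bar> \<le> \<phi>)"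
  proof -
    have "(\<exists>r t. x = of_real r * cis t \<and> cmod z \<le> r \<and> (\<exists>\<theta>. cis t = cis \<theta> \<and> P \<theta>)) \<longleftrightarrow>
      (\<exists>r \<theta>. x = of_real r * cis \<theta> \<and> cmod z \<le> r \<and> P \<theta>)" for P
    proof
      assume "\<exists>r t. x = of_real r * cis t \<and> cmod z \<le> r \<and> (\<exists>\<theta>. cis t = cis \<theta> \<and> P \<theta>)"
      then obtain r t \<theta> where "x = of_real r * cis t" "cmod z \<le> r" "cis t = cis \<theta>" "P \<theta>" by blast
      then have "x = of_real r * cis \<theta> \<and> cmod z \<le> r \<and> P \<theta>" by simp
      then show "\<exists>r \<theta>. x = of_real r * cis \<theta> \<and> cmod z \<le> r \<and> P \<theta>" by blast
    qed blast
    then show ?thesis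
      unfolding carleson_square_def carleson_arc_def \<phi>_def mem_Collect_eq by simp
  qed
  have key: "\<bar>Arg (z * cis (- \<theta>))\<bar> \<le> \<phi> \<longleftrightarrow> cmod z * r * cos \<phi> \<le> Re (z * cnj (of_real r * cis \<theta>))"
    if "r > 0" for r \<theta>
  proof -
    have "Re (z * cnj (of_real r * cis \<theta>)) = r * Re (z * cis (- \<theta>))"
      by (simp add: cis_cnj algebra_simps)
    moreover have "\<bar>Arg (z * cis (- \<theta>))\<bar> \<le> \<phi> \<longleftrightarrow> cmod z * cos \<phi> \<le> Re (z * cis (- \<theta>))"
      using arc[of "z * cis (- \<theta>)"] assms by (simp add: norm_mult)
    moreover have "cmod z * r * cos \<phi> = r * (cmod z * cos \<phi>)" by simp
    ultimately show ?thesis using that by (simp only: mult_le_cancel_left_pos)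
  qed
  show ?thesis
  proof
    assume "x \<in> carleson_square z"
    then obtain r \<theta> where x: "x \<in> ball 0 1" "x = of_real r * cis \<theta>" "cmod z \<le> r" "\<bar>Arg (z * cis (- \<theta>))\<bar> \<le> \<phi>"
      using mem by blast
    have r: "r > 0" using x(3) assms by (meson less_le_trans zero_less_norm_iff)
    then have "cmod x = r" using x(2) by (simp add: norm_mult)
    moreover have "cmod z * r * cos \<phi> \<le> Re (z * cnj x)"
      using key[OF r, of \<theta>] x(4) unfolding x(2) by (simp only:)
    ultimately show "x \<in> ball 0 1 \<and> cmod z \<le> cmod x \<and> cmod z * cmod x * cos ((1 - cmod z) / 2) \<le> Re (z * cnj x)"
      using x(1,3) unfolding \<phi>_def by (simp only: simp_thms)
  next
    assume x: "x \<in> ball 0 1 \<and> cmod z \<le> cmod x \<and> cmod z * cmod x * cos ((1 - cmod z) / 2) \<le> Re (z * cnj x)"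
    then have "cmod x > 0" using assms by (meson less_le_trans zero_less_norm_iff)
    moreover have "x = of_real (cmod x) * cis (Arg x)"
      using rcis_cmod_Arg[of x] by (simp add: rcis_def)
    ultimately have "\<bar>Arg (z * cis (- Arg x))\<bar> \<le> \<phi>"
      using key[of "cmod x" "Arg x"] x unfolding \<phi>_def by metis
    with x \<open>x = _\<close> show "x \<in> carleson_square z"
      unfolding mem by blast
  qed
qed

lemma carleson_square_borel [measurable]:
  assumes "z \<in> ball 0 1" "z \<noteq> 0"
  shows "carleson_square z \<in> sets borel"
proof -
  have "carleson_square z = {x \<in> ball 0 1. cmod z \<le> cmod x} \<inter>
     {x. cmod z * cmod x * cos ((1 - cmod z) / 2) \<le> Re (z * cnj x)}"
    using carleson_square_iff[OF assms] by blast
  moreover have "{x. cmod z * cmod x * cos ((1 - cmod z) / 2) \<le> Re (z * cnj x)} \<in> sets borel"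
    by (rule borel_closed) (intro closed_Collect_le continuous_intros)
  moreover have "{x \<in> ball 0 1. cmod z \<le> cmod x} \<in> sets borel" by measurable
  ultimately show ?thesis by (simp only: sets.Int)
qed

lemma one_minus_cos_le: "1 - cos x \<le> x\<^sup>2 / 2" for x :: real
proof -
  have "cos x = 1 - 2 * (sin (x / 2))\<^sup>2"
    using cos_double_sin[of "x / 2"] by simp
  moreover have "(sin (x / 2))\<^sup>2 \<le> (x / 2)\<^sup>2"
    using abs_sin_x_le_abs_x[of "x / 2"] by (rule abs_le_square_iff[THEN iffD1])
  ultimately show ?thesis by (simp add: power2_eq_square)
qed

lemma dist_sq: "(cmod (x - z))\<^sup>2 = (cmod x)\<^sup>2 + (cmod z)\<^sup>2 - 2 * Re (z * cnj x)"
  unfolding cmod_power2 by (simp add: power2_eq_square algebra_simps)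

text \<open>The two coordinates of \<open>x - z\<close> are at most \<open>gap z\<close> and \<open>gap z / 2\<close>, and \<open>1 + 1/4 < 4\<close>.\<close>

lemma carleson_square_subset_tent:
  assumes "z \<in> ball 0 1" "z \<noteq> 0"
  shows "carleson_square z \<subseteq> tent z (2 * (1 - cmod z))"
proof
  fix x assume "x \<in> carleson_square z"
  then have x: "cmod x < 1" "cmod z \<le> cmod x" "cmod z * cmod x * cos ((1 - cmod z) / 2) \<le> Re (z * cnj x)"
    using carleson_square_iff[OF assms] by auto
  have z: "cmod z < 1" using assms by simp
  have "cmod z * cmod x * (1 - cos ((1 - cmod z) / 2)) \<le> 1 * (1 - cos ((1 - cmod z) / 2))"
    using x z by (intro mult_right_mono mult_le_one) auto
  also have "\<dots> \<le> (1 - cmod z)\<^sup>2 / 8"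
    using one_minus_cos_le[of "(1 - cmod z) / 2"] by (simp add: power_divide)
  finally have "cmod z * cmod x \<le> Re (z * cnj x) + (1 - cmod z)\<^sup>2 / 8"
    using x(3) by (simp add: algebra_simps)
  moreover have e: "(cmod x - cmod z)\<^sup>2 = (cmod x)\<^sup>2 + (cmod z)\<^sup>2 - 2 * (cmod z * cmod x)"
    by (simp add: power2_diff)
  ultimately have "(cmod (x - z))\<^sup>2 \<le> (cmod x - cmod z)\<^sup>2 + (1 - cmod z)\<^sup>2 / 4"
    unfolding dist_sq e by argo
  also have "(cmod x - cmod z)\<^sup>2 \<le> (1 - cmod z)\<^sup>2"
    using x by (intro power_mono) auto
  finally have "(cmod (x - z))\<^sup>2 \<le> (1 - cmod z)\<^sup>2 + (1 - cmod z)\<^sup>2 / 4" by simp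
  also have "\<dots> < (2 * (1 - cmod z))\<^sup>2"
  proof -
    have "0 < (1 - cmod z)\<^sup>2" using z by simp
    moreover have "(2 * (1 - cmod z))\<^sup>2 = 4 * (1 - cmod z)\<^sup>2" by (simp only: power_mult_distrib) simp
    ultimately show ?thesis by argo
  qed
  finally have "cmod (x - z) < 2 * (1 - cmod z)"
    by (rule power_less_imp_less_base) (use z in simp)
  then show "x \<in> tent z (2 * (1 - cmod z))"
    using x by (simp add: tent_def dist_norm norm_minus_commute)
qed

text \<open>The vertex of the square is on the radius of \<open>z\<close> and so far inside that the half angle of the square
  is \<open>4 s\<close>, while the tent is seen from the origin under an angle of about \<open>s\<close>.\<close>

lemma tent_subset_carleson_square:
  assumes z: "z \<in> ball 0 1" and s: "2 * (1 - cmod z) \<le> s" "s \<le> 1 / 10"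
  shows "tent z s \<subseteq> carleson_square (of_real ((1 - 8 * s) / cmod z) * z)"
proof
  fix x assume "x \<in> tent z s"
  then have x: "cmod x < 1" "cmod (x - z) < s"
    by (auto simp: tent_def dist_norm norm_minus_commute)
  have z1: "cmod z < 1" "cmod z \<ge> 19 / 20" using z s by auto
  then have s0: "0 < s" using s by argo
  have "cmod z - cmod x \<le> cmod (x - z)" using norm_triangle_ineq2[of z x] by (simp add: norm_minus_commute)
  then have x1: "cmod x \<ge> 1 - 3 / 2 * s" using x(2) s by argo
  define b where "b = of_real ((1 - 8 * s) / cmod z) * z"
  have z0: "z \<noteq> 0" using z1 by auto
  have b: "cmod b = 1 - 8 * s"
    unfolding b_def norm_mult norm_of_real using z0 s(2) by simp
  have bD: "b \<in> ball 0 1" "b \<noteq> 0" using b s0 s(2) by auto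
  have "(1 - cos (4 * s)) = 2 * (sin (2 * s))\<^sup>2"
    using cos_double_sin[of "2 * s"] by simp
  moreover have "s \<le> sin (2 * s)"
    using sin_ge_half[of "2 * s"] s0 s(2) pi_gt3 by simp
  then have "s\<^sup>2 \<le> (sin (2 * s))\<^sup>2" using s0 by (intro power_mono) auto
  ultimately have c: "2 * s\<^sup>2 \<le> 1 - cos (4 * s)" by simp
  have "(1/2) * (1/2) \<le> cmod z * cmod x"
    using z1 x1 s(2) by (intro mult_mono) auto
  then have "(1 / 4) * (2 * s\<^sup>2) \<le> cmod z * cmod x * (1 - cos (4 * s))"
    using c by (intro mult_mono) auto
  moreover have "(cmod (x - z))\<^sup>2 \<le> s\<^sup>2" using x(2) by (intro power_mono) auto
  moreover have "2 * (cmod z * cmod x) \<le> s\<^sup>2 + 2 * Re (z * cnj x)" if "(cmod (x - z))\<^sup>2 \<le> s\<^sup>2"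
  proof -
    have "0 \<le> (cmod x)\<^sup>2 + (cmod z)\<^sup>2 - 2 * (cmod z * cmod x)"
      using zero_le_power2[of "cmod x - cmod z"] by (simp add: power2_diff mult_ac)
    with that show ?thesis unfolding dist_sq by argo
  qed
  moreover have "cmod z * cmod x * (1 - cos (4 * s)) = cmod z * cmod x - cmod z * cmod x * cos (4 * s)"
    by (simp add: right_diff_distrib)
  ultimately have "cmod z * cmod x * cos (4 * s) \<le> Re (z * cnj x)"
    by argo
  then have "(1 - 8 * s) / cmod z * (cmod z * cmod x * cos (4 * s)) \<le> (1 - 8 * s) / cmod z * Re (z * cnj x)"
    using s(2) by (intro mult_left_mono) auto
  moreover have "Re (b * cnj x) = (1 - 8 * s) / cmod z * Re (z * cnj x)"
  proof -
    have "Re (of_real r * w) = r * Re w" for r w by simp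
    then show ?thesis unfolding b_def by (simp only: mult.assoc)
  qed
  moreover have "(1 - 8 * s) / cmod z * (cmod z * cmod x * cos (4 * s)) = cmod b * cmod x * cos ((1 - cmod b) / 2)"
    using z0 b by simp
  ultimately have "cmod b * cmod x * cos ((1 - cmod b) / 2) \<le> Re (b * cnj x)" by simp
  then show "x \<in> carleson_square (of_real ((1 - 8 * s) / cmod z) * z)"
    unfolding b_def[symmetric] carleson_square_iff[OF bD] using x x1 b s0 by auto
qed

context radial_profile
begin

text \<open>Near the boundary the tent meets each circle in an arc of length comparable to \<open>s\<close>. Tents with \<open>s > 1/3\<close> are
  compared with the whole collar.\<close>

lemma nu_tent_collar_upper:
  assumes z: "z \<in> ball 0 1" and s: "2 * (1 - cmod z) \<le> s"
  shows "measure nu (tent z s \<inter> collar u) \<le> 24 * min s 1 * N u"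
proof (cases "s \<le> 1 / 3")
  case True
  have s0: "s > 0" using z s by (auto intro: less_le_trans[rotated])
  have "measure nu (tent z s \<inter> collar u) \<le> (8 * s) * N u"
  proof (rule nu_le_N)
    fix x assume x: "x \<in> collar u"
    show "(\<integral>\<^sup>+t\<in>{0..1}. indicator (tent z s \<inter> collar u) (unit_circle t * x) \<partial>lborel) \<le> ennreal (8 * s)"
    proof (cases "1 / 2 \<le> cmod x")
      case True
      have "(\<integral>\<^sup>+t\<in>{0..1}. indicator (tent z s \<inter> collar u) (unit_circle t * x) \<partial>lborel)
        \<le> (\<integral>\<^sup>+t\<in>{0..1}. indicator (ball z s) (unit_circle t * x) \<partial>lborel)"
        by (intro nn_integral_mono) (auto simp: indicator_def tent_def)
      also have "\<dots> \<le> ennreal (8 * s)" using rotation_arc_upper[OF True] s0 by simp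
      finally show ?thesis .
    next
      case False
      have "unit_circle t * x \<notin> tent z s" for t
      proof
        assume "unit_circle t * x \<in> tent z s"
        then have "cmod (unit_circle t * x - z) < s" by (simp add: tent_def dist_norm norm_minus_commute)
        then have "cmod z - cmod x < s" using norm_triangle_ineq2[of z "unit_circle t * x"]
          by (simp add: norm_mult norm_minus_commute)
        then show False using False \<open>s \<le> 1 / 3\<close> s by argo
      qed
      then show ?thesis by simp
    qed
  qed (use s0 in auto)
  also have "\<dots> \<le> 24 * min s 1 * N u"
    using True s0 N_nonneg[of u] by (intro mult_right_mono) auto
  finally show ?thesis .
next
  case False
  have "measure nu (tent z s \<inter> collar u) \<le> 1 * N u"
    unfolding N_def by (simp, intro nu.finite_measure_mono) auto
  also have "\<dots> \<le> 24 * min s 1 * N u"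
    using False by (intro mult_right_mono N_nonneg) auto
  finally show ?thesis .
qed

text \<open>Every circle in the collar has a point on the radius of \<open>z\<close> at distance at most \<open>s/2\<close> from \<open>z\<close>, and a
  rotation of it by a small multiple of \<open>s\<close> does not leave the tent.\<close>

lemma nu_tent_collar_lower:
  assumes z: "z \<in> ball 0 1" and s: "2 * (1 - cmod z) \<le> s" and u: "u \<le> s / 2"
  shows "min s 1 / 16 * N u \<le> measure nu (tent z s \<inter> collar u)"
proof (rule nu_ge_N)
  have s0: "s > 0" using z s by (auto intro: less_le_trans[rotated])
  show "0 \<le> min s 1 / 16" using s0 by simp
  fix x assume x: "x \<in> collar u"
  obtain t0 where t0: "t0 \<in> {0..1}" "unit_circle t0 * x * of_real (cmod z) = of_real (cmod x) * z"
    using rotate_onto_ray .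
  have d0: "cmod (unit_circle t0 * x - z) \<le> s / 2"
  proof -
    have "cmod (unit_circle t0 * x - z) = \<bar>cmod x - cmod z\<bar>"
    proof (cases "z = 0")
      case False
      then have "unit_circle t0 * x - z = of_real ((cmod x - cmod z) / cmod z) * z"
        using t0(2) by (simp add: field_simps)
      then have "cmod (unit_circle t0 * x - z) = \<bar>cmod x - cmod z\<bar> / cmod z * cmod z"
        by (simp only: norm_mult norm_of_real abs_divide abs_norm_cancel)
      then show ?thesis using False by simp
    qed (simp add: norm_mult)
    also have "\<dots> \<le> s / 2"
    proof (rule abs_leI)
      have *: "cmod x < 1" "1 - u \<le> cmod x" "cmod z < 1" using x z by (auto simp: collar_def)
      show "cmod x - cmod z \<le> s / 2" using * s by argo
      show "- (cmod x - cmod z) \<le> s / 2" using * u by argo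
    qed
    finally show ?thesis .
  qed
  show "ennreal (min s 1 / 16) \<le> (\<integral>\<^sup>+t\<in>{0..1}. indicator (tent z s \<inter> collar u) (unit_circle t * x) \<partial>lborel)"
  proof (rule rotation_arc_lower[OF t0(1)])
    fix t assume t: "t \<in> {0..1}" "\<bar>t - t0\<bar> \<le> min s 1 / 16"
    have "cmod (unit_circle t * x - unit_circle t0 * x) = cmod (unit_circle t - unit_circle t0) * cmod x"
      by (simp add: left_diff_distrib[symmetric] norm_mult)
    also have "\<dots> \<le> (7 * \<bar>t - t0\<bar>) * 1"
      using unit_circle_dist_upper[of t t0] x by (intro mult_mono) (auto simp: collar_def)
    also have "\<dots> \<le> 7 * s / 16" using t(2) by simp
    finally have "cmod (unit_circle t * x - z) \<le> 7 * s / 16 + s / 2"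
      using d0 norm_triangle_ineq[of "unit_circle t * x - unit_circle t0 * x" "unit_circle t0 * x - z"] by simp
    also have "\<dots> < s" using s0 by simp
    finally show "unit_circle t * x \<in> tent z s \<inter> collar u"
      using x by (simp add: tent_def collar_def dist_norm norm_minus_commute norm_mult)
  qed (use s0 in auto)
qed auto

lemma nu_carleson_square_lower:
  assumes z: "z \<in> ball 0 1" "z \<noteq> 0"
  shows "(1 - cmod z) / 16 * N (1 - cmod z) \<le> measure nu (carleson_square z)"
proof (rule nu_ge_N)
  fix x assume x: "x \<in> collar (1 - cmod z)"
  have d1: "(1 - cmod z) / 16 \<le> 1" using norm_ge_zero[of z] by argo
  obtain t0 where t0: "t0 \<in> {0..1}" "unit_circle t0 * x * of_real (cmod z) = of_real (cmod x) * z"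
    using rotate_onto_ray .
  show "ennreal ((1 - cmod z) / 16) \<le> (\<integral>\<^sup>+t\<in>{0..1}. indicator (carleson_square z) (unit_circle t * x) \<partial>lborel)"
  proof (rule rotation_arc_lower[OF t0(1)])
    fix t assume t: "t \<in> {0..1}" "\<bar>t - t0\<bar> \<le> (1 - cmod z) / 16"
    have "unit_circle t = unit_circle (t - t0) * unit_circle t0"
      by (simp add: unit_circle_def cis_mult algebra_simps)
    then have "unit_circle t * x = unit_circle (t - t0) * (of_real (cmod x / cmod z) * z)"
      using t0(2) z by (simp add: field_simps)
    then have "z * cnj (unit_circle t * x) = of_real (cmod x / cmod z) * (z * cnj z) * cnj (unit_circle (t - t0))"
      by (simp add: mult_ac)
    also have "z * cnj z = of_real ((cmod z)\<^sup>2)" by (metis complex_norm_square of_real_power)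
    also have "of_real (cmod x / cmod z) * complex_of_real ((cmod z)\<^sup>2) = of_real (cmod z * cmod x)"
      using z by (simp add: power2_eq_square)
    finally have "Re (z * cnj (unit_circle t * x)) = cmod z * cmod x * cos (2 * pi * (t - t0))"
      by (simp add: unit_circle_def)
    moreover have "cos ((1 - cmod z) / 2) \<le> cos \<bar>2 * pi * (t - t0)\<bar>"
    proof (rule cos_monotone_0_pi_le)
      have "\<bar>2 * pi * (t - t0)\<bar> = 2 * pi * \<bar>t - t0\<bar>" by (simp add: abs_mult)
      also have "\<dots> \<le> 8 * ((1 - cmod z) / 16)"
        using t(2) pi_less_4 by (intro mult_mono) auto
      finally show "\<bar>2 * pi * (t - t0)\<bar> \<le> (1 - cmod z) / 2" by simp
      show "(1 - cmod z) / 2 \<le> pi" using pi_gt3 norm_ge_zero[of z] by argo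
    qed auto
    ultimately have "cmod z * cmod x * cos ((1 - cmod z) / 2) \<le> Re (z * cnj (unit_circle t * x))"
      by (simp add: mult_left_mono)
    then show "unit_circle t * x \<in> carleson_square z"
      unfolding carleson_square_iff[OF z] using x by (simp add: norm_mult collar_def)
  qed (use z d1 in auto)
qed (use z in auto)

end

context D_profile
begin

lemma nu_tent_pos:
  assumes z: "z \<in> ball 0 1" and s: "2 * (1 - cmod z) \<le> s"
  shows "0 < measure nu (tent z s)"
proof -
  have s0: "s > 0" using z s by (auto intro: less_le_trans[rotated])
  have "0 < min s 1 / 16 * N (s / 2)" using s0 N_pos by simp
  also have "\<dots> \<le> measure nu (tent z s \<inter> collar (s / 2))"
    using nu_tent_collar_lower[OF z s] by simp
  also have "\<dots> \<le> measure nu (tent z s)" by (intro nu.finite_measure_mono) auto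
  finally show ?thesis .
qed

lemma tent_subset_collar:
  assumes "2 * (1 - cmod z) \<le> s"
  shows "tent z s \<subseteq> collar (3 / 2 * s)"
proof
  fix x assume "x \<in> tent z s"
  then have "cmod x < 1" "cmod (x - z) < s" by (auto simp: tent_def dist_norm norm_minus_commute)
  then show "x \<in> collar (3 / 2 * s)"
    using assms norm_triangle_ineq2[of z x] by (simp add: collar_def norm_minus_commute)
qed

lemma nu_tent_le_collar:
  obtains C where "C \<ge> 1" "\<And>z s s'. z \<in> ball 0 1 \<Longrightarrow> 2 * (1 - cmod z) \<le> s \<Longrightarrow> s' \<le> \<Lambda> * s \<Longrightarrow>
     measure nu (tent z s') \<le> C * (min s 1 * N (s / 2))"
proof -
  define \<Lambda>' where "\<Lambda>' = max 1 \<Lambda>"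
  obtain C where C: "C \<ge> 1" "\<And>u v. 0 < u \<Longrightarrow> v \<le> (3 * \<Lambda>') * u \<Longrightarrow> N v \<le> C * N u"
    using N_doubling_le by blast
  have \<Lambda>: "\<Lambda>' \<ge> 1" "\<Lambda> \<le> \<Lambda>'" by (auto simp: \<Lambda>'_def)
  show thesis
  proof (rule that[of "24 * \<Lambda>' * C"])
    have "1 \<le> 24 * \<Lambda>'" using \<Lambda> by simp
    then show "1 \<le> 24 * \<Lambda>' * C" using mult_mono[of 1 "24 * \<Lambda>'" 1 C] C(1) by simp
    fix z :: complex and s s' assume z: "z \<in> ball 0 1" and s: "2 * (1 - cmod z) \<le> s" and s': "s' \<le> \<Lambda> * s"
    have s0: "s > 0" using z s by (auto intro: less_le_trans[rotated])
    define s1 where "s1 = \<Lambda>' * s"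
    have "1 * s \<le> \<Lambda>' * s" using \<Lambda> s0 by (intro mult_right_mono) auto
    then have s1: "s \<le> s1" "0 < s1" using s0 by (auto simp: s1_def)
    have "\<Lambda> * s \<le> \<Lambda>' * s" using \<Lambda> s0 by (intro mult_right_mono) auto
    then have "s' \<le> s1" using s' by (simp add: s1_def)
    have N1: "N (3 / 2 * s1) \<le> C * N (s / 2)"
      using s0 by (intro C(2)) (auto simp: s1_def)
    from \<open>s' \<le> s1\<close> have "tent z s' \<subseteq> tent z s1" by (auto simp: tent_def)
    also have "\<dots> = tent z s1 \<inter> collar (3 / 2 * s1)"
      using tent_subset_collar[of z s1] s s1 by auto
    finally have "measure nu (tent z s') \<le> measure nu (tent z s1 \<inter> collar (3 / 2 * s1))"
      by (intro nu.finite_measure_mono) auto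
    also have "\<dots> \<le> 24 * min s1 1 * N (3 / 2 * s1)"
      using s s1 by (intro nu_tent_collar_upper z) auto
    also have "24 * min s1 1 * N (3 / 2 * s1) \<le> 24 * (\<Lambda>' * min s 1) * (C * N (s / 2))"
    proof (intro mult_mono N1)
      show "min s1 1 \<le> \<Lambda>' * min s 1" 
      proof (cases "s \<le> 1")
        case False
        then show ?thesis using \<Lambda> s1(1) by (simp add: min_def)
      qed (simp add: s1_def min_def)
      show "0 \<le> 24 * (\<Lambda>' * min s 1)" using s0 \<Lambda> by simp
    qed (use s0 s1 in \<open>auto simp: N_nonneg\<close>)
    finally show "measure nu (tent z s') \<le> 24 * \<Lambda>' * C * (min s 1 * N (s / 2))"
      by (simp add: mult_ac)
  qed
qed

lemma nu_tent_doubling: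
  obtains C where "C \<ge> 1" "\<And>z s s'. z \<in> ball 0 1 \<Longrightarrow> 2 * (1 - cmod z) \<le> s \<Longrightarrow> s' \<le> \<Lambda> * s \<Longrightarrow>
     measure nu (tent z s') \<le> C * measure nu (tent z s)"
proof -
  obtain C where C: "C \<ge> 1" "\<And>z s s'. z \<in> ball 0 1 \<Longrightarrow> 2 * (1 - cmod z) \<le> s \<Longrightarrow> s' \<le> \<Lambda> * s \<Longrightarrow>
     measure nu (tent z s') \<le> C * (min s 1 * N (s / 2))"
    using nu_tent_le_collar by blast
  show thesis
  proof (rule that[of "16 * C"])
    fix z :: complex and s s' assume z: "z \<in> ball 0 1" and s: "2 * (1 - cmod z) \<le> s" and s': "s' \<le> \<Lambda> * s"
    have "min s 1 / 16 * N (s / 2) \<le> measure nu (tent z s \<inter> collar (s / 2))"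
      using nu_tent_collar_lower[OF z s] by simp
    also have "\<dots> \<le> measure nu (tent z s)" by (intro nu.finite_measure_mono) auto
    finally have "min s 1 * N (s / 2) \<le> 16 * measure nu (tent z s)" by simp
    then have "C * (min s 1 * N (s / 2)) \<le> C * (16 * measure nu (tent z s))"
      using C(1) by (intro mult_left_mono) auto
    then show "measure nu (tent z s') \<le> 16 * C * measure nu (tent z s)"
      using C(2)[OF z s s'] by simp
  qed (use C in auto)
qed

end

section \<open>The Bekolle--Bonami condition on tents\<close>

text \<open>Values of the density outside the disc are discarded here.\<close>

definition disc_measure :: "(complex \<Rightarrow> ennreal) \<Rightarrow> complex measure" where
  "disc_measure g = density area (\<lambda>x. g x * indicator (ball 0 1) x)"

lemma sets_disc_measure [simp, measurable_cong]: "sets (disc_measure g) = sets borel"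
  by (simp add: disc_measure_def)

lemma space_disc_measure [simp]: "space (disc_measure g) = UNIV"
  by (simp add: disc_measure_def)

lemma nn_integral_disc_measure:
  assumes [measurable]: "g \<in> borel_measurable borel" "f \<in> borel_measurable borel"
  shows "(\<integral>\<^sup>+x. f x \<partial>disc_measure g) = (\<integral>\<^sup>+x\<in>ball 0 1. f x * g x \<partial>area)"
  unfolding disc_measure_def by (subst nn_integral_density) (auto simp: mult_ac)

lemma emeasure_disc_measure:
  assumes [measurable]: "g \<in> borel_measurable borel" "A \<in> sets borel"
  shows "emeasure (disc_measure g) A = (\<integral>\<^sup>+x\<in>ball 0 1. indicator A x * g x \<partial>area)"
  using nn_integral_disc_measure[of g "indicator A"] by simp

lemma AE_area_not_0: "AE x in area. x \<noteq> 0"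
proof -
  have "emeasure area {0} = 0"
    using nn_integral_area[OF borel_measurable_indicator, of "{0}"] by simp
  then show ?thesis by (intro AE_I[of _ _ "{0}"]) auto
qed

lemma ennreal_powr_le_imp_le:
  assumes "ennreal_powr X e \<le> ennreal Y" "0 < e" "0 \<le> Y"
  shows "X \<le> ennreal (Y powr (1 / e))"
proof -
  have X: "X \<noteq> top" using assms by (auto simp: ennreal_powr_def top_unique)
  then have "ennreal (enn2real X powr e) \<le> ennreal Y"
    using assms(1) by (simp add: ennreal_powr_def)
  then have "enn2real X powr e \<le> Y"
    using assms(3) by simp
  then have "(enn2real X powr e) powr (1 / e) \<le> Y powr (1 / e)"
    using assms by (intro powr_mono2) auto
  then have "enn2real X \<le> Y powr (1 / e)" using assms by (simp add: powr_powr)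
  then show ?thesis
    using X by (metis ennreal_enn2real ennreal_leI less_top)
qed

text \<open>The hypothesis of the theorem for Borel functions, in terms of measures on the disc.\<close>

locale bekolle = D_profile +
  fixes om :: "complex \<Rightarrow> real" and q :: real
  assumes om_borel [measurable]: "om \<in> borel_measurable borel"
    and om_nonneg: "\<And>x. 0 \<le> om x"
    and om_finite: "(\<integral>\<^sup>+x\<in>ball 0 1. ennreal (om x) \<partial>area) < \<infinity>"
    and q: "1 < q"
    and om_pos: "\<And>a. a \<in> ball 0 1 \<Longrightarrow> a \<noteq> 0 \<Longrightarrow>
      0 < measure (disc_measure (\<lambda>x. ennreal (om x))) (carleson_square a)"
    and Bq: "\<exists>C::real. \<forall>a\<in>ball 0 1 - {0}.
      ennreal (measure (disc_measure (\<lambda>x. ennreal (om x))) (carleson_square a) powr (1 / q)) *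
      ennreal_powr (emeasure (disc_measure (dual_integrand q om (\<lambda>z. n (cmod z)))) (carleson_square a))
        (1 / (q / (q - 1)))
      \<le> ennreal (C * measure nu (carleson_square a))"
begin

definition mu :: "complex measure" where
  "mu = disc_measure (\<lambda>x. ennreal (om x))"

text \<open>The density \<open>(\<nu> \<omega>\<^sup>-\<^sup>1\<^sup>/\<^sup>q)\<^sup>q\<^sup>'\<close>, which may take the value \<open>\<infinity>\<close>.\<close>

definition dual :: "complex \<Rightarrow> ennreal" where
  "dual = dual_integrand q om (\<lambda>z. n (cmod z))"

definition sigma :: "complex measure" where
  "sigma = disc_measure dual"

definition q' :: real where
  "q' = q / (q - 1)"

lemma q': "1 < q'" "1 / q + 1 / q' = 1"
  using q by (auto simp: q'_def field_simps)

lemma sets_mu [simp, measurable_cong]: "sets mu = sets borel"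
  and sets_sigma [simp, measurable_cong]: "sets sigma = sets borel"
  and space_mu [simp]: "space mu = UNIV"
  and space_sigma [simp]: "space sigma = UNIV"
  by (simp_all add: mu_def sigma_def)

lemma dual_borel [measurable]: "dual \<in> borel_measurable borel"
  unfolding dual_def dual_integrand_def by measurable

sublocale mu: finite_measure mu
proof
  have "emeasure mu (space mu) = (\<integral>\<^sup>+x\<in>ball 0 1. ennreal (om x) \<partial>area)"
    by (simp add: mu_def emeasure_disc_measure)
  then show "emeasure mu (space mu) \<noteq> \<infinity>" using om_finite by simp
qed

lemma nu_eq: "nu = disc_measure (\<lambda>x. ennreal (n (cmod x)))"
  by (simp add: nu_def disc_measure_def)

text \<open>The \<open>B\<^sub>q\<close> condition solved for the dual mass. In particular that mass is finite, as squares have positive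
  \<open>\<omega>\<close>-mass.\<close>

lemma Bq_square:
  obtains C where "0 < C" "\<And>a. a \<in> ball 0 1 \<Longrightarrow> a \<noteq> 0 \<Longrightarrow>
    emeasure sigma (carleson_square a) \<le>
      ennreal ((C * measure nu (carleson_square a) / measure mu (carleson_square a) powr (1 / q)) powr q')"
proof -
  obtain C0 :: real where C0: "\<And>a. a \<in> ball 0 1 \<Longrightarrow> a \<noteq> 0 \<Longrightarrow>
      ennreal (measure mu (carleson_square a) powr (1 / q)) *
      ennreal_powr (emeasure sigma (carleson_square a)) (1 / q') \<le> ennreal (C0 * measure nu (carleson_square a))"
    using Bq unfolding mu_def sigma_def dual_def q'_def by blast
  define C where "C = max 1 C0"
  show thesis
  proof (rule that)
    show "0 < C" by (simp add: C_def)
    fix a :: complex assume a: "a \<in> ball 0 1" "a \<noteq> 0"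
    define m where "m = measure mu (carleson_square a) powr (1 / q)"
    have m: "m > 0" using om_pos[OF a] by (simp add: m_def mu_def)
    define X where "X = ennreal_powr (emeasure sigma (carleson_square a)) (1 / q')"
    have "ennreal m * X \<le> ennreal (C * measure nu (carleson_square a))"
      using C0[OF a] unfolding m_def X_def
      by (rule order_trans) (intro ennreal_leI mult_right_mono, auto simp: C_def)
    then have "ennreal (1 / m) * (ennreal m * X) \<le> ennreal (1 / m) * ennreal (C * measure nu (carleson_square a))"
      by (rule mult_left_mono) simp
    moreover have "ennreal (1 / m) * (ennreal m * X) = X"
      using m by (simp add: mult.assoc[symmetric] ennreal_mult'[symmetric])
    ultimately have "X \<le> ennreal (C * measure nu (carleson_square a) / m)"
      using m by (simp add: ennreal_mult'[symmetric])
    then have "emeasure sigma (carleson_square a) \<le> ennreal ((C * measure nu (carleson_square a) / m) powr (1 / (1 / q')))"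
      unfolding X_def using q' m \<open>0 < C\<close> by (intro ennreal_powr_le_imp_le) auto
    then show "emeasure sigma (carleson_square a) \<le>
      ennreal ((C * measure nu (carleson_square a) / measure mu (carleson_square a) powr (1 / q)) powr q')"
      by (simp add: m_def)
  qed
qed

text \<open>The squares of \<open>c/2, c/3, \<dots>\<close> increase to a sector without its vertex. Their dual masses are bounded,
  since their \<open>\<omega>\<close>-masses are at least that of the first one.\<close>

lemma sigma_sector_finite:
  assumes c: "cmod c = 1"
  defines "A \<equiv> {x \<in> ball 0 1. x \<noteq> 0 \<and> cmod x * cos (1/4) < Re (c * cnj x)}"
  shows "emeasure sigma A < \<infinity>"
proof -
  obtain C where C: "0 < C" "\<And>a. a \<in> ball 0 1 \<Longrightarrow> a \<noteq> 0 \<Longrightarrow>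
    emeasure sigma (carleson_square a) \<le>
      ennreal ((C * measure nu (carleson_square a) / measure mu (carleson_square a) powr (1 / q)) powr q')"
    using Bq_square by blast
  define z where "z = (\<lambda>k::nat. c / of_nat (k + 2))"
  have nz: "cmod (z k) = 1 / (real k + 2)" for k
    by (simp only: z_def norm_divide norm_of_nat c) simp
  have z: "z k \<in> ball 0 1" "z k \<noteq> 0" for k
  proof -
    show "z k \<in> ball 0 1" using nz[of k] by simp
    have "0 < cmod (z k)" unfolding nz by simp
    then show "z k \<noteq> 0" by simp
  qed
  have sq: "x \<in> carleson_square (z k) \<longleftrightarrow> x \<in> ball 0 1 \<and> 1 / (real k + 2) \<le> cmod x \<and>
     cmod x * cos ((1 - 1 / (real k + 2)) / 2) \<le> Re (c * cnj x)" for x k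
  proof -
    have "z k * cnj x = (c * cnj x) / complex_of_real (real k + 2)"
      by (simp add: z_def)
    then have re: "Re (z k * cnj x) = Re (c * cnj x) / (real k + 2)"
      by (simp only: Re_divide_of_real)
    have gen: "1 / m * a * b \<le> r / m \<longleftrightarrow> a * b \<le> r" if "m > 0" for m a b r :: real
      using that by (simp add: field_simps)
    have "real k + 2 > 0" by simp
    from gen[OF this] show ?thesis unfolding carleson_square_iff[OF z] nz re by blast
  qed
  have inc: "carleson_square (z k) \<subseteq> carleson_square (z l)" if "k \<le> l" for k l
  proof
    fix x assume x: "x \<in> carleson_square (z k)"
    have kl: "1 / (real l + 2) \<le> 1 / (real k + 2)" using that by (simp add: frac_le)
    have k1: "1 / (real k + 2) \<le> 1" "0 \<le> 1 / (real l + 2)" by auto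
    have "cos ((1 - 1 / (real l + 2)) / 2) \<le> cos ((1 - 1 / (real k + 2)) / 2)"
    proof (rule cos_monotone_0_pi_le)
      show "0 \<le> (1 - 1 / (real k + 2)) / 2" using k1 by argo
      show "(1 - 1 / (real k + 2)) / 2 \<le> (1 - 1 / (real l + 2)) / 2" using kl by argo
      show "(1 - 1 / (real l + 2)) / 2 \<le> pi" using k1 pi_gt3 by argo
    qed
    then have "cmod x * cos ((1 - 1 / (real l + 2)) / 2) \<le> cmod x * cos ((1 - 1 / (real k + 2)) / 2)"
      by (rule mult_left_mono) simp
    then show "x \<in> carleson_square (z l)"
      using x kl unfolding sq by linarith
  qed
  have [measurable]: "carleson_square (z k) \<in> sets borel" for k
    using z by (intro carleson_square_borel)
  define B where "B = (C * measure nu UNIV / measure mu (carleson_square (z 0)) powr (1 / q)) powr q'"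
  have "emeasure sigma (\<Union>k. carleson_square (z k)) = (SUP k. emeasure sigma (carleson_square (z k)))"
    by (intro SUP_emeasure_incseq[symmetric]) (auto simp: incseq_def inc)
  also have "\<dots> \<le> ennreal B"
  proof (rule SUP_least)
    fix k
    have pos: "0 < measure mu (carleson_square (z 0))"
      using om_pos[OF z] by (simp add: mu_def)
    have "C * measure nu (carleson_square (z k)) / measure mu (carleson_square (z k)) powr (1 / q)
      \<le> C * measure nu UNIV / measure mu (carleson_square (z 0)) powr (1 / q)"
    proof (intro frac_le mult_left_mono powr_mono2)
      show "measure nu (carleson_square (z k)) \<le> measure nu UNIV"
        using nu.bounded_measure[of "carleson_square (z k)"] by simp
      show "measure mu (carleson_square (z 0)) \<le> measure mu (carleson_square (z k))"
        by (intro mu.finite_measure_mono inc) auto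
    qed (use C pos q in auto)
    then have "(C * measure nu (carleson_square (z k)) / measure mu (carleson_square (z k)) powr (1 / q)) powr q' \<le> B"
      unfolding B_def using q' C by (intro powr_mono2) auto
    then show "emeasure sigma (carleson_square (z k)) \<le> ennreal B"
      using C(2)[OF z] by (meson ennreal_leI order_trans)
  qed
  finally have fin: "emeasure sigma (\<Union>k. carleson_square (z k)) \<le> ennreal B" .
  have "A \<subseteq> (\<Union>k. carleson_square (z k))"
  proof
    fix x assume x: "x \<in> A"
    then have "0 < cmod x" by (simp add: A_def)
    then obtain k0 :: nat where k0: "inverse (real (Suc k0)) < cmod x"
      using reals_Archimedean by blast
    have "1 / (real k0 + 2) \<le> inverse (real (Suc k0))" by (simp add: field_simps)
    then have k: "1 / (real k0 + 2) \<le> cmod x" "1 / (real k0 + 2) \<le> 1 / 2" "0 \<le> 1 / (real k0 + 2)"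
      using k0 by (linarith, simp_all add: field_simps)
    have "cos ((1 - 1 / (real k0 + 2)) / 2) \<le> cos (1/4)"
    proof (rule cos_monotone_0_pi_le)
      show "1 / 4 \<le> (1 - 1 / (real k0 + 2)) / 2" using k by argo
      show "(1 - 1 / (real k0 + 2)) / 2 \<le> pi" using k pi_gt3 by argo
    qed simp
    then have "cmod x * cos ((1 - 1 / (real k0 + 2)) / 2) \<le> cmod x * cos (1/4)"
      by (rule mult_left_mono) simp
    then have "cmod x * cos ((1 - 1 / (real k0 + 2)) / 2) \<le> Re (c * cnj x)"
      using x unfolding A_def mem_Collect_eq by linarith
    then have "x \<in> carleson_square (z k0)"
      using x k(1) unfolding sq A_def by blast
    then show "x \<in> (\<Union>k. carleson_square (z k))" by blast
  qed
  then have "emeasure sigma A \<le> emeasure sigma (\<Union>k. carleson_square (z k))"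
    by (intro emeasure_mono) auto
  with fin show ?thesis by (simp add: le_less_trans)
qed

text \<open>Finitely many sectors cover the disc except for the origin. The square of \<open>a\<close>
  omits the disc of radius \<open>|a|\<close>, so finitely many squares would not suffice.\<close>

lemma sigma_total_finite: "emeasure sigma UNIV < \<infinity>"
proof -
  define O1 where "O1 = (\<lambda>c. {x. cos (1/4) < Re (c * cnj x)})"
  have cos14: "cos (1/4) < (1::real)"
    using cos_monotone_0_pi[of 0 "1/4"] pi_gt3 by simp
  have opn: "open (O1 c)" for c
    unfolding O1_def by (intro open_Collect_less continuous_intros)
  have cov: "sphere 0 1 \<subseteq> (\<Union>c\<in>sphere 0 1. O1 c)"
  proof
    fix c :: complex assume c: "c \<in> sphere 0 1"
    then have "c * cnj c = 1" by (simp add: complex_norm_square[symmetric])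
    then have "c \<in> O1 c" using cos14 unfolding O1_def by (metis mem_Collect_eq one_complex.simps(1))
    with c show "c \<in> (\<Union>c\<in>sphere 0 1. O1 c)" by blast
  qed
  obtain F where F: "F \<subseteq> sphere 0 1" "finite F" "sphere 0 1 \<subseteq> (\<Union>c\<in>F. O1 c)"
    using compactE_image[OF compact_sphere opn cov] by blast
  define A where "A = (\<lambda>c. {x \<in> ball 0 1. x \<noteq> 0 \<and> cmod x * cos (1/4) < Re (c * cnj x)})"
  have Ab [measurable]: "A c \<in> sets borel" for c
  proof -
    have "A c = (ball 0 1 - {0}) \<inter> {x. cmod x * cos (1/4) < Re (c * cnj x)}" by (auto simp: A_def)
    moreover have "open {x. cmod x * cos (1/4) < Re (c * cnj x)}"
      by (intro open_Collect_less continuous_intros)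
    ultimately show ?thesis by (metis borel_open open_Int open_ball open_delete)
  qed
  have sub: "ball 0 1 - {0} \<subseteq> (\<Union>c\<in>F. A c)"
  proof
    fix x :: complex assume x: "x \<in> ball 0 1 - {0}"
    then have "x / of_real (cmod x) \<in> sphere 0 1" by (simp add: norm_divide)
    then obtain c where c: "c \<in> F" "x / of_real (cmod x) \<in> O1 c" using F by blast
    have "Re (c * cnj (x / of_real (cmod x))) = Re (c * cnj x) / cmod x"
      by (simp add: Re_divide_of_real)
    moreover have xp: "0 < cmod x" using x by simp
    ultimately have "cos (1/4) * cmod x < Re (c * cnj x)"
      using c(2) by (simp only: O1_def mem_Collect_eq pos_less_divide_eq[OF xp])
    then have "x \<in> A c" using x unfolding A_def by (simp add: mult.commute)
    with c show "x \<in> (\<Union>c\<in>F. A c)" by blast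
  qed
  have "emeasure sigma UNIV = (\<integral>\<^sup>+x\<in>ball 0 1. indicator UNIV x * dual x \<partial>area)"
    unfolding sigma_def by (rule emeasure_disc_measure) auto
  also have "\<dots> \<le> (\<integral>\<^sup>+x\<in>ball 0 1. indicator (\<Union>c\<in>F. A c) x * dual x \<partial>area)"
    by (intro nn_integral_mono_AE eventually_mono[OF AE_area_not_0])
       (use sub in \<open>auto simp: indicator_def split: if_splits\<close>)
  also have "\<dots> = emeasure sigma (\<Union>c\<in>F. A c)"
    unfolding sigma_def using F(2) by (intro emeasure_disc_measure[symmetric]) auto
  also have "\<dots> \<le> (\<Sum>c\<in>F. emeasure sigma (A c))"
    using F(2) by (intro emeasure_subadditive_finite) auto
  also have "\<dots> < \<infinity>"
    using F sigma_sector_finite unfolding A_def by (auto simp: less_top)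
  finally show ?thesis .
qed

sublocale sigma: finite_measure sigma
proof
  show "emeasure sigma (space sigma) \<noteq> \<infinity>" using sigma_total_finite by simp
qed

text \<open>Young's inequality, with the two factors normalised by the bounds \<open>a\<close> and \<open>b\<close>, integrated over the disc. The
  pointwise inequality uses \<open>\<nu> = \<omega>\<^sup>1\<^sup>/\<^sup>q (\<nu> \<omega>\<^sup>-\<^sup>1\<^sup>/\<^sup>q)\<close>; where \<open>\<omega>\<close> vanishes and \<open>\<nu>\<close> does not, the dual density is
  infinite.\<close>

lemma Hoelder_positive:
  assumes [measurable]: "G \<in> borel_measurable borel" "H \<in> borel_measurable borel"
    and nn: "\<And>x. 0 \<le> G x" "\<And>x. 0 \<le> H x"
    and ab: "0 < a" "0 < b"
    and ia: "(\<integral>\<^sup>+x. ennreal (G x powr q) \<partial>mu) \<le> ennreal a"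
    and ib: "(\<integral>\<^sup>+x. ennreal (H x powr q') \<partial>sigma) \<le> ennreal b"
  shows "(\<integral>\<^sup>+x. ennreal (G x * H x) \<partial>nu) \<le> ennreal (a powr (1 / q) * b powr (1 / q'))"
proof -
  define c where "c = a powr (1 / q) * b powr (1 / q')"
  have c: "c > 0" using ab by (simp add: c_def)
  have q0: "q > 0" "q' > 0" using q q' by auto
  have pw: "ennreal (G x * H x) * ennreal (n (cmod x)) \<le>
     ennreal (c / (q * a)) * (ennreal (G x powr q) * ennreal (om x)) +
     ennreal (c / (q' * b)) * (ennreal (H x powr q') * dual x)" for x
  proof (cases "n (cmod x) = 0 \<or> G x = 0 \<or> H x = 0")
    case True
    then show ?thesis by auto
  next
    case False
    then have nz: "n (cmod x) > 0" "G x > 0" "H x > 0"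
      using n_nonneg[of "cmod x"] nn[of x] by auto
    show ?thesis
    proof (cases "om x = 0")
      case True
      then have "dual x = top" using nz by (simp add: dual_def dual_integrand_def)
      then show ?thesis using nz c q0 ab by (simp add: ennreal_mult_top)
    next
      case False
      then have om: "om x > 0" using om_nonneg[of x] by simp
      define d where "d = n (cmod x) * om x powr (- 1 / q)"
      have dual: "dual x = ennreal (d powr q')"
        using nz om by (simp add: dual_def dual_integrand_def d_def q'_def)
      have d0: "d \<ge> 0" using nz by (simp add: d_def)
      define U where "U = G x * om x powr (1 / q) / a powr (1 / q)"
      define V where "V = H x * d / b powr (1 / q')"
      have "U * V \<le> U powr q / q + V powr q' / q'"
        using q q' nz d0 by (intro Youngs_inequality) (auto simp: U_def V_def)
      moreover have "U powr q = G x powr q * om x / a"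
        using nz om ab q0 by (simp add: U_def powr_divide powr_mult powr_powr)
      moreover have "V powr q' = H x powr q' * d powr q' / b"
        using nz d0 ab q0 by (simp add: V_def powr_divide powr_mult powr_powr)
      moreover have "c * (U * V) = G x * H x * n (cmod x)"
        using nz om ab q0 by (simp add: U_def V_def c_def d_def powr_minus field_simps)
      ultimately have "G x * H x * n (cmod x) \<le> c * (G x powr q * om x / a / q + H x powr q' * d powr q' / b / q')"
        using mult_left_mono[of "U * V" "U powr q / q + V powr q' / q'" c] c by simp
      also have "\<dots> = c / (q * a) * (G x powr q * om x) + c / (q' * b) * (H x powr q' * d powr q')"
        using ab q0 by (simp add: field_simps)
      finally have "ennreal (G x * H x * n (cmod x)) \<le>
         ennreal (c / (q * a) * (G x powr q * om x) + c / (q' * b) * (H x powr q' * d powr q'))"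
        by (rule ennreal_leI)
      then show ?thesis
        using nz om c ab q0 unfolding dual by (simp add: ennreal_mult[symmetric] ennreal_plus[symmetric] del: ennreal_plus)
    qed
  qed
  have "(\<integral>\<^sup>+x. ennreal (G x * H x) \<partial>nu) = (\<integral>\<^sup>+x\<in>ball 0 1. ennreal (G x * H x) * ennreal (n (cmod x)) \<partial>area)"
    unfolding nu_eq by (rule nn_integral_disc_measure) measurable
  also have "\<dots> \<le> (\<integral>\<^sup>+x. ennreal (c / (q * a)) * (ennreal (G x powr q) * ennreal (om x) * indicator (ball 0 1) x) +
     ennreal (c / (q' * b)) * (ennreal (H x powr q') * dual x * indicator (ball 0 1) x) \<partial>area)"
    using pw by (intro nn_integral_mono) (auto simp: indicator_def)
  also have "\<dots> = ennreal (c / (q * a)) * (\<integral>\<^sup>+x\<in>ball 0 1. ennreal (G x powr q) * ennreal (om x) \<partial>area) +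
     ennreal (c / (q' * b)) * (\<integral>\<^sup>+x\<in>ball 0 1. ennreal (H x powr q') * dual x \<partial>area)"
    by (simp add: nn_integral_add nn_integral_cmult)
  also have "(\<integral>\<^sup>+x\<in>ball 0 1. ennreal (G x powr q) * ennreal (om x) \<partial>area) = (\<integral>\<^sup>+x. ennreal (G x powr q) \<partial>mu)"
    unfolding mu_def by (rule nn_integral_disc_measure[symmetric]) measurable
  also have "(\<integral>\<^sup>+x\<in>ball 0 1. ennreal (H x powr q') * dual x \<partial>area) = (\<integral>\<^sup>+x. ennreal (H x powr q') \<partial>sigma)"
    unfolding sigma_def by (rule nn_integral_disc_measure[symmetric]) measurable
  also have "ennreal (c / (q * a)) * (\<integral>\<^sup>+x. ennreal (G x powr q) \<partial>mu) +
      ennreal (c / (q' * b)) * (\<integral>\<^sup>+x. ennreal (H x powr q') \<partial>sigma)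
    \<le> ennreal (c / (q * a)) * ennreal a + ennreal (c / (q' * b)) * ennreal b"
    using ia ib by (intro add_mono mult_left_mono) auto
  also have "\<dots> = ennreal (c / (q * a) * a + c / (q' * b) * b)"
    using c ab q0 by (simp add: ennreal_mult[symmetric] ennreal_plus[symmetric] del: ennreal_plus)
  also have "c / (q * a) * a + c / (q' * b) * b = c * (1 / q + 1 / q')"
    using ab q0 by (simp add: field_simps)
  finally show ?thesis using q'(2) by (simp add: c_def)
qed

lemma Hoelder:
  assumes G: "G \<in> borel_measurable borel" and H: "H \<in> borel_measurable borel"
    and nn: "\<And>x. 0 \<le> G x" "\<And>x. 0 \<le> H x"
    and ab: "0 \<le> a" "0 \<le> b"
    and ia: "(\<integral>\<^sup>+x. ennreal (G x powr q) \<partial>mu) \<le> ennreal a"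
    and ib: "(\<integral>\<^sup>+x. ennreal (H x powr q') \<partial>sigma) \<le> ennreal b"
  shows "(\<integral>\<^sup>+x. ennreal (G x * H x) \<partial>nu) \<le> ennreal (a powr (1 / q) * b powr (1 / q'))"
proof -
  have bd: "(\<integral>\<^sup>+x. ennreal (G x * H x) \<partial>nu) \<le> ennreal ((a + e) powr (1 / q) * (b + e) powr (1 / q'))"
    if "e > 0" for e
  proof (rule Hoelder_positive[OF G H nn])
    show "(\<integral>\<^sup>+x. ennreal (G x powr q) \<partial>mu) \<le> ennreal (a + e)"
      using that by (intro order_trans[OF ia ennreal_leI]) simp
    show "(\<integral>\<^sup>+x. ennreal (H x powr q') \<partial>sigma) \<le> ennreal (b + e)"
      using that by (intro order_trans[OF ib ennreal_leI]) simp
  qed (use that ab in auto)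
  have lim: "((\<lambda>e. ennreal ((a + e) powr (1 / q) * (b + e) powr (1 / q'))) \<longlongrightarrow>
      ennreal ((a + 0) powr (1 / q) * (b + 0) powr (1 / q'))) (at_right 0)"
    using q q' ab
    by (intro tendsto_ennrealI tendsto_mult tendsto_powr' tendsto_intros)
       (auto simp: eventually_at_right_less intro!: eventually_mono[OF eventually_at_right_less])
  have "(\<integral>\<^sup>+x. ennreal (G x * H x) \<partial>nu) \<le> ennreal ((a + 0) powr (1 / q) * (b + 0) powr (1 / q'))"
    by (rule tendsto_lowerbound[OF lim eventually_mono[OF eventually_at_right_less bd]]) auto
  then show ?thesis by simp
qed

lemma nu_le_mu_sigma:
  assumes [measurable]: "E \<in> sets borel" "T \<in> sets borel" and "E \<subseteq> T"
  shows "measure nu E \<le> measure mu E powr (1 / q) * measure sigma T powr (1 / q')"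
proof -
  have "(\<integral>\<^sup>+x. ennreal (indicator E x * indicator E x) \<partial>nu) \<le>
      ennreal (measure mu E powr (1 / q) * measure sigma T powr (1 / q'))"
  proof (rule Hoelder)
    have "(\<integral>\<^sup>+x. ennreal (indicator E x powr q) \<partial>mu) = (\<integral>\<^sup>+x. indicator E x \<partial>mu)"
      by (intro nn_integral_cong) (auto simp: indicator_def)
    then show "(\<integral>\<^sup>+x. ennreal (indicator E x powr q) \<partial>mu) \<le> ennreal (measure mu E)"
      by (simp add: mu.emeasure_eq_measure)
    have "(\<integral>\<^sup>+x. ennreal (indicator E x powr q') \<partial>sigma) \<le> (\<integral>\<^sup>+x. indicator T x \<partial>sigma)"
      using assms(3) by (intro nn_integral_mono) (auto simp: indicator_def)
    then show "(\<integral>\<^sup>+x. ennreal (indicator E x powr q') \<partial>sigma) \<le> ennreal (measure sigma T)"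
      by (simp add: sigma.emeasure_eq_measure)
  qed auto
  also have "(\<integral>\<^sup>+x. ennreal (indicator E x * indicator E x) \<partial>nu) = (\<integral>\<^sup>+x. indicator E x \<partial>nu)"
    by (intro nn_integral_cong) (auto simp: indicator_def)
  finally show ?thesis by (simp add: nu.emeasure_eq_measure)
qed

text \<open>A small tent lies in a Carleson square of comparable \<open>\<nu>\<close>-mass. For large tents the left side is
  bounded by the total masses and the right side is bounded below.\<close>

lemma Bq_tent:
  obtains C where "0 < C" "\<And>z s. z \<in> ball 0 1 \<Longrightarrow> 2 * (1 - cmod z) \<le> s \<Longrightarrow>
    measure mu (tent z s) powr (1 / q) * measure sigma (tent z s) powr (1 / q') \<le> C * measure nu (tent z s)"
proof -
  obtain C0 where C0: "0 < C0" "\<And>a. a \<in> ball 0 1 \<Longrightarrow> a \<noteq> 0 \<Longrightarrow>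
    emeasure sigma (carleson_square a) \<le>
      ennreal ((C0 * measure nu (carleson_square a) / measure mu (carleson_square a) powr (1 / q)) powr q')"
    using Bq_square by blast
  obtain D where D: "D \<ge> 1" "\<And>z s s'. z \<in> ball 0 1 \<Longrightarrow> 2 * (1 - cmod z) \<le> s \<Longrightarrow> s' \<le> 25 * s \<Longrightarrow>
     measure nu (tent z s') \<le> D * measure nu (tent z s)"
    using nu_tent_doubling by blast
  define M where "M = measure mu UNIV powr (1 / q) * measure sigma UNIV powr (1 / q')"
  define c where "c = 1 / 160 * N (1 / 20)"
  have c: "c > 0" using N_pos by (simp add: c_def)
  \<comment> \<open>The two terms serve small and large tents.\<close>
  define C where "C = max (C0 * D) (M / c)"
  have C: "C > 0" using C0 D by (simp add: C_def less_max_iff_disj)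
  show thesis
  proof (rule that[OF C])
    fix z :: complex and s assume z: "z \<in> ball 0 1" and s: "2 * (1 - cmod z) \<le> s"
    have s0: "s > 0" using z s by (auto intro: less_le_trans[rotated])
    show "measure mu (tent z s) powr (1 / q) * measure sigma (tent z s) powr (1 / q') \<le> C * measure nu (tent z s)"
    proof (cases "s \<le> 1 / 10")
      case True
      define b where "b = of_real ((1 - 8 * s) / cmod z) * z"
      have z0: "z \<noteq> 0" using s True by auto
      have b: "cmod b = 1 - 8 * s"
        unfolding b_def norm_mult norm_of_real using z0 True by simp
      have bD: "b \<in> ball 0 1" "b \<noteq> 0" using b s0 True by auto
      have sub: "tent z s \<subseteq> carleson_square b"
        unfolding b_def by (rule tent_subset_carleson_square[OF z s True])
      have bz: "cmod (b - z) < 9 * s"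
      proof -
        have "b - z = of_real ((1 - 8 * s) / cmod z - 1) * z" by (simp add: b_def algebra_simps)
        then have "cmod (b - z) = \<bar>((1 - 8 * s) / cmod z - 1) * cmod z\<bar>"
          by (simp only: norm_mult norm_of_real abs_mult abs_norm_cancel)
        also have "((1 - 8 * s) / cmod z - 1) * cmod z = 1 - 8 * s - cmod z"
          using z0 by (simp add: field_simps)
        also have "\<bar>1 - 8 * s - cmod z\<bar> < 9 * s"
        proof -
          have "cmod z < 1" using z by simp
          then have "1 - 8 * s - cmod z < 9 * s" "- (1 - 8 * s - cmod z) < 9 * s" using s s0 by argo+
          then show ?thesis by (simp only: abs_less_iff)
        qed
        finally show ?thesis .
      qed
      have "carleson_square b \<subseteq> tent b (16 * s)"
        using carleson_square_subset_tent[OF bD] b by simp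
      also have "\<dots> \<subseteq> tent z (25 * s)"
      proof
        fix x assume "x \<in> tent b (16 * s)"
        then have "x \<in> ball 0 1" "cmod (x - b) < 16 * s" by (auto simp: tent_def dist_norm norm_minus_commute)
        then show "x \<in> tent z (25 * s)"
          using bz norm_triangle_ineq[of "x - b" "b - z"] by (simp add: tent_def dist_norm norm_minus_commute)
      qed
      finally have sub2: "carleson_square b \<subseteq> tent z (25 * s)" .
      have [measurable]: "carleson_square b \<in> sets borel" using bD by (rule carleson_square_borel)
      have mpos: "0 < measure mu (carleson_square b)" using om_pos[OF bD] by (simp add: mu_def)
      have "measure sigma (carleson_square b) \<le>
         (C0 * measure nu (carleson_square b) / measure mu (carleson_square b) powr (1 / q)) powr q'"
        using C0(2)[OF bD] by (simp add: sigma.emeasure_eq_measure)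
      then have "measure sigma (carleson_square b) powr (1 / q') \<le>
         ((C0 * measure nu (carleson_square b) / measure mu (carleson_square b) powr (1 / q)) powr q') powr (1 / q')"
        using q' by (intro powr_mono2) auto
      also have "\<dots> = C0 * measure nu (carleson_square b) / measure mu (carleson_square b) powr (1 / q)"
        using q' C0(1) by (simp add: powr_powr)
      finally have B: "measure mu (carleson_square b) powr (1 / q) * measure sigma (carleson_square b) powr (1 / q')
         \<le> C0 * measure nu (carleson_square b)"
        using mpos by (simp add: field_simps)
      have "measure mu (tent z s) powr (1 / q) * measure sigma (tent z s) powr (1 / q')
        \<le> measure mu (carleson_square b) powr (1 / q) * measure sigma (carleson_square b) powr (1 / q')"
        using q q' by (intro mult_mono powr_mono2 mu.finite_measure_mono sigma.finite_measure_mono sub) auto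
      also note B
      also have "measure nu (carleson_square b) \<le> measure nu (tent z (25 * s))"
        by (intro nu.finite_measure_mono sub2) auto
      also have "measure nu (tent z (25 * s)) \<le> D * measure nu (tent z s)"
        by (rule D(2)[OF z s]) simp
      finally have "measure mu (tent z s) powr (1 / q) * measure sigma (tent z s) powr (1 / q')
         \<le> (C0 * D) * measure nu (tent z s)" using C0(1) by (simp add: mult_ac)
      also have "\<dots> \<le> C * measure nu (tent z s)" by (intro mult_right_mono) (auto simp: C_def)
      finally show ?thesis .
    next
      case False
      have "c \<le> min s 1 / 16 * N (1 / 20)"
        unfolding c_def using False by (intro mult_right_mono N_nonneg) auto
      also have "\<dots> \<le> measure nu (tent z s \<inter> collar (1 / 20))"
        using False by (intro nu_tent_collar_lower z s) auto
      also have "\<dots> \<le> measure nu (tent z s)" by (intro nu.finite_measure_mono) auto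
      finally have "M / c * c \<le> C * measure nu (tent z s)"
        using c C by (intro mult_mono) (auto simp: C_def)
      moreover have "measure mu (tent z s) powr (1 / q) * measure sigma (tent z s) powr (1 / q') \<le> M"
        unfolding M_def using q q' mu.bounded_measure sigma.bounded_measure
        by (intro mult_mono powr_mono2) auto
      ultimately show ?thesis using c by simp
    qed
  qed
qed

text \<open>Hoelder's inequality on \<open>E\<close> bounds \<open>\<nu>(E)\<close> by \<open>\<omega>(E)\<^sup>1\<^sup>/\<^sup>q\<close> times a power of the dual mass of
  the tent; the latter is
  eliminated by the \<open>B\<^sub>q\<close> condition.\<close>

lemma A_infinity:
  obtains C where "0 < C" "\<And>z s E. z \<in> ball 0 1 \<Longrightarrow> 2 * (1 - cmod z) \<le> s \<Longrightarrow> E \<in> sets borel \<Longrightarrow>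
    E \<subseteq> tent z s \<Longrightarrow> measure nu E powr q * measure mu (tent z s) \<le> C * measure mu E * measure nu (tent z s) powr q"
proof -
  obtain C where C: "0 < C" "\<And>z s. z \<in> ball 0 1 \<Longrightarrow> 2 * (1 - cmod z) \<le> s \<Longrightarrow>
    measure mu (tent z s) powr (1 / q) * measure sigma (tent z s) powr (1 / q') \<le> C * measure nu (tent z s)"
    using Bq_tent by blast
  show thesis
  proof (rule that[of "C powr q"])
    show "0 < C powr q" using C by simp
    fix z :: complex and s E assume z: "z \<in> ball 0 1" and s: "2 * (1 - cmod z) \<le> s"
      and E: "E \<in> sets borel" "E \<subseteq> tent z s"
    let ?T = "tent z s"
    have "measure nu E powr q \<le> (measure mu E powr (1 / q) * measure sigma ?T powr (1 / q')) powr q"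
      using nu_le_mu_sigma[OF E(1) _ E(2)] q by (intro powr_mono2) auto
    also have "\<dots> = measure mu E * (measure sigma ?T powr (1 / q')) powr q"
      using q by (simp add: powr_mult powr_powr)
    finally have "measure nu E powr q * measure mu ?T \<le>
        (measure mu E * (measure sigma ?T powr (1 / q')) powr q) * measure mu ?T"
      by (intro mult_right_mono) auto
    also have "\<dots> = measure mu E * (measure mu ?T powr (1 / q) * measure sigma ?T powr (1 / q')) powr q"
      using q by (simp add: powr_mult powr_powr)
    also have "\<dots> \<le> measure mu E * (C * measure nu ?T) powr q"
      using C(2)[OF z s] q by (intro mult_left_mono powr_mono2) auto
    also have "\<dots> = C powr q * measure mu E * measure nu ?T powr q"
      by (simp add: powr_mult)
    finally show "measure nu E powr q * measure mu ?T \<le> C powr q * measure mu E * measure nu ?T powr q" .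
  qed
qed

lemma mu_proportion:
  assumes c: "0 < c"
  obtains C where "C \<ge> 1" "\<And>z s E. z \<in> ball 0 1 \<Longrightarrow> 2 * (1 - cmod z) \<le> s \<Longrightarrow> E \<in> sets borel \<Longrightarrow>
    E \<subseteq> tent z s \<Longrightarrow> c * measure nu (tent z s) \<le> measure nu E \<Longrightarrow> measure mu (tent z s) \<le> C * measure mu E"
proof -
  obtain C where C: "0 < C" "\<And>z s E. z \<in> ball 0 1 \<Longrightarrow> 2 * (1 - cmod z) \<le> s \<Longrightarrow> E \<in> sets borel \<Longrightarrow>
    E \<subseteq> tent z s \<Longrightarrow> measure nu E powr q * measure mu (tent z s) \<le> C * measure mu E * measure nu (tent z s) powr q"
    using A_infinity by blast
  show thesis
  proof (rule that[of "max 1 (C / c powr q)"])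
    fix z :: complex and s E assume z: "z \<in> ball 0 1" and s: "2 * (1 - cmod z) \<le> s"
      and E: "E \<in> sets borel" "E \<subseteq> tent z s" and cE: "c * measure nu (tent z s) \<le> measure nu E"
    let ?T = "tent z s"
    have nT: "0 < measure nu ?T" by (rule nu_tent_pos[OF z s])
    have "(c * measure nu ?T) powr q * measure mu ?T \<le> measure nu E powr q * measure mu ?T"
      using cE q c by (intro mult_right_mono powr_mono2) auto
    also have "\<dots> \<le> C * measure mu E * measure nu ?T powr q"
      by (rule C(2)[OF z s E])
    finally have "(c powr q * measure mu ?T) * measure nu ?T powr q \<le> (C * measure mu E) * measure nu ?T powr q"
      using c by (simp add: powr_mult mult_ac)
    then have "c powr q * measure mu ?T \<le> C * measure mu E"
      using nT by (simp add: mult_le_cancel_right)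
    then have "measure mu ?T \<le> C / c powr q * measure mu E"
      using c by (simp add: field_simps)
    also have "\<dots> \<le> max 1 (C / c powr q) * measure mu E"
      by (intro mult_right_mono) auto
    finally show "measure mu ?T \<le> max 1 (C / c powr q) * measure mu E" .
  qed simp
qed

end

section \<open>Doubling and decay towards the boundary\<close>

text \<open>Every point of a collar sees a fixed proportion of area at the scale of the collar.\<close>

lemma collar_contains_ball:
  assumes x: "x \<in> collar h" and h: "0 < h" "h \<le> 1"
  obtains y where "ball y (h / 4) \<subseteq> collar h \<inter> ball x (2 * h)"
proof -
  have "\<exists>u. cmod u = 1 \<and> x = of_real (cmod x) * u"
  proof (cases "x = 0")
    case False
    then show ?thesis by (intro exI[of _ "x / of_real (cmod x)"]) (simp add: norm_divide)
  qed (auto intro!: exI[of _ 1])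
  then obtain u where u: "cmod u = 1" "x = of_real (cmod x) * u" by blast
  define y where "y = of_real (1 - 3 * h / 4) * u"
  have xh: "1 - h \<le> cmod x" "cmod x < 1" using x by (auto simp: collar_def)
  have ny: "cmod y = 1 - 3 * h / 4"
    unfolding y_def norm_mult u(1) norm_of_real using h by simp
  have xy: "cmod (x - y) \<le> 3 * h / 4"
  proof -
    have "x - y = of_real (cmod x - (1 - 3 * h / 4)) * u"
      using u(2) by (simp add: y_def algebra_simps)
    then have "cmod (x - y) = \<bar>cmod x - (1 - 3 * h / 4)\<bar>"
      by (simp only: norm_mult norm_of_real u(1) mult_1_right)
    also have "\<dots> \<le> 3 * h / 4" by (rule abs_leI; use xh h in argo)
    finally show ?thesis .
  qed
  show thesis
  proof (rule that[of y], rule)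
    fix w assume "w \<in> ball y (h / 4)"
    then have w: "cmod (w - y) < h / 4" by (simp add: dist_norm norm_minus_commute)
    have "cmod w \<le> cmod y + cmod (w - y)" using norm_triangle_ineq[of y "w - y"] by simp
    then have 1: "cmod w < 1" using w ny h by argo
    have "cmod y \<le> cmod w + cmod (w - y)" using norm_triangle_ineq4[of w "w - y"] by simp
    then have 2: "1 - h \<le> cmod w" using w ny by argo
    have "cmod (x - w) \<le> cmod (x - y) + cmod (w - y)" using norm_triangle_ineq4[of "x - y" "w - y"] by simp
    then have 3: "cmod (x - w) < 2 * h" using w xy h by argo
    show "w \<in> collar h \<inter> ball x (2 * h)" using 1 2 3 by (simp add: collar_def dist_norm)
  qed
qed

context bekolle
begin

text \<open>The smaller tent carries a fixed proportion of the \<open>\<nu>\<close>-mass of the larger one.\<close>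

lemma mu_tent_doubling:
  obtains C where "C \<ge> 1" "\<And>z s s'. z \<in> ball 0 1 \<Longrightarrow> 2 * (1 - cmod z) \<le> s \<Longrightarrow> s' \<le> \<Lambda> * s \<Longrightarrow>
     measure mu (tent z s') \<le> C * measure mu (tent z s)"
proof -
  obtain D where D: "D \<ge> 1" "\<And>z s s'. z \<in> ball 0 1 \<Longrightarrow> 2 * (1 - cmod z) \<le> s \<Longrightarrow> s' \<le> \<Lambda> * s \<Longrightarrow>
     measure nu (tent z s') \<le> D * measure nu (tent z s)"
    using nu_tent_doubling by blast
  have "1 / D > 0" using D(1) by simp
  then obtain C where C: "C \<ge> 1" "\<And>z s E. z \<in> ball 0 1 \<Longrightarrow> 2 * (1 - cmod z) \<le> s \<Longrightarrow> E \<in> sets borel \<Longrightarrow>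
    E \<subseteq> tent z s \<Longrightarrow> 1 / D * measure nu (tent z s) \<le> measure nu E \<Longrightarrow> measure mu (tent z s) \<le> C * measure mu E"
    using mu_proportion by blast
  show thesis
  proof (rule that[OF C(1)])
    fix z :: complex and s s' assume z: "z \<in> ball 0 1" and s: "2 * (1 - cmod z) \<le> s" and s': "s' \<le> \<Lambda> * s"
    show "measure mu (tent z s') \<le> C * measure mu (tent z s)"
    proof (cases "s \<le> s'")
      case True
      then show ?thesis
        using D(2)[OF z s s'] D(1) s by (intro C(2) z) (auto simp: field_simps tent_def)
    next
      case False
      have "measure mu (tent z s') \<le> 1 * measure mu (tent z s)"
        using False by (simp, intro mu.finite_measure_mono) (auto simp: tent_def)
      also have "\<dots> \<le> C * measure mu (tent z s)" using C(1) by (intro mult_right_mono) auto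
      finally show ?thesis .
    qed
  qed
qed

lemma mu_tent_nearby:
  obtains C where "C \<ge> 1" "\<And>z w s. w \<in> ball 0 1 \<Longrightarrow> cmod (z - w) \<le> A * (1 - cmod w) \<Longrightarrow> s \<le> B * (1 - cmod w) \<Longrightarrow>
     measure mu (tent z s) \<le> C * measure mu (tent w (2 * (1 - cmod w)))"
proof -
  obtain C where C: "C \<ge> 1" "\<And>z s s'. z \<in> ball 0 1 \<Longrightarrow> 2 * (1 - cmod z) \<le> s \<Longrightarrow> s' \<le> ((A + B) / 2) * s \<Longrightarrow>
     measure mu (tent z s') \<le> C * measure mu (tent z s)"
    using mu_tent_doubling by blast
  show thesis
  proof (rule that[OF C(1)])
    fix z w :: complex and s assume w: "w \<in> ball 0 1" and zw: "cmod (z - w) \<le> A * (1 - cmod w)"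
      and s: "s \<le> B * (1 - cmod w)"
    have "tent z s \<subseteq> tent w ((A + B) * (1 - cmod w))"
    proof
      fix x assume "x \<in> tent z s"
      then have x: "x \<in> ball 0 1" "cmod (x - z) < s" by (auto simp: tent_def dist_norm norm_minus_commute)
      have "cmod (x - w) \<le> cmod (x - z) + cmod (z - w)" using norm_triangle_ineq[of "x - z" "z - w"] by simp
      also have "\<dots> < (A + B) * (1 - cmod w)" using x(2) zw s by (simp add: distrib_right)
      finally show "x \<in> tent w ((A + B) * (1 - cmod w))"
        using x(1) by (simp add: tent_def dist_norm norm_minus_commute)
    qed
    then have "measure mu (tent z s) \<le> measure mu (tent w ((A + B) * (1 - cmod w)))"
      by (intro mu.finite_measure_mono) auto
    also have "\<dots> \<le> C * measure mu (tent w (2 * (1 - cmod w)))"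
      by (intro C(2) w) (auto simp: field_simps)
    finally show "measure mu (tent z s) \<le> C * measure mu (tent w (2 * (1 - cmod w)))" .
  qed
qed

lemma mu_tent_le_square:
  obtains C where "C \<ge> 1" "\<And>z. z \<in> ball 0 1 \<Longrightarrow> z \<noteq> 0 \<Longrightarrow>
     measure mu (tent z (2 * (1 - cmod z))) \<le> C * measure mu (carleson_square z)"
proof -
  obtain D where D: "D \<ge> 1" "\<And>z s s'. z \<in> ball 0 1 \<Longrightarrow> 2 * (1 - cmod z) \<le> s \<Longrightarrow> s' \<le> 1 * s \<Longrightarrow>
     measure nu (tent z s') \<le> D * (min s 1 * N (s / 2))"
    using nu_tent_le_collar[of 1] by blast
  have "1 / (32 * D) > 0" using D(1) by simp
  then obtain C where C: "C \<ge> 1" "\<And>z s E. z \<in> ball 0 1 \<Longrightarrow> 2 * (1 - cmod z) \<le> s \<Longrightarrow> E \<in> sets borel \<Longrightarrow>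
    E \<subseteq> tent z s \<Longrightarrow> 1 / (32 * D) * measure nu (tent z s) \<le> measure nu E \<Longrightarrow> measure mu (tent z s) \<le> C * measure mu E"
    using mu_proportion by blast
  show thesis
  proof (rule that[OF C(1)])
    fix z :: complex assume z: "z \<in> ball 0 1" "z \<noteq> 0"
    define g where "g = 1 - cmod z"
    have gg: "2 * (1 - cmod z) \<le> 2 * g" by (simp add: g_def)
    have "measure nu (tent z (2 * g)) \<le> D * (min (2 * g) 1 * N g)"
      using D(2)[OF z(1) gg, of "2 * g"] by simp
    also have "\<dots> \<le> D * (2 * g * N g)"
      using D(1) by (intro mult_left_mono mult_mono) (auto simp: N_nonneg g_def z(1)[simplified, THEN less_imp_le])
    also have "\<dots> = 32 * D * (g / 16 * N g)" by simp
    also have "\<dots> \<le> 32 * D * measure nu (carleson_square z)"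
      using nu_carleson_square_lower[OF z] D(1) unfolding g_def by (intro mult_left_mono) auto
    finally have "1 / (32 * D) * measure nu (tent z (2 * g)) \<le> measure nu (carleson_square z)"
      using D(1) by (simp add: field_simps)
    then show "measure mu (tent z (2 * (1 - cmod z))) \<le> C * measure mu (carleson_square z)"
      unfolding g_def
      by (intro C(2) z(1) carleson_square_borel z carleson_square_subset_tent) auto
  qed
qed

text \<open>By the decay of \<open>N\<close> the strip at distance between \<open>\<delta> h\<close> and \<open>h\<close> from the boundary carries a fixed
  proportion of the \<open>\<nu>\<close>-mass of the tent.\<close>

lemma mu_tent_le_strip:
  obtains C \<delta> where "C \<ge> 1" "0 < \<delta>" "\<delta> < 1" "\<And>y h. y \<in> collar h \<Longrightarrow> h \<le> 1 \<Longrightarrow>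
     measure mu (tent y (2 * h)) \<le> C * measure mu (tent y (2 * h) \<inter> (collar h - collar (\<delta> * h)))"
proof -
  obtain D where D: "D \<ge> 1" "\<And>z s s'. z \<in> ball 0 1 \<Longrightarrow> 2 * (1 - cmod z) \<le> s \<Longrightarrow> s' \<le> 1 * s \<Longrightarrow>
     measure nu (tent z s') \<le> D * (min s 1 * N (s / 2))"
    using nu_tent_le_collar[of 1] by blast
  have "1 / (32 * D) > 0" using D(1) by simp
  then obtain C where C: "C \<ge> 1" "\<And>z s E. z \<in> ball 0 1 \<Longrightarrow> 2 * (1 - cmod z) \<le> s \<Longrightarrow> E \<in> sets borel \<Longrightarrow>
    E \<subseteq> tent z s \<Longrightarrow> 1 / (32 * D) * measure nu (tent z s) \<le> measure nu E \<Longrightarrow> measure mu (tent z s) \<le> C * measure mu E"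
    using mu_proportion by blast
  obtain \<delta> where \<delta>: "0 < \<delta>" "\<delta> < 1" "\<And>u. 0 < u \<Longrightarrow> u \<le> 1 \<Longrightarrow> N (\<delta> * u) \<le> 1 / 768 * N u"
    using N_decay[of "1 / 768"] by auto
  show thesis
  proof (rule that[OF C(1) \<delta>(1,2)])
    fix y h assume y: "y \<in> collar h" and h1: "h \<le> 1"
    then have yD: "y \<in> ball 0 1" and yh: "1 - cmod y \<le> h" by (auto simp: collar_def)
    have h0: "0 < h" using yD yh by (auto intro: less_le_trans[rotated])
    have s: "2 * (1 - cmod y) \<le> 2 * h" using yh by simp
    have \<delta>h: "\<delta> * h \<le> h" using \<delta> h0 by simp
    let ?m = "min (2 * h) 1"
    have m: "0 \<le> ?m" using h0 by simp
    have "?m / 16 * N h \<le> measure nu (tent y (2 * h) \<inter> collar h)"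
      using nu_tent_collar_lower[OF yD s, of h] by simp
    moreover have "measure nu (tent y (2 * h) \<inter> collar (\<delta> * h)) \<le> 24 * ?m * N (\<delta> * h)"
      by (rule nu_tent_collar_upper[OF yD s])
    moreover have "24 * ?m * N (\<delta> * h) \<le> 24 * ?m * (1 / 768 * N h)"
      using \<delta>(3)[OF h0 h1] m by (intro mult_left_mono) auto
    moreover have "measure nu (tent y (2 * h) \<inter> (collar h - collar (\<delta> * h))) =
      measure nu (tent y (2 * h) \<inter> collar h) - measure nu (tent y (2 * h) \<inter> collar (\<delta> * h))"
    proof -
      have "tent y (2 * h) \<inter> (collar h - collar (\<delta> * h)) = tent y (2 * h) \<inter> collar h - tent y (2 * h) \<inter> collar (\<delta> * h)"
        by blast
      then show ?thesis using collar_mono[OF \<delta>h] by (simp, intro nu.finite_measure_Diff) auto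
    qed
    moreover have "24 * ?m * (1 / 768 * N h) = ?m * N h / 32" "?m / 16 * N h = ?m * N h / 16" by simp_all
    ultimately have "?m * N h / 32 \<le> measure nu (tent y (2 * h) \<inter> (collar h - collar (\<delta> * h)))"
      by linarith
    moreover have "measure nu (tent y (2 * h)) \<le> D * (?m * N (2 * h / 2))"
      by (rule D(2)[OF yD s]) simp
    then have "1 / (32 * D) * measure nu (tent y (2 * h)) \<le> ?m * N h / 32"
      using D(1) by (simp add: field_simps)
    ultimately have "1 / (32 * D) * measure nu (tent y (2 * h)) \<le>
        measure nu (tent y (2 * h) \<inter> (collar h - collar (\<delta> * h)))" by linarith
    then show "measure mu (tent y (2 * h)) \<le> C * measure mu (tent y (2 * h) \<inter> (collar h - collar (\<delta> * h)))"
      by (intro C(2) yD s) auto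
  qed
qed

text \<open>Average the preceding lemma over the centre \<open>y\<close>: each point of the collar belongs to tents whose centres fill an area
  of order \<open>h\<^sup>2\<close>, and each point of the strip to at most that many. An average over \<open>y\<close> replaces a covering with
  bounded overlap; its price is the enlargement of the disc by \<open>4 h\<close>.\<close>

lemma collar_mass_le_strip:
  obtains C \<delta> where "C \<ge> 1" "0 < \<delta>" "\<delta> < 1" "\<And>a s h. 0 < h \<Longrightarrow> h \<le> 1 \<Longrightarrow>
     measure mu (collar h \<inter> ball a s) \<le> C * measure mu ((collar h - collar (\<delta> * h)) \<inter> ball a (s + 4 * h))"
proof -
  obtain C \<delta> where C: "C \<ge> 1" and \<delta>: "0 < \<delta>" "\<delta> < 1" and strip: "\<And>y h. y \<in> collar h \<Longrightarrow> h \<le> 1 \<Longrightarrow>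
     measure mu (tent y (2 * h)) \<le> C * measure mu (tent y (2 * h) \<inter> (collar h - collar (\<delta> * h)))"
    using mu_tent_le_strip by blast
  interpret pair_sigma_finite area mu ..
  show thesis
  proof (rule that[of "64 * C", OF _ \<delta>])
    show "1 \<le> 64 * C" using C by simp
    fix a :: complex and s h :: real assume h: "0 < h" "h \<le> 1"
    define S where "S = collar h - collar (\<delta> * h)"
    have [measurable]: "S \<in> sets borel" by (simp add: S_def)
    define E where "E = collar h \<inter> ball a s"
    define E' where "E' = S \<inter> ball a (s + 4 * h)"
    have [measurable]: "E \<in> sets borel" "E' \<in> sets borel" by (simp_all add: E_def E'_def)
    define near where "near = (\<lambda>x y :: complex. indicator {r. r < 2 * h} (dist x y) :: ennreal)"
    have near [measurable]: "case_prod near \<in> borel_measurable (borel \<Otimes>\<^sub>M borel)"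
      unfolding near_def by measurable
    have "ennreal ((h / 4)\<^sup>2) * emeasure mu E = (\<integral>\<^sup>+x. ennreal ((h / 4)\<^sup>2) * indicator E x \<partial>mu)"
      by (simp add: nn_integral_cmult_indicator)
    also have "\<dots> \<le> (\<integral>\<^sup>+x. (\<integral>\<^sup>+y. indicator E x * (indicator (collar h) y * near x y) \<partial>area) \<partial>mu)"
    proof (rule nn_integral_mono)
      fix x
      show "ennreal ((h / 4)\<^sup>2) * indicator E x \<le> (\<integral>\<^sup>+y. indicator E x * (indicator (collar h) y * near x y) \<partial>area)"
      proof (cases "x \<in> E")
        case True
        then have "x \<in> collar h" by (simp add: E_def)
        then obtain y0 where y0: "ball y0 (h / 4) \<subseteq> collar h \<inter> ball x (2 * h)"
          using collar_contains_ball h by blast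
        have "ennreal ((h / 4)\<^sup>2) = emeasure area (ball y0 (h / 4))"
          using h by (subst emeasure_area_ball) auto
        also have "\<dots> = (\<integral>\<^sup>+y. indicator (ball y0 (h / 4)) y \<partial>area)" by simp
        also have "\<dots> \<le> (\<integral>\<^sup>+y. indicator E x * (indicator (collar h) y * near x y) \<partial>area)"
          using y0 True by (intro nn_integral_mono) (auto simp: indicator_def near_def)
        finally show ?thesis using True by simp
      qed simp
    qed
    also have "\<dots> = (\<integral>\<^sup>+y. (\<integral>\<^sup>+x. indicator E x * (indicator (collar h) y * near x y) \<partial>mu) \<partial>area)"
      by (rule Fubini') (unfold near_def, measurable)
    also have "\<dots> \<le> (\<integral>\<^sup>+y. (\<integral>\<^sup>+x. ennreal C * (indicator E' x * near x y) \<partial>mu) \<partial>area)"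
    proof (rule nn_integral_mono)
      fix y
      show "(\<integral>\<^sup>+x. indicator E x * (indicator (collar h) y * near x y) \<partial>mu) \<le> (\<integral>\<^sup>+x. ennreal C * (indicator E' x * near x y) \<partial>mu)"
      proof (cases "y \<in> collar h \<and> y \<in> ball a (s + 2 * h)")
        case True
        have "(\<integral>\<^sup>+x. indicator E x * (indicator (collar h) y * near x y) \<partial>mu) \<le> (\<integral>\<^sup>+x. indicator (tent y (2 * h)) x \<partial>mu)"
          by (intro nn_integral_mono) (auto simp: indicator_def near_def E_def tent_def collar_def dist_commute)
        also have "\<dots> \<le> ennreal C * emeasure mu (tent y (2 * h) \<inter> S)"
          using strip[of y h] True h C by (simp add: mu.emeasure_eq_measure ennreal_mult'[symmetric] S_def)
        also have "\<dots> = (\<integral>\<^sup>+x. ennreal C * indicator (tent y (2 * h) \<inter> S) x \<partial>mu)"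
          by (simp add: nn_integral_cmult_indicator)
        also have "\<dots> \<le> (\<integral>\<^sup>+x. ennreal C * (indicator E' x * near x y) \<partial>mu)"
        proof (intro nn_integral_mono mult_left_mono)
          fix x
          show "indicator (tent y (2 * h) \<inter> S) x \<le> indicator E' x * near x y"
          proof (cases "x \<in> tent y (2 * h) \<inter> S")
            case xT: True
            then have "dist y x < 2 * h" "x \<in> S" by (auto simp: tent_def)
            moreover have "dist a x < s + 4 * h"
              using dist_triangle[of a x y] True \<open>dist y x < 2 * h\<close> by simp
            ultimately show ?thesis by (simp add: E'_def near_def dist_commute indicator_def)
          qed simp
        qed simp
        finally show ?thesis .
      next
        case False
        have "(\<integral>\<^sup>+x. indicator E x * (indicator (collar h) y * near x y) \<partial>mu) = (\<integral>\<^sup>+x. 0 \<partial>mu)"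
        proof (intro nn_integral_cong)
          fix x
          have "\<not> (x \<in> E \<and> y \<in> collar h \<and> dist x y < 2 * h)"
            using False dist_triangle[of a y x] by (auto simp: E_def)
          then show "indicator E x * (indicator (collar h) y * near x y) = 0"
            by (auto simp: near_def indicator_def)
        qed
        then show ?thesis by simp
      qed
    qed
    also have "\<dots> = (\<integral>\<^sup>+x. (\<integral>\<^sup>+y. ennreal C * (indicator E' x * near x y) \<partial>area) \<partial>mu)"
      by (rule Fubini'[symmetric]) (unfold near_def, measurable)
    also have "\<dots> = (\<integral>\<^sup>+x. ennreal C * ennreal ((2 * h)\<^sup>2) * indicator E' x \<partial>mu)"
    proof (rule nn_integral_cong)
      fix x
      have "(\<integral>\<^sup>+y. near x y \<partial>area) = (\<integral>\<^sup>+y. indicator (ball x (2 * h)) y \<partial>area)"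
        by (intro nn_integral_cong) (auto simp: near_def indicator_def)
      also have "\<dots> = ennreal ((2 * h)\<^sup>2)"
        using h emeasure_area_ball[of "2 * h" x] by simp
      finally have "(\<integral>\<^sup>+y. near x y \<partial>area) = ennreal ((2 * h)\<^sup>2)" .
      moreover have "(\<lambda>y. near x y) \<in> borel_measurable borel"
        unfolding near_def by measurable
      ultimately show "(\<integral>\<^sup>+y. ennreal C * (indicator E' x * near x y) \<partial>area) = ennreal C * ennreal ((2 * h)\<^sup>2) * indicator E' x"
        by (simp add: nn_integral_cmult mult_ac)
    qed
    also have "\<dots> = ennreal C * ennreal ((2 * h)\<^sup>2) * emeasure mu E'"
      by (simp add: nn_integral_cmult_indicator)
    finally have "(h / 4)\<^sup>2 * measure mu E \<le> C * (2 * h)\<^sup>2 * measure mu E'"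
      using C by (simp add: mu.emeasure_eq_measure ennreal_mult'[symmetric])
    then have "h\<^sup>2 * measure mu E \<le> h\<^sup>2 * (64 * C * measure mu E')"
      by (simp add: power_mult_distrib power_divide field_simps)
    then have "measure mu E \<le> 64 * C * measure mu E'"
      using h by (simp add: mult_le_cancel_left)
    then show "measure mu (collar h \<inter> ball a s) \<le> 64 * C * measure mu ((collar h - collar (\<delta> * h)) \<inter> ball a (s + 4 * h))"
      unfolding E_def E'_def S_def .
  qed
qed

text \<open>Subtracting the mass of the inner collar turns the preceding bound into a contraction by \<open>C / (1 + C)\<close>.
  The enlargements in the successive steps form a geometric series, so they stay bounded.\<close>

lemma collar_mass_decay:
  obtains \<kappa> \<delta> where "0 < \<kappa>" "\<kappa> < 1" "0 < \<delta>" "\<delta> < 1" "\<And>m a s h. 0 < h \<Longrightarrow> h \<le> 1 \<Longrightarrow>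
     measure mu (collar (\<delta> ^ m * h) \<inter> ball a s) \<le> \<kappa> ^ m * measure mu (ball 0 1 \<inter> ball a (s + 4 * h / (1 - \<delta>)))"
proof -
  obtain C \<delta> where C: "C \<ge> 1" and \<delta>: "0 < \<delta>" "\<delta> < 1" and le: "\<And>a s h. 0 < h \<Longrightarrow> h \<le> 1 \<Longrightarrow>
     measure mu (collar h \<inter> ball a s) \<le> C * measure mu ((collar h - collar (\<delta> * h)) \<inter> ball a (s + 4 * h))"
    using collar_mass_le_strip by blast
  define \<kappa> where "\<kappa> = C / (1 + C)"
  have \<kappa>: "0 < \<kappa>" "\<kappa> < 1" using C by (auto simp: \<kappa>_def)
  have step: "measure mu (collar (\<delta> * h) \<inter> ball a s) \<le> \<kappa> * measure mu (collar h \<inter> ball a (s + 4 * h))"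
    if h: "0 < h" "h \<le> 1" for a s h
  proof -
    have sub: "collar (\<delta> * h) \<subseteq> collar h" using h \<delta> by (intro collar_mono) simp
    let ?b = "measure mu (collar (\<delta> * h) \<inter> ball a s)"
    let ?B = "measure mu (collar (\<delta> * h) \<inter> ball a (s + 4 * h))"
    let ?A = "measure mu (collar h \<inter> ball a (s + 4 * h))"
    have "?b \<le> measure mu (collar h \<inter> ball a s)" using sub by (intro mu.finite_measure_mono) auto
    also have "\<dots> \<le> C * measure mu ((collar h - collar (\<delta> * h)) \<inter> ball a (s + 4 * h))"
      by (rule le[OF h])
    also have "(collar h - collar (\<delta> * h)) \<inter> ball a (s + 4 * h) =
        collar h \<inter> ball a (s + 4 * h) - collar (\<delta> * h) \<inter> ball a (s + 4 * h)" by blast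
    also have "measure mu \<dots> = ?A - ?B"
      using sub by (intro mu.finite_measure_Diff) auto
    finally have "?b \<le> C * (?A - ?B)" .
    moreover have "?b \<le> ?B" using h by (intro mu.finite_measure_mono) auto
    \<comment> \<open>Only the part in the smaller disc is kept, so that it can be absorbed on the left.\<close>
    then have "C * (?A - ?B) \<le> C * (?A - ?b)" using C by (intro mult_left_mono) auto
    ultimately have "?b \<le> C * (?A - ?b)" by linarith
    then show ?thesis using C by (simp add: \<kappa>_def field_simps)
  qed
  have it: "measure mu (collar (\<delta> ^ m * h) \<inter> ball a s)
     \<le> \<kappa> ^ m * measure mu (collar h \<inter> ball a (s + 4 * h * (\<Sum>i<m. \<delta> ^ i)))"
    if h: "0 < h" "h \<le> 1" for a s h m
  proof (induction m arbitrary: s)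
    case (Suc m)
    have "\<delta> ^ m * h \<le> 1 * 1" using \<delta> h by (intro mult_mono power_le_one) auto
    then have dh: "0 < \<delta> ^ m * h" "\<delta> ^ m * h \<le> 1" using \<delta> h by auto
    have "measure mu (collar (\<delta> ^ Suc m * h) \<inter> ball a s) \<le> \<kappa> * measure mu (collar (\<delta> ^ m * h) \<inter> ball a (s + 4 * (\<delta> ^ m * h)))"
      using step[OF dh, of a s] by (simp add: mult.assoc)
    also have "\<dots> \<le> \<kappa> * (\<kappa> ^ m * measure mu (collar h \<inter> ball a (s + 4 * (\<delta> ^ m * h) + 4 * h * (\<Sum>i<m. \<delta> ^ i))))"
      using \<kappa> by (intro mult_left_mono Suc) auto
    also have "s + 4 * (\<delta> ^ m * h) + 4 * h * (\<Sum>i<m. \<delta> ^ i) = s + 4 * h * (\<Sum>i<Suc m. \<delta> ^ i)"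
      by (simp add: algebra_simps)
    finally show ?case by (simp add: mult.assoc)
  qed simp
  show thesis
  proof (rule that[OF \<kappa> \<delta>])
    fix m a s and h :: real assume h: "0 < h" "h \<le> 1"
    have "(\<Sum>i<m. \<delta> ^ i) \<le> 1 / (1 - \<delta>)"
      using \<delta> by (subst sum_gp_strict) (auto simp: divide_right_mono)
    then have "4 * h * (\<Sum>i<m. \<delta> ^ i) \<le> 4 * h * (1 / (1 - \<delta>))"
      using h by (intro mult_left_mono) auto
    then have "s + 4 * h * (\<Sum>i<m. \<delta> ^ i) \<le> s + 4 * h / (1 - \<delta>)" by simp
    then have "collar h \<inter> ball a (s + 4 * h * (\<Sum>i<m. \<delta> ^ i)) \<subseteq> ball 0 1 \<inter> ball a (s + 4 * h / (1 - \<delta>))"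
      by (auto simp: collar_def)
    then have "\<kappa> ^ m * measure mu (collar h \<inter> ball a (s + 4 * h * (\<Sum>i<m. \<delta> ^ i)))
        \<le> \<kappa> ^ m * measure mu (ball 0 1 \<inter> ball a (s + 4 * h / (1 - \<delta>)))"
      using \<kappa> by (intro mult_left_mono mu.finite_measure_mono) auto
    with it[OF h, of m a s]
    show "measure mu (collar (\<delta> ^ m * h) \<inter> ball a s) \<le> \<kappa> ^ m * measure mu (ball 0 1 \<inter> ball a (s + 4 * h / (1 - \<delta>)))"
      by linarith
  qed
qed

text \<open>Sum over the strips \<open>\<delta>\<^sup>m\<^sup>+\<^sup>1 g < gap x \<le> \<delta>\<^sup>m g\<close>: the integrand grows like \<open>\<delta>\<^sup>-\<^sup>\<eta>\<^sup>m\<close> and the mass decays like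
  \<open>\<kappa>\<^sup>m\<close>.\<close>

lemma negative_power_integrable:
  obtains \<eta> where "0 < \<eta>" "\<And>R. \<exists>C>0. \<forall>w\<in>ball 0 1.
     (\<integral>\<^sup>+x\<in>tent w (R * (1 - cmod w)). ennreal ((1 - cmod x) powr (- \<eta>)) \<partial>mu)
       \<le> ennreal (C * (1 - cmod w) powr (- \<eta>) * measure mu (tent w (2 * (1 - cmod w))))"
proof -
  obtain \<kappa> \<delta> where \<kappa>: "0 < \<kappa>" "\<kappa> < 1" and \<delta>: "0 < \<delta>" "\<delta> < 1" and dec: "\<And>m a s h. 0 < h \<Longrightarrow> h \<le> 1 \<Longrightarrow>
     measure mu (collar (\<delta> ^ m * h) \<inter> ball a s) \<le> \<kappa> ^ m * measure mu (ball 0 1 \<inter> ball a (s + 4 * h / (1 - \<delta>)))"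
    using collar_mass_decay by blast
  \<comment> \<open>Chosen so that \<open>\<delta>\<^sup>-\<^sup>\<eta> = \<kappa>\<^sup>-\<^sup>1\<^sup>/\<^sup>2\<close>: half of the decay remains.\<close>
  define \<eta> where "\<eta> = ln \<kappa> / (2 * ln \<delta>)"
  have ln: "ln \<kappa> < 0" "ln \<delta> < 0" using \<kappa> \<delta> by auto
  then have \<eta>: "0 < \<eta>" by (simp add: \<eta>_def divide_neg_neg)
  have \<delta>\<eta>: "\<delta> powr (- \<eta>) = \<kappa> powr (- 1 / 2)"
    using \<delta> \<kappa> ln by (simp add: powr_def \<eta>_def)
  define \<gamma> where "\<gamma> = \<kappa> powr (1 / 2)"
  have \<gamma>: "0 < \<gamma>" "\<gamma> < 1" using \<kappa> powr_less_mono2[of "1/2" \<kappa> 1] by (auto simp: \<gamma>_def)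
  have \<delta>\<kappa>: "\<delta> powr (- \<eta>) * \<kappa> = \<gamma>"
  proof -
    have "\<delta> powr (- \<eta>) * \<kappa> = \<kappa> powr (- 1 / 2) * \<kappa> powr 1" using \<kappa> by (simp add: \<delta>\<eta>)
    also have "\<dots> = \<kappa> powr (- 1 / 2 + 1)" by (rule powr_add[symmetric])
    finally show ?thesis by (simp add: \<gamma>_def)
  qed
  show thesis
  proof (rule that[OF \<eta>])
    fix R :: real
    define R' where "R' = max R 0 + 4 / (1 - \<delta>)"
    obtain D where D: "D \<ge> 1" "\<And>z s s'. z \<in> ball 0 1 \<Longrightarrow> 2 * (1 - cmod z) \<le> s \<Longrightarrow> s' \<le> (R' / 2) * s \<Longrightarrow>
       measure mu (tent z s') \<le> D * measure mu (tent z s)"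
      using mu_tent_doubling by blast
    define C where "C = \<delta> powr (- \<eta>) * (D + D / (1 - \<gamma>))"
    have C: "C > 0" using D \<gamma> \<delta> by (simp add: C_def add_pos_pos)
    show "\<exists>C>0. \<forall>w\<in>ball 0 1.
     (\<integral>\<^sup>+x\<in>tent w (R * (1 - cmod w)). ennreal ((1 - cmod x) powr (- \<eta>)) \<partial>mu)
       \<le> ennreal (C * (1 - cmod w) powr (- \<eta>) * measure mu (tent w (2 * (1 - cmod w))))"
    proof (intro exI[of _ C] conjI C ballI)
      fix w :: complex assume w: "w \<in> ball 0 1"
      define g where "g = 1 - cmod w"
      have g: "0 < g" "g \<le> 1" using w by (auto simp: g_def)
      define T where "T = tent w (R * g)"
      define M where "M = measure mu (tent w (2 * g))"
      have [measurable]: "T \<in> sets borel" by (simp add: T_def)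
      have MR: "measure mu (tent w (R' * g)) \<le> D * M"
        unfolding M_def g_def by (intro D(2) w) (auto simp: algebra_simps)
      have sub: "T \<subseteq> tent w (R' * g)"
      proof -
        have "R * g \<le> R' * g" using g \<delta> by (intro mult_right_mono) (auto simp: R'_def add_increasing2)
        then show ?thesis by (auto simp: T_def tent_def)
      qed
      have pw: "ennreal ((1 - cmod x) powr (- \<eta>)) * indicator T x \<le>
         ennreal ((\<delta> * g) powr (- \<eta>)) * indicator T x +
         (\<Sum>m. ennreal ((\<delta> ^ Suc m * g) powr (- \<eta>)) * indicator (collar (\<delta> ^ m * g) \<inter> T) x)" for x
      proof (cases "x \<in> T")
        case True
        then have x: "cmod x < 1" by (simp add: T_def tent_def)
        define t where "t = 1 - cmod x"
        have t: "0 < t" using x by (simp add: t_def)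
        show ?thesis
        proof (cases "\<delta> * g \<le> t")
          case dg: True
          have "t powr (- \<eta>) \<le> (\<delta> * g) powr (- \<eta>)"
            using dg \<delta> g \<eta> by (intro powr_mono2') auto
          then show ?thesis using True by (simp add: t_def add_increasing2 ennreal_leI)
        next
          case dg: False
          have "\<exists>m. \<delta> ^ m * g < t"
          proof -
            obtain m where "\<delta> ^ m < t / g" using real_arch_pow_inv[of "t / g" \<delta>] t g \<delta> by auto
            then show ?thesis using g by (auto simp: field_simps)
          qed
          define k where "k = (LEAST m. \<delta> ^ m * g < t)"
          have k: "\<delta> ^ k * g < t" unfolding k_def using \<open>\<exists>m. \<delta> ^ m * g < t\<close> by (rule LeastI_ex)
          have "k \<noteq> 0"
          proof
            assume "k = 0"
            then have "g < t" using k by simp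
            moreover have "\<delta> * g < g" using \<delta> g by simp
            ultimately show False using dg by simp
          qed
          then obtain m where m: "k = Suc m" by (cases k) auto
          then have "\<not> \<delta> ^ m * g < t" unfolding k_def by (intro not_less_Least) simp
          then have xm: "x \<in> collar (\<delta> ^ m * g)" using x by (simp add: collar_def t_def)
          have "t powr (- \<eta>) \<le> (\<delta> ^ Suc m * g) powr (- \<eta>)"
            using k \<delta> g \<eta> unfolding m by (intro powr_mono2') (auto simp del: power_Suc)
          then have "ennreal (t powr (- \<eta>)) * indicator T x \<le>
             ennreal ((\<delta> ^ Suc m * g) powr (- \<eta>)) * indicator (collar (\<delta> ^ m * g) \<inter> T) x"
            using True xm by (simp add: ennreal_leI del: power_Suc)
          also have "\<dots> \<le> (\<Sum>m. ennreal ((\<delta> ^ Suc m * g) powr (- \<eta>)) * indicator (collar (\<delta> ^ m * g) \<inter> T) x)"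
            by (rule ennreal_le_suminf)
          finally show ?thesis by (simp add: t_def add_increasing)
        qed
      qed simp
      have summand: "ennreal ((\<delta> ^ Suc m * g) powr (- \<eta>)) * emeasure mu (collar (\<delta> ^ m * g) \<inter> T)
          \<le> ennreal (\<delta> powr (- \<eta>) * g powr (- \<eta>) * (D * M) * \<gamma> ^ m)" for m
      proof -
        have eq: "(\<delta> ^ Suc m * g) powr (- \<eta>) = \<delta> powr (- \<eta>) * (\<delta> powr (- \<eta>)) ^ m * g powr (- \<eta>)"
        proof -
          have "(\<delta> ^ m) powr (- \<eta>) = (\<delta> powr (- \<eta>)) ^ m"
            using \<delta> by (simp add: powr_realpow[symmetric] powr_powr mult.commute powr_gt_zero)
          then show ?thesis using \<delta> g by (simp add: powr_mult)
        qed
        have "measure mu (collar (\<delta> ^ m * g) \<inter> T) \<le> measure mu (collar (\<delta> ^ m * g) \<inter> ball w (max R 0 * g))"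
        proof (intro mu.finite_measure_mono)
          have "R * g \<le> max R 0 * g" using g by (intro mult_right_mono) auto
          then show "collar (\<delta> ^ m * g) \<inter> T \<subseteq> collar (\<delta> ^ m * g) \<inter> ball w (max R 0 * g)"
            by (auto simp: T_def tent_def)
        qed auto
        also have "\<dots> \<le> \<kappa> ^ m * measure mu (ball 0 1 \<inter> ball w (max R 0 * g + 4 * g / (1 - \<delta>)))"
          by (rule dec[OF g])
        also have "max R 0 * g + 4 * g / (1 - \<delta>) = R' * g" by (simp add: R'_def distrib_right)
        also have "\<kappa> ^ m * measure mu (ball 0 1 \<inter> ball w (R' * g)) \<le> \<kappa> ^ m * (D * M)"
          using MR \<kappa> unfolding tent_def by (intro mult_left_mono) auto
        finally have "(\<delta> ^ Suc m * g) powr (- \<eta>) * measure mu (collar (\<delta> ^ m * g) \<inter> T)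
           \<le> (\<delta> ^ Suc m * g) powr (- \<eta>) * (\<kappa> ^ m * (D * M))"
          by (intro mult_left_mono) auto
        also have "(\<delta> ^ Suc m * g) powr (- \<eta>) * (\<kappa> ^ m * (D * M)) =
            \<delta> powr (- \<eta>) * g powr (- \<eta>) * (D * M) * \<gamma> ^ m"
          unfolding eq \<delta>\<kappa>[symmetric] power_mult_distrib by (simp add: mult_ac)
        finally show ?thesis
          by (simp add: mu.emeasure_eq_measure ennreal_mult'[symmetric] ennreal_leI)
      qed
      have "(\<integral>\<^sup>+x\<in>T. ennreal ((1 - cmod x) powr (- \<eta>)) \<partial>mu) \<le>
        (\<integral>\<^sup>+x. ennreal ((\<delta> * g) powr (- \<eta>)) * indicator T x +
         (\<Sum>m. ennreal ((\<delta> ^ Suc m * g) powr (- \<eta>)) * indicator (collar (\<delta> ^ m * g) \<inter> T) x) \<partial>mu)"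
        by (intro nn_integral_mono pw)
      also have "\<dots> = ennreal ((\<delta> * g) powr (- \<eta>)) * emeasure mu T +
         (\<Sum>m. ennreal ((\<delta> ^ Suc m * g) powr (- \<eta>)) * emeasure mu (collar (\<delta> ^ m * g) \<inter> T))"
        by (subst nn_integral_add) (auto simp: nn_integral_suminf nn_integral_cmult_indicator simp del: power_Suc)
      also have "\<dots> \<le> ennreal (\<delta> powr (- \<eta>) * g powr (- \<eta>) * (D * M)) +
         (\<Sum>m. ennreal (\<delta> powr (- \<eta>) * g powr (- \<eta>) * (D * M) * \<gamma> ^ m))"
      proof (intro add_mono suminf_le summand)
        have "measure mu T \<le> D * M"
          using MR by (rule order_trans[rotated]) (intro mu.finite_measure_mono sub, auto)
        then have "(\<delta> * g) powr (- \<eta>) * measure mu T \<le> (\<delta> * g) powr (- \<eta>) * (D * M)"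
          by (intro mult_left_mono) auto
        then show "ennreal ((\<delta> * g) powr (- \<eta>)) * emeasure mu T \<le> ennreal (\<delta> powr (- \<eta>) * g powr (- \<eta>) * (D * M))"
          using \<delta> g by (simp add: mu.emeasure_eq_measure ennreal_mult'[symmetric] ennreal_leI powr_mult)
      qed auto
      also have "(\<Sum>m. ennreal (\<delta> powr (- \<eta>) * g powr (- \<eta>) * (D * M) * \<gamma> ^ m)) =
         ennreal (\<Sum>m. \<delta> powr (- \<eta>) * g powr (- \<eta>) * (D * M) * \<gamma> ^ m)"
        using \<gamma> D by (intro suminf_ennreal2 summable_mult summable_geometric mult_nonneg_nonneg)
          (auto simp: M_def)
      also have "(\<Sum>m. \<delta> powr (- \<eta>) * g powr (- \<eta>) * (D * M) * \<gamma> ^ m) =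
         \<delta> powr (- \<eta>) * g powr (- \<eta>) * (D * M) * (1 / (1 - \<gamma>))"
        using \<gamma> by (subst suminf_mult) (auto simp: suminf_geometric)
      also have "ennreal (\<delta> powr (- \<eta>) * g powr (- \<eta>) * (D * M)) +
         ennreal (\<delta> powr (- \<eta>) * g powr (- \<eta>) * (D * M) * (1 / (1 - \<gamma>))) =
         ennreal (C * g powr (- \<eta>) * M)"
        using \<gamma> D by (subst ennreal_plus[symmetric]) (auto simp: M_def C_def algebra_simps)
      finally show "(\<integral>\<^sup>+x\<in>tent w (R * (1 - cmod w)). ennreal ((1 - cmod x) powr (- \<eta>)) \<partial>mu)
       \<le> ennreal (C * (1 - cmod w) powr (- \<eta>) * measure mu (tent w (2 * (1 - cmod w))))"
        unfolding T_def M_def g_def .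
    qed
  qed
qed

end

section \<open>The averaged weight\<close>

abbreviation gap :: "complex \<Rightarrow> real" where
  "gap z \<equiv> 1 - cmod z"

text \<open>\<open>|f|\<^sup>p\<close> cut off outside the disc, where \<open>f\<close> may be arbitrary.\<close>

definition disc_pow :: "(complex \<Rightarrow> complex) \<Rightarrow> real \<Rightarrow> complex \<Rightarrow> ennreal" where
  "disc_pow f p x = ennreal (cmod (f x) powr p) * indicator (ball 0 1) x"

lemma disc_pow_borel:
  assumes "f holomorphic_on ball 0 1"
  shows "disc_pow f p \<in> borel_measurable borel"
proof -
  have [measurable]: "(\<lambda>x. f x * indicator (ball 0 1) x) \<in> borel_measurable borel"
    by (rule holomorphic_borel_measurable_on_open[OF assms]) simp
  have "disc_pow f p = (\<lambda>x. ennreal (cmod (f x * indicator (ball 0 1) x) powr p) * indicator (ball 0 1) x)"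
    by (auto simp: disc_pow_def indicator_def fun_eq_iff)
  also have "\<dots> \<in> borel_measurable borel" by measurable
  finally show ?thesis .
qed

lemma gap_triangle: "gap x \<le> gap z + cmod (x - z)" "gap z \<le> gap x + cmod (x - z)"
  using norm_triangle_ineq2[of x z] norm_triangle_ineq2[of z x] by (simp_all add: norm_minus_commute)

lemma ball_gap_subset:
  assumes "z \<in> ball 0 1"
  shows "ball z (gap z / 2) \<subseteq> ball 0 1"
proof
  fix x assume "x \<in> ball z (gap z / 2)"
  then have "cmod (x - z) < gap z / 2" by (simp add: dist_norm norm_minus_commute)
  then show "x \<in> ball 0 1" using gap_triangle(2)[of z x] assms by simp
qed

lemma emeasure_tent_measurable:
  assumes "sigma_finite_measure M" "sets M = sets borel"
  shows "(\<lambda>x. emeasure M (tent x (c * gap x))) \<in> borel_measurable borel"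
proof -
  interpret sigma_finite_measure M by fact
  have [measurable_cong]: "sets M = sets borel" by fact
  let ?S = "{w :: complex \<times> complex. cmod (snd w) < 1 \<and> cmod (fst w - snd w) < c * gap (fst w)}"
  have [measurable]: "?S \<in> sets (borel \<Otimes>\<^sub>M borel)"
    unfolding borel_prod by (intro borel_open open_Collect_conj open_Collect_less continuous_intros)
  have "emeasure M (tent x (c * gap x)) = (\<integral>\<^sup>+z. indicator ?S (x, z) \<partial>M)" for x
  proof -
    have "tent x (c * gap x) \<in> sets M" by (simp add: assms(2))
    then have "emeasure M (tent x (c * gap x)) = (\<integral>\<^sup>+z. indicator (tent x (c * gap x)) z \<partial>M)" by simp
    also have "\<dots> = (\<integral>\<^sup>+z. indicator ?S (x, z) \<partial>M)"
      by (intro nn_integral_cong) (auto simp: tent_def indicator_def dist_norm)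
    finally show ?thesis .
  qed
  moreover have "(\<lambda>x. \<integral>\<^sup>+z. indicator ?S (x, z) \<partial>M) \<in> borel_measurable borel" by measurable
  ultimately show ?thesis by simp
qed

text \<open>If \<open>\<Phi>(z)\<close> is bounded by the mean of \<open>F\<close> over the disc about \<open>z\<close> of half the radius possible, interchange the
  integrals: the points \<open>z\<close> that see a given \<open>x\<close> lie within \<open>gap x\<close> of \<open>x\<close>, and their gaps are comparable to that of \<open>x\<close>.\<close>

lemma local_average_swap:
  fixes M :: "complex measure"
  assumes M: "sigma_finite_measure M" "sets M = sets borel"
    and [measurable]: "\<Phi> \<in> borel_measurable borel" "F \<in> borel_measurable borel"
    and C: "C \<ge> 0"
    and le: "\<And>z. z \<in> ball 0 1 \<Longrightarrow> \<Phi> z * ennreal ((gap z)\<^sup>2) \<le> ennreal C * (\<integral>\<^sup>+x\<in>ball z (gap z / 2). F x \<partial>area)"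
  shows "(\<integral>\<^sup>+z\<in>ball 0 1. \<Phi> z \<partial>M) \<le>
    ennreal (9 / 4 * C) * (\<integral>\<^sup>+x\<in>ball 0 1. F x * ennreal (1 / (gap x)\<^sup>2) * emeasure M (tent x (gap x)) \<partial>area)"
proof -
  interpret M: sigma_finite_measure M by fact
  interpret pair_sigma_finite area M ..
  have [measurable_cong]: "sets M = sets borel" by fact
  define K :: "complex \<Rightarrow> complex \<Rightarrow> ennreal" where
    "K = (\<lambda>x z. F x * (ennreal (C / (gap z)\<^sup>2) * indicator {w. cmod (fst w - snd w) < gap (snd w) / 2} (x, z)
        * indicator (ball 0 1) z))"
  have meas: "{w :: complex \<times> complex. cmod (fst w - snd w) < gap (snd w) / 2} \<in> sets (borel \<Otimes>\<^sub>M borel)"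
    unfolding borel_prod by (intro borel_open open_Collect_less continuous_intros) auto
  note [measurable] = this
  have Kb [measurable]: "case_prod K \<in> borel_measurable (area \<Otimes>\<^sub>M M)"
    unfolding K_def by measurable
  have "(\<integral>\<^sup>+z\<in>ball 0 1. \<Phi> z \<partial>M) \<le> (\<integral>\<^sup>+z. (\<integral>\<^sup>+x. K x z \<partial>area) \<partial>M)"
  proof (rule nn_integral_mono)
    fix z
    show "\<Phi> z * indicator (ball 0 1) z \<le> (\<integral>\<^sup>+x. K x z \<partial>area)"
    proof (cases "z \<in> ball 0 1")
      case True
      then have g: "gap z > 0" by simp
      have "\<Phi> z = \<Phi> z * ennreal ((gap z)\<^sup>2) * ennreal (1 / (gap z)\<^sup>2)"
        using g by (simp add: mult.assoc ennreal_mult'[symmetric])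
      also have "\<dots> \<le> ennreal C * (\<integral>\<^sup>+x\<in>ball z (gap z / 2). F x \<partial>area) * ennreal (1 / (gap z)\<^sup>2)"
        by (intro mult_right_mono le True) simp
      also have "\<dots> = ennreal (C / (gap z)\<^sup>2) * (\<integral>\<^sup>+x\<in>ball z (gap z / 2). F x \<partial>area)"
      proof -
        have "ennreal (C / (gap z)\<^sup>2) = ennreal C * ennreal (1 / (gap z)\<^sup>2)"
          using C by (simp add: ennreal_mult'[symmetric])
        then show ?thesis by (simp add: mult_ac)
      qed
      also have "\<dots> = (\<integral>\<^sup>+x. ennreal (C / (gap z)\<^sup>2) * (F x * indicator (ball z (gap z / 2)) x) \<partial>area)"
        by (rule nn_integral_cmult[symmetric]) simp
      also have "\<dots> = (\<integral>\<^sup>+x. K x z \<partial>area)"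
        using True by (intro nn_integral_cong) (auto simp: K_def indicator_def dist_norm norm_minus_commute mult.commute)
      finally show ?thesis using True by simp
    qed simp
  qed
  also have "\<dots> = (\<integral>\<^sup>+x. (\<integral>\<^sup>+z. K x z \<partial>M) \<partial>area)"
    by (rule Fubini') simp
  also have "\<dots> \<le> (\<integral>\<^sup>+x\<in>ball 0 1. ennreal (9 / 4 * C) * (F x * ennreal (1 / (gap x)\<^sup>2) * emeasure M (tent x (gap x))) \<partial>area)"
  proof (rule nn_integral_mono)
    fix x
    have K: "K x z \<le> (ennreal (9 / 4 * C) * (F x * ennreal (1 / (gap x)\<^sup>2)) * indicator (ball 0 1) x) * indicator (tent x (gap x)) z" for z
    proof (cases "z \<in> ball 0 1 \<and> cmod (x - z) < gap z / 2")
      case True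
      then have gz: "gap z > 0" and xz: "cmod (x - z) < gap z / 2" by auto
      have "x \<in> ball z (gap z / 2)" using xz by (simp add: dist_norm norm_minus_commute)
      then have xD: "x \<in> ball 0 1" using ball_gap_subset[of z] True by blast
      have gx: "gap x > 0" using xD by simp
      have "gap x \<le> 3 / 2 * gap z" using gap_triangle(1)[of x z] xz by argo
      then have "(gap x)\<^sup>2 \<le> (3 / 2 * gap z)\<^sup>2" using gx by (intro power_mono) auto
      also have "\<dots> = 9 / 4 * (gap z)\<^sup>2" by (simp only: power_mult_distrib) (simp add: power_divide)
      finally have "(gap x)\<^sup>2 \<le> 9 / 4 * (gap z)\<^sup>2" .
      then have "C * (gap x)\<^sup>2 \<le> C * (9 / 4 * (gap z)\<^sup>2)" using C by (rule mult_left_mono)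
      then have "C / (gap z)\<^sup>2 \<le> 9 / 4 * C * (1 / (gap x)\<^sup>2)"
        using gz gx by (simp add: divide_le_eq le_divide_eq field_simps)
      then have 1: "ennreal (C / (gap z)\<^sup>2) \<le> ennreal (9 / 4 * C) * ennreal (1 / (gap x)\<^sup>2)"
        using C by (simp add: ennreal_mult'[symmetric] ennreal_leI)
      have "cmod (x - z) < gap x" using gap_triangle(2)[of z x] xz by argo
      then have 2: "z \<in> tent x (gap x)" using True by (simp add: tent_def dist_norm)
      have "K x z = F x * ennreal (C / (gap z)\<^sup>2)" using True by (simp add: K_def)
      also have "\<dots> \<le> F x * (ennreal (9 / 4 * C) * ennreal (1 / (gap x)\<^sup>2))"
        by (rule mult_left_mono[OF 1]) simp
      finally show ?thesis using 2 xD by (simp add: mult_ac)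
    qed (auto simp: K_def indicator_def)
    have "(\<integral>\<^sup>+z. K x z \<partial>M) \<le> (\<integral>\<^sup>+z. (ennreal (9 / 4 * C) * (F x * ennreal (1 / (gap x)\<^sup>2)) * indicator (ball 0 1) x) * indicator (tent x (gap x)) z \<partial>M)"
      by (intro nn_integral_mono K)
    also have "\<dots> = ennreal (9 / 4 * C) * (F x * ennreal (1 / (gap x)\<^sup>2)) * indicator (ball 0 1) x * emeasure M (tent x (gap x))"
      by (rule nn_integral_cmult_indicator) (simp add: M)
    finally show "(\<integral>\<^sup>+z. K x z \<partial>M) \<le>
      ennreal (9 / 4 * C) * (F x * ennreal (1 / (gap x)\<^sup>2) * emeasure M (tent x (gap x))) * indicator (ball 0 1) x"
      by (simp add: mult_ac)
  qed
  also have "\<dots> = (\<integral>\<^sup>+x. ennreal (9 / 4 * C) * (F x * ennreal (1 / (gap x)\<^sup>2) * emeasure M (tent x (gap x)) * indicator (ball 0 1) x) \<partial>area)"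
    by (simp add: mult.assoc)
  also have "\<dots> = ennreal (9 / 4 * C) * (\<integral>\<^sup>+x\<in>ball 0 1. F x * ennreal (1 / (gap x)\<^sup>2) * emeasure M (tent x (gap x)) \<partial>area)"
  proof (rule nn_integral_cmult)
    have [measurable]: "(\<lambda>x. emeasure M (tent x (gap x))) \<in> borel_measurable borel"
      using emeasure_tent_measurable[OF M, of 1] by simp
    show "(\<lambda>x. F x * ennreal (1 / (gap x)\<^sup>2) * emeasure M (tent x (gap x)) * indicator (ball 0 1) x) \<in> borel_measurable area"
      by simp
  qed
  finally show ?thesis .
qed

lemma disc_pow_submean:
  assumes f: "f holomorphic_on ball 0 1" and p: "0 < p" and z: "z \<in> ball 0 1"
  shows "disc_pow f p z * ennreal ((gap z)\<^sup>2) \<le> ennreal 4 * (\<integral>\<^sup>+x\<in>ball z (gap z / 2). disc_pow f p x \<partial>area)"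
proof -
  have g: "gap z > 0" using z by simp
  have "disc_pow f p z * ennreal ((gap z)\<^sup>2) = ennreal (cmod (f z) powr p * (gap z)\<^sup>2)"
    using z by (simp add: disc_pow_def ennreal_mult')
  also have "cmod (f z) powr p * (gap z)\<^sup>2 = 4 * (cmod (f z) powr p * (gap z / 2)\<^sup>2)"
    by (simp add: power_divide)
  also have "ennreal \<dots> = ennreal 4 * ennreal (cmod (f z) powr p * (gap z / 2)\<^sup>2)"
    by (rule ennreal_mult') simp
  also have "\<dots> \<le> ennreal 4 * (\<integral>\<^sup>+x\<in>ball z (gap z / 2). ennreal (cmod (f x) powr p) \<partial>area)"
    using g by (intro mult_left_mono area_submean p holomorphic_on_subset[OF f] ball_gap_subset z) auto
  also have "(\<integral>\<^sup>+x\<in>ball z (gap z / 2). ennreal (cmod (f x) powr p) \<partial>area) =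
     (\<integral>\<^sup>+x\<in>ball z (gap z / 2). disc_pow f p x \<partial>area)"
    using ball_gap_subset[OF z] by (intro nn_integral_cong) (auto simp: disc_pow_def indicator_def)
  finally show ?thesis .
qed

context bekolle
begin

text \<open>Comparable to the averaged weight of the theorem, with the tent of size \<open>2 gap z\<close> in place of the Carleson square of \<open>z\<close>.\<close>

definition V :: "complex \<Rightarrow> real" where
  "V z = measure mu (tent z (2 * gap z)) / (gap z)\<^sup>2"

abbreviation V_weighted_norm :: "real \<Rightarrow> real \<Rightarrow> (complex \<Rightarrow> complex) \<Rightarrow> ennreal" where
  "V_weighted_norm p \<beta> f \<equiv> \<integral>\<^sup>+x. disc_pow f p x * ennreal (gap x powr \<beta>) * ennreal (V x) \<partial>area"

abbreviation V_norm :: "real \<Rightarrow> (complex \<Rightarrow> complex) \<Rightarrow> ennreal" where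
  "V_norm p f \<equiv> \<integral>\<^sup>+x. disc_pow f p x * ennreal (V x) \<partial>area"

lemma V_nonneg: "0 \<le> V z"
  by (simp add: V_def)

lemma emeasure_tent_borel [measurable]: "(\<lambda>z. emeasure mu (tent z (2 * gap z))) \<in> borel_measurable borel"
  by (rule emeasure_tent_measurable) (simp_all add: mu.sigma_finite_measure_axioms)

lemma V_borel [measurable]: "V \<in> borel_measurable borel"
  unfolding V_def measure_def by measurable

text \<open>Slow variation of \<open>V\<close> on the hyperbolic scale.\<close>

lemma V_nearby:
  assumes A: "A > 0"
  obtains C where "C \<ge> 1" "\<And>z w. z \<in> ball 0 1 \<Longrightarrow> w \<in> ball 0 1 \<Longrightarrow> cmod (z - w) \<le> A * gap w \<Longrightarrow> gap w \<le> A * gap z \<Longrightarrow>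
     V z \<le> C * V w"
proof -
  obtain C where C: "C \<ge> 1" "\<And>z w s. w \<in> ball 0 1 \<Longrightarrow> cmod (z - w) \<le> A * gap w \<Longrightarrow> s \<le> (2 * (1 + A)) * gap w \<Longrightarrow>
     measure mu (tent z s) \<le> C * measure mu (tent w (2 * gap w))"
    using mu_tent_nearby by blast
  show thesis
  proof (rule that[of "max 1 (C * A\<^sup>2)"])
    fix z w :: complex assume z: "z \<in> ball 0 1" and w: "w \<in> ball 0 1"
      and zw: "cmod (z - w) \<le> A * gap w" and g: "gap w \<le> A * gap z"
    have "2 * gap z \<le> (2 * (1 + A)) * gap w"
      using gap_triangle(1)[of z w] zw by (simp add: algebra_simps)
    then have m: "measure mu (tent z (2 * gap z)) \<le> C * measure mu (tent w (2 * gap w))"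
      by (intro C(2) w zw)
    have gp: "gap z > 0" "gap w > 0" using z w by auto
    have "(gap w)\<^sup>2 \<le> (A * gap z)\<^sup>2" using g gp by (intro power_mono) auto
    then have "1 / (gap z)\<^sup>2 \<le> A\<^sup>2 * (1 / (gap w)\<^sup>2)"
      using gp by (simp add: divide_le_eq le_divide_eq power_mult_distrib mult_ac)
    then have "measure mu (tent z (2 * gap z)) * (1 / (gap z)\<^sup>2) \<le>
        (C * measure mu (tent w (2 * gap w))) * (A\<^sup>2 * (1 / (gap w)\<^sup>2))"
      using m C(1) by (intro mult_mono) auto
    then have "V z \<le> (C * A\<^sup>2) * V w" by (simp add: V_def mult_ac)
    also have "\<dots> \<le> max 1 (C * A\<^sup>2) * V w" by (intro mult_right_mono V_nonneg) auto
    finally show "V z \<le> max 1 (C * A\<^sup>2) * V w" .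
  qed simp
qed

lemma mu_norm_le_V_norm:
  assumes p: "0 < p"
  shows "\<exists>C>0. \<forall>f. f holomorphic_on ball 0 1 \<longrightarrow>
    (\<integral>\<^sup>+x. disc_pow f p x \<partial>mu) \<le> ennreal C * V_norm p f"
proof (intro exI[of _ 9] conjI allI impI)
  fix f :: "complex \<Rightarrow> complex" assume f: "f holomorphic_on ball 0 1"
  note [measurable] = disc_pow_borel[OF f]
  have "(\<integral>\<^sup>+x. disc_pow f p x \<partial>mu) = (\<integral>\<^sup>+x\<in>ball 0 1. disc_pow f p x \<partial>mu)"
    by (intro nn_integral_cong) (auto simp: disc_pow_def indicator_def)
  also have "\<dots> \<le> ennreal (9 / 4 * 4) * (\<integral>\<^sup>+x\<in>ball 0 1. disc_pow f p x * ennreal (1 / (gap x)\<^sup>2) * emeasure mu (tent x (gap x)) \<partial>area)"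
    by (intro local_average_swap disc_pow_submean f p mu.sigma_finite_measure_axioms) simp_all
  also have "\<dots> \<le> ennreal 9 * V_norm p f"
  proof -
    have "disc_pow f p x * ennreal (1 / (gap x)\<^sup>2) * emeasure mu (tent x (gap x)) * indicator (ball 0 1) x
       \<le> disc_pow f p x * ennreal (V x)" for x
    proof (cases "x \<in> ball 0 1")
      case True
      have "emeasure mu (tent x (gap x)) \<le> emeasure mu (tent x (2 * gap x))"
        using True by (intro emeasure_mono) (auto simp: tent_def)
      then have "ennreal (1 / (gap x)\<^sup>2) * emeasure mu (tent x (gap x)) \<le> ennreal (1 / (gap x)\<^sup>2) * emeasure mu (tent x (2 * gap x))"
        by (rule mult_left_mono) simp
      also have "\<dots> = ennreal (V x)"
        by (simp add: V_def mu.emeasure_eq_measure ennreal_mult'[symmetric])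
      finally show ?thesis using True by (simp add: mult.assoc mult_left_mono)
    qed simp
    then show ?thesis by (simp, intro mult_left_mono nn_integral_mono) auto
  qed
  finally show "(\<integral>\<^sup>+x. disc_pow f p x \<partial>mu) \<le> ennreal 9 * V_norm p f" .
qed simp

lemma derivative_le_V_norm:
  assumes p: "0 < p"
  shows "\<exists>C>0. \<forall>f. f holomorphic_on ball 0 1 \<longrightarrow>
    V_weighted_norm p (real k * p) ((deriv ^^ k) f)
      \<le> ennreal C * V_norm p f"
proof -
  obtain C0 where C0: "C0 > 0"
    "\<And>f c R. f holomorphic_on ball c R \<Longrightarrow> R > 0 \<Longrightarrow>
       ennreal (cmod ((deriv ^^ k) f c) powr p * R powr (real k * p)) * ennreal (R\<^sup>2)
         \<le> ennreal C0 * (\<integral>\<^sup>+x\<in>ball c R. ennreal (cmod (f x) powr p) \<partial>area)"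
    using area_submean_deriv[OF p, where k = k] by blast
  obtain C2 where C2: "C2 \<ge> 1" "\<And>z w. z \<in> ball 0 1 \<Longrightarrow> w \<in> ball 0 1 \<Longrightarrow> cmod (z - w) \<le> 2 * gap w \<Longrightarrow> gap w \<le> 2 * gap z \<Longrightarrow>
     V z \<le> C2 * V w"
    using V_nearby[of 2] by auto
  define C where "C = 4 * 2 powr (real k * p) * C0"
  have C: "C > 0" using C0 by (simp add: C_def)
  show ?thesis
  proof (intro exI[of _ "9 / 4 * C * C2"] conjI allI impI)
    show "0 < 9 / 4 * C * C2" using C C2 by simp
    fix f :: "complex \<Rightarrow> complex" assume f: "f holomorphic_on ball 0 1"
    have fk: "(deriv ^^ k) f holomorphic_on ball 0 1"
      using f by (rule holomorphic_higher_deriv) simp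
    note [measurable] = disc_pow_borel[OF f] disc_pow_borel[OF fk]
    define \<Phi> where "\<Phi> = (\<lambda>x. disc_pow ((deriv ^^ k) f) p x * ennreal (gap x powr (real k * p)) * ennreal (V x))"
    define F where "F = (\<lambda>x. disc_pow f p x * ennreal (V x))"
    have [measurable]: "\<Phi> \<in> borel_measurable borel" "F \<in> borel_measurable borel"
      unfolding \<Phi>_def F_def by measurable
    have "(\<integral>\<^sup>+x. \<Phi> x \<partial>area) = (\<integral>\<^sup>+x\<in>ball 0 1. \<Phi> x \<partial>area)"
      by (intro nn_integral_cong) (auto simp: \<Phi>_def disc_pow_def indicator_def)
    also have "\<dots> \<le> ennreal (9 / 4 * (C * C2)) * (\<integral>\<^sup>+x\<in>ball 0 1. F x * ennreal (1 / (gap x)\<^sup>2) * emeasure area (tent x (gap x)) \<partial>area)"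
    proof (rule local_average_swap)
      fix z :: complex assume z: "z \<in> ball 0 1"
      have g: "gap z > 0" using z by simp
      have "ennreal (cmod ((deriv ^^ k) f z) powr p * (gap z / 2) powr (real k * p)) * ennreal ((gap z / 2)\<^sup>2)
         \<le> ennreal C0 * (\<integral>\<^sup>+x\<in>ball z (gap z / 2). ennreal (cmod (f x) powr p) \<partial>area)"
        using g by (intro C0(2) holomorphic_on_subset[OF f] ball_gap_subset z) auto
      then have "ennreal (4 * 2 powr (real k * p)) * (ennreal (cmod ((deriv ^^ k) f z) powr p * (gap z / 2) powr (real k * p)) * ennreal ((gap z / 2)\<^sup>2))
         \<le> ennreal (4 * 2 powr (real k * p)) * (ennreal C0 * (\<integral>\<^sup>+x\<in>ball z (gap z / 2). ennreal (cmod (f x) powr p) \<partial>area))"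
        by (rule mult_left_mono) simp
      moreover have "4 * 2 powr (real k * p) * (cmod ((deriv ^^ k) f z) powr p * (gap z / 2) powr (real k * p) * (gap z / 2)\<^sup>2) =
         cmod ((deriv ^^ k) f z) powr p * gap z powr (real k * p) * (gap z)\<^sup>2"
        using g by (simp add: powr_divide power_divide)
      moreover have "ennreal (cmod ((deriv ^^ k) f z) powr p * gap z powr (real k * p) * (gap z)\<^sup>2) =
         ennreal (4 * 2 powr (real k * p)) * (ennreal (cmod ((deriv ^^ k) f z) powr p * (gap z / 2) powr (real k * p)) * ennreal ((gap z / 2)\<^sup>2))"
        if "4 * 2 powr (real k * p) * (cmod ((deriv ^^ k) f z) powr p * (gap z / 2) powr (real k * p) * (gap z / 2)\<^sup>2) =
         cmod ((deriv ^^ k) f z) powr p * gap z powr (real k * p) * (gap z)\<^sup>2"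
      proof -
        have "ennreal (4 * 2 powr (real k * p) * (cmod ((deriv ^^ k) f z) powr p * (gap z / 2) powr (real k * p) * (gap z / 2)\<^sup>2)) =
          ennreal (4 * 2 powr (real k * p)) * (ennreal (cmod ((deriv ^^ k) f z) powr p * (gap z / 2) powr (real k * p)) * ennreal ((gap z / 2)\<^sup>2))"
          by (subst ennreal_mult', simp, subst ennreal_mult') simp_all
        then show ?thesis unfolding that .
      qed
      moreover have "ennreal C = ennreal (4 * 2 powr (real k * p)) * ennreal C0"
        unfolding C_def by (rule ennreal_mult') simp
      ultimately have "ennreal (cmod ((deriv ^^ k) f z) powr p * gap z powr (real k * p) * (gap z)\<^sup>2) \<le>
         ennreal C * (\<integral>\<^sup>+x\<in>ball z (gap z / 2). ennreal (cmod (f x) powr p) \<partial>area)"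
        by (simp only: simp_thms mult.assoc)
      then have "ennreal (V z) * ennreal (cmod ((deriv ^^ k) f z) powr p * gap z powr (real k * p) * (gap z)\<^sup>2) \<le>
         ennreal (V z) * (ennreal C * (\<integral>\<^sup>+x\<in>ball z (gap z / 2). ennreal (cmod (f x) powr p) \<partial>area))"
        by (rule mult_left_mono) simp
      also have "\<dots> = ennreal C * (\<integral>\<^sup>+x. ennreal (V z) * (disc_pow f p x * indicator (ball z (gap z / 2)) x) \<partial>area)"
      proof -
        have "(\<integral>\<^sup>+x\<in>ball z (gap z / 2). ennreal (cmod (f x) powr p) \<partial>area) = (\<integral>\<^sup>+x\<in>ball z (gap z / 2). disc_pow f p x \<partial>area)"
          using ball_gap_subset[OF z] by (intro nn_integral_cong) (auto simp: disc_pow_def indicator_def)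
        then show ?thesis by (subst nn_integral_cmult) (auto simp: mult_ac)
      qed
      also have "\<dots> \<le> ennreal C * (\<integral>\<^sup>+x. ennreal C2 * (F x * indicator (ball z (gap z / 2)) x) \<partial>area)"
      proof (intro mult_left_mono nn_integral_mono)
        fix x
        show "ennreal (V z) * (disc_pow f p x * indicator (ball z (gap z / 2)) x) \<le> ennreal C2 * (F x * indicator (ball z (gap z / 2)) x)"
        proof (cases "x \<in> ball z (gap z / 2)")
          case True
          then have xz: "cmod (x - z) < gap z / 2" by (simp add: dist_norm norm_minus_commute)
          have xD: "x \<in> ball 0 1" using ball_gap_subset[OF z] True by blast
          have "V z \<le> C2 * V x"
          proof (rule C2(2)[OF z xD])
            show "cmod (z - x) \<le> 2 * gap x" 
            proof -
              have "gap x > 0" using xD by simp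
              then show ?thesis using gap_triangle(2)[of z x] xz unfolding norm_minus_commute[of z x] by argo
            qed
            show "gap x \<le> 2 * gap z" using gap_triangle(1)[of x z] xz g by argo
          qed
          then have "ennreal (V z) \<le> ennreal C2 * ennreal (V x)"
            using C2(1) by (simp add: ennreal_mult'[symmetric] ennreal_leI)
          then have "disc_pow f p x * ennreal (V z) \<le> disc_pow f p x * (ennreal C2 * ennreal (V x))"
            by (rule mult_left_mono) simp
          then show ?thesis using True by (simp add: F_def mult_ac)
        qed simp
      qed simp
      also have "\<dots> = ennreal (C * C2) * (\<integral>\<^sup>+x\<in>ball z (gap z / 2). F x \<partial>area)"
        using C C2(1) by (subst nn_integral_cmult) (auto simp: ennreal_mult mult.assoc)
      finally show "\<Phi> z * ennreal ((gap z)\<^sup>2) \<le> ennreal (C * C2) * (\<integral>\<^sup>+x\<in>ball z (gap z / 2). F x \<partial>area)"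
        using z by (simp add: \<Phi>_def disc_pow_def ennreal_mult mult_ac)
    qed (use C C2 area.sigma_finite_measure_axioms in simp_all)
    also have "\<dots> \<le> ennreal (9 / 4 * (C * C2)) * (\<integral>\<^sup>+x. F x \<partial>area)"
    proof (intro mult_left_mono nn_integral_mono)
      fix x
      show "F x * ennreal (1 / (gap x)\<^sup>2) * emeasure area (tent x (gap x)) * indicator (ball 0 1) x \<le> F x"
      proof (cases "x \<in> ball 0 1")
        case True
        then have g: "gap x > 0" by simp
        have "emeasure area (tent x (gap x)) \<le> emeasure area (ball x (gap x))"
          by (intro emeasure_mono) (auto simp: tent_def)
        also have "\<dots> = ennreal ((gap x)\<^sup>2)" using g by (intro emeasure_area_ball) simp
        finally have "ennreal (1 / (gap x)\<^sup>2) * emeasure area (tent x (gap x)) \<le> ennreal (1 / (gap x)\<^sup>2) * ennreal ((gap x)\<^sup>2)"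
          by (rule mult_left_mono) simp
        also have "\<dots> = 1" using g by (simp add: ennreal_mult'[symmetric])
        finally have "F x * (ennreal (1 / (gap x)\<^sup>2) * emeasure area (tent x (gap x))) \<le> F x * 1"
          by (rule mult_left_mono) simp
        then show ?thesis using True by (simp add: mult.assoc)
      qed simp
    qed simp
    finally show "V_weighted_norm p (real k * p) ((deriv ^^ k) f)
      \<le> ennreal (9 / 4 * C * C2) * V_norm p f"
      by (simp add: \<Phi>_def F_def mult.assoc)
  qed
qed

lemma mu_tent_pos:
  assumes z: "z \<in> ball 0 1" and s: "2 * gap z \<le> s"
  shows "0 < measure mu (tent z s)"
proof (rule ccontr)
  assume "\<not> 0 < measure mu (tent z s)"
  then have "measure mu (tent z s) = 0" by (simp add: zero_less_measure_iff)
  moreover have "measure nu (tent z s) \<le> measure mu (tent z s) powr (1 / q) * measure sigma (tent z s) powr (1 / q')"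
    by (rule nu_le_mu_sigma) auto
  ultimately show False using nu_tent_pos[OF z s] by simp
qed

text \<open>On the disc of radius \<open>1/2\<close> the weight \<open>V\<close> is bounded below, by doubling.\<close>

lemma deriv_at_0_le_V_norm:
  assumes p: "0 < p"
  shows "\<exists>C>0. \<forall>f. f holomorphic_on ball 0 1 \<longrightarrow>
    ennreal (cmod ((deriv ^^ j) f 0) powr p) \<le> ennreal C * V_norm p f"
proof -
  obtain C0 where C0: "C0 > 0"
    "\<And>f c R. f holomorphic_on ball c R \<Longrightarrow> R > 0 \<Longrightarrow>
       ennreal (cmod ((deriv ^^ j) f c) powr p * R powr (real j * p)) * ennreal (R\<^sup>2)
         \<le> ennreal C0 * (\<integral>\<^sup>+x\<in>ball c R. ennreal (cmod (f x) powr p) \<partial>area)"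
    using area_submean_deriv[OF p, where k = j] by blast
  obtain C1 where C1: "C1 \<ge> 1" "\<And>z w s. w \<in> ball 0 1 \<Longrightarrow> cmod (z - w) \<le> 1 * gap w \<Longrightarrow> s \<le> 4 * gap w \<Longrightarrow>
     measure mu (tent z s) \<le> C1 * measure mu (tent w (2 * gap w))"
    using mu_tent_nearby[of 1 4] by blast
  define m where "m = measure mu (tent 0 2)"
  have m: "m > 0" unfolding m_def by (rule mu_tent_pos) auto
  have Vlow: "m / C1 \<le> V x" if x: "x \<in> ball 0 (1/2)" for x
  proof -
    have xn: "cmod x < 1 / 2" using x by simp
    have "m \<le> C1 * measure mu (tent x (2 * gap x))"
      unfolding m_def using xn by (intro C1(2)) auto
    then have "m / C1 \<le> measure mu (tent x (2 * gap x))" using C1(1) by (simp add: field_simps)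
    also have "\<dots> \<le> V x"
    proof -
      have "(gap x)\<^sup>2 \<le> 1" using xn by (intro power_le_one) auto
      moreover have "(gap x)\<^sup>2 > 0" using xn by simp
      ultimately show ?thesis unfolding V_def by (simp add: le_divide_eq mult_left_le)
    qed
    finally show ?thesis .
  qed
  define C where "C = 4 * 2 powr (real j * p) * C0 * (C1 / m)"
  show ?thesis
  proof (intro exI[of _ C] conjI allI impI)
    show "0 < C" using C0 C1 m by (simp add: C_def)
    fix f :: "complex \<Rightarrow> complex" assume f: "f holomorphic_on ball 0 1"
    note [measurable] = disc_pow_borel[OF f]
    have "ennreal (cmod ((deriv ^^ j) f 0) powr p) =
       ennreal (4 * 2 powr (real j * p)) * (ennreal (cmod ((deriv ^^ j) f 0) powr p * (1/2) powr (real j * p)) * ennreal ((1/2)\<^sup>2))"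
      by (simp add: ennreal_mult'[symmetric] powr_divide power2_eq_square)
    also have "\<dots> \<le> ennreal (4 * 2 powr (real j * p)) * (ennreal C0 * (\<integral>\<^sup>+x\<in>ball 0 (1/2). ennreal (cmod (f x) powr p) \<partial>area))"
      by (intro mult_left_mono C0(2) holomorphic_on_subset[OF f]) auto
    also have "(\<integral>\<^sup>+x\<in>ball 0 (1/2). ennreal (cmod (f x) powr p) \<partial>area) \<le> (\<integral>\<^sup>+x. ennreal (C1 / m) * (disc_pow f p x * ennreal (V x)) \<partial>area)"
    proof (intro nn_integral_mono)
      fix x
      show "ennreal (cmod (f x) powr p) * indicator (ball 0 (1/2)) x \<le> ennreal (C1 / m) * (disc_pow f p x * ennreal (V x))"
      proof (cases "x \<in> ball 0 (1/2)")
        case True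
        have "1 \<le> C1 / m * V x" using Vlow[OF True] m C1(1) by (simp add: field_simps)
        then have "cmod (f x) powr p * 1 \<le> cmod (f x) powr p * (C1 / m * V x)" by (intro mult_left_mono) auto
        then have "ennreal (cmod (f x) powr p) \<le> ennreal (cmod (f x) powr p * (C1 / m * V x))" by (intro ennreal_leI) simp
        also have "\<dots> = ennreal (C1 / m) * (ennreal (cmod (f x) powr p) * ennreal (V x))"
          using m C1(1) by (simp add: ennreal_mult'[symmetric] mult_ac V_nonneg)
        finally show ?thesis using True by (simp add: disc_pow_def)
      qed simp
    qed
    also have "\<dots> = ennreal (C1 / m) * V_norm p f"
      by (rule nn_integral_cmult) simp
    also have "ennreal (4 * 2 powr (real j * p)) * (ennreal C0 * (ennreal (C1 / m) * V_norm p f))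
       = ennreal C * V_norm p f"
      using C0(1) C1(1) m by (simp add: C_def ennreal_mult'[symmetric] mult.assoc[symmetric])
    finally show "ennreal (cmod ((deriv ^^ j) f 0) powr p) \<le> ennreal C * V_norm p f"
      by (simp add: mult_left_mono)
  qed
qed

end

section \<open>Bounding a function by averages against the original weight\<close>

context bekolle
begin

lemma emeasure_sigma_ball: "emeasure sigma (ball z s) = emeasure sigma (tent z s)"
  unfolding sigma_def
  by (subst (1 2) emeasure_disc_measure) (auto simp: tent_def indicator_def intro!: nn_integral_cong)

text \<open>The dual mass of the dyadic enlargements of a tent grows at most geometrically, by the \<open>B\<^sub>q\<close> condition and doubling of
  \<open>\<nu>\<close>; the exponent \<open>b\<close> of the kernel is chosen to beat this growth. The bound is what the \<open>B\<^sub>q\<close> condition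
  gives for the tent itself.\<close>

lemma sigma_kernel:
  obtains b :: nat and C :: real where "0 < C" "\<And>z. z \<in> ball 0 1 \<Longrightarrow>
    (\<integral>\<^sup>+y\<in>{y. gap z / 2 \<le> cmod (y - z)}. ennreal ((gap z / cmod (y - z)) powr (real b * q')) \<partial>sigma)
    \<le> ennreal ((C * measure nu (tent z (2 * gap z)) / measure mu (tent z (2 * gap z)) powr (1 / q)) powr q')"
proof -
  obtain C1 where C1: "0 < C1" "\<And>z s. z \<in> ball 0 1 \<Longrightarrow> 2 * gap z \<le> s \<Longrightarrow>
    measure mu (tent z s) powr (1 / q) * measure sigma (tent z s) powr (1 / q') \<le> C1 * measure nu (tent z s)"
    using Bq_tent by blast
  obtain D where D: "D \<ge> 1" "\<And>z s s'. z \<in> ball 0 1 \<Longrightarrow> 2 * gap z \<le> s \<Longrightarrow> s' \<le> 2 * s \<Longrightarrow>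
     measure nu (tent z s') \<le> D * measure nu (tent z s)"
    using nu_tent_doubling by blast
  obtain b :: nat where b: "2 * D < 2 ^ b" using real_arch_pow[of 2 "2 * D"] by auto
  have b0: "b \<noteq> 0" using b D(1) by (cases b) auto
  \<comment> \<open>\<open>2\<^sup>b\<close> rescales the kernel from \<open>h/2\<close> to \<open>h\<close>; the factor \<open>2\<close> is the sum of the geometric series.\<close>
  define C where "C = 2 ^ b * 2 * C1"
  have q0: "q' > 0" using q' by simp
  show thesis
  proof (rule that[of C b])
    show "0 < C" using C1 by (simp add: C_def)
    fix z :: complex assume z: "z \<in> ball 0 1"
    define h where "h = gap z"
    have h: "h > 0" using z by (simp add: h_def)
    define m0 where "m0 = measure mu (tent z (2 * h))"
    have m0: "m0 > 0" unfolding m0_def h_def by (rule mu_tent_pos[OF z]) simp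
    define n0 where "n0 = measure nu (tent z (2 * h))"
    have n0: "n0 \<ge> 0" by (simp add: n0_def)
    have it: "measure nu (tent z (2 ^ k * (2 * h))) \<le> D ^ k * n0" for k
    proof (induction k)
      case (Suc k)
      have "1 * (2 * gap z) \<le> 2 ^ k * (2 * h)" unfolding h_def using h
        by (intro mult_right_mono) (auto simp: h_def)
      then have "measure nu (tent z (2 ^ Suc k * (2 * h))) \<le> D * measure nu (tent z (2 ^ k * (2 * h)))"
        by (intro D(2) z) auto
      also have "\<dots> \<le> D * (D ^ k * n0)" using Suc D(1) by (intro mult_left_mono) auto
      finally show ?case by (simp add: mult.assoc)
    qed (simp add: n0_def)
    define X where "X = C1 * n0 / m0 powr (1 / q)"
    have X: "X \<ge> 0" using C1 n0 by (simp add: X_def)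
    have sg: "measure sigma (tent z (2 ^ k * (2 * h))) \<le> (D ^ k * X) powr q'" for k
    proof -
      let ?T = "tent z (2 ^ k * (2 * h))"
      have k1: "1 * (2 * h) \<le> 2 ^ k * (2 * h)" using h by (intro mult_right_mono) auto
      have "m0 powr (1 / q) * measure sigma ?T powr (1 / q') \<le> measure mu ?T powr (1 / q) * measure sigma ?T powr (1 / q')"
        using q k1 unfolding m0_def
        by (intro mult_right_mono powr_mono2 mu.finite_measure_mono) (auto simp: tent_def)
      also have "\<dots> \<le> C1 * measure nu ?T" using k1 by (intro C1(2) z) (simp add: h_def)
      also have "\<dots> \<le> C1 * (D ^ k * n0)" using it C1(1) by (intro mult_left_mono) auto
      finally have "measure sigma ?T powr (1 / q') \<le> D ^ k * X"
        using m0 by (simp add: X_def field_simps)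
      then have "(measure sigma ?T powr (1 / q')) powr q' \<le> (D ^ k * X) powr q'"
        using q0 by (intro powr_mono2) auto
      then show ?thesis using q0 by (simp add: powr_powr)
    qed
    have summand: "ennreal (2 powr (- (real k * (real b * q')))) * emeasure sigma (ball z (2 ^ (k + 1) * (h / 2)))
       \<le> ennreal (X powr q' * (1 / 2) ^ k)" for k
    proof -
      have "emeasure sigma (ball z (2 ^ (k + 1) * (h / 2))) = emeasure sigma (tent z (2 ^ k * h))"
        by (simp add: emeasure_sigma_ball)
      also have "\<dots> \<le> emeasure sigma (tent z (2 ^ k * (2 * h)))"
      proof (rule emeasure_mono)
        have "2 ^ k * h \<le> 2 ^ k * (2 * h)" using h by (intro mult_left_mono) auto
        then show "tent z (2 ^ k * h) \<subseteq> tent z (2 ^ k * (2 * h))" by (rule tent_mono)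
      qed simp
      also have "\<dots> \<le> ennreal ((D ^ k * X) powr q')"
        using sg[of k] by (simp add: sigma.emeasure_eq_measure ennreal_leI)
      finally have "ennreal (2 powr (- (real k * (real b * q')))) * emeasure sigma (ball z (2 ^ (k + 1) * (h / 2)))
         \<le> ennreal (2 powr (- (real k * (real b * q')))) * ennreal ((D ^ k * X) powr q')"
        by (rule mult_left_mono) simp
      also have "\<dots> = ennreal (2 powr (- (real k * (real b * q'))) * (D ^ k * X) powr q')"
        by (simp add: ennreal_mult')
      also have "\<dots> \<le> ennreal (X powr q' * (1 / 2) ^ k)"
      proof (rule ennreal_leI)
        have "2 powr (- (real k * (real b * q'))) = ((1 / 2 ^ b) ^ k) powr q'"
        proof -
          have "(1 / 2 ^ b) ^ k = (2::real) powr (- (real k * real b))"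
            by (simp add: powr_minus powr_realpow[symmetric] powr_powr field_simps flip: power_mult of_nat_mult)
          then show ?thesis by (simp add: powr_powr mult.assoc)
        qed
        then have "2 powr (- (real k * (real b * q'))) * (D ^ k * X) powr q' = ((1 / 2 ^ b) ^ k * (D ^ k * X)) powr q'"
          by (simp add: powr_mult)
        also have "(1 / 2 ^ b) ^ k * (D ^ k * X) = (D / 2 ^ b) ^ k * X"
          by (simp add: power_divide)
        also have "((D / 2 ^ b) ^ k * X) powr q' \<le> ((1 / 2) ^ k * X) powr q'"
          using b D(1) X q0 by (intro powr_mono2 mult_right_mono power_mono) (auto simp: field_simps)
        also have "\<dots> = ((1 / 2) ^ k) powr q' * X powr q'" by (rule powr_mult)
        also have "\<dots> \<le> ((1 / 2) ^ k) powr 1 * X powr q'"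
          using q' by (intro mult_right_mono powr_mono') (auto simp: power_le_one)
        finally show "2 powr (- (real k * (real b * q'))) * (D ^ k * X) powr q' \<le> X powr q' * (1 / 2) ^ k"
          by (simp add: mult.commute)
      qed
      finally show ?thesis .
    qed
    have "(\<integral>\<^sup>+y\<in>{y. h / 2 \<le> cmod (y - z)}. ennreal ((h / cmod (y - z)) powr (real b * q')) \<partial>sigma)
      = (\<integral>\<^sup>+y. ennreal (2 powr (real b * q')) * (ennreal ((h / 2 / cmod (y - z)) powr (real b * q')) * indicator {y. h / 2 \<le> cmod (y - z)} y) \<partial>sigma)"
    proof (rule nn_integral_cong)
      fix y
      have "h / cmod (y - z) = 2 * (h / 2 / cmod (y - z))" by simp
      then have "(h / cmod (y - z)) powr (real b * q') = 2 powr (real b * q') * (h / 2 / cmod (y - z)) powr (real b * q')"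
        using h by (metis powr_mult)
      then show "ennreal ((h / cmod (y - z)) powr (real b * q')) * indicator {y. h / 2 \<le> cmod (y - z)} y =
         ennreal (2 powr (real b * q')) * (ennreal ((h / 2 / cmod (y - z)) powr (real b * q')) * indicator {y. h / 2 \<le> cmod (y - z)} y)"
        by (simp add: ennreal_mult' mult.assoc)
    qed
    also have "\<dots> = ennreal (2 powr (real b * q')) * (\<integral>\<^sup>+y. ennreal ((h / 2 / cmod (y - z)) powr (real b * q')) * indicator {y. h / 2 \<le> cmod (y - z)} y \<partial>sigma)"
      by (rule nn_integral_cmult) measurable
    also have "\<dots> \<le> ennreal (2 powr (real b * q')) * (\<Sum>k. ennreal (2 powr (- (real k * (real b * q')))) * emeasure sigma (ball z (2 ^ (k + 1) * (h / 2))))"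
      using h b0 q0 by (intro mult_left_mono nn_integral_dyadic) auto
    also have "\<dots> \<le> ennreal (2 powr (real b * q')) * (\<Sum>k. ennreal (X powr q' * (1 / 2) ^ k))"
      by (intro mult_left_mono suminf_le summand) auto
    also have "(\<Sum>k. ennreal (X powr q' * (1 / 2) ^ k)) = ennreal (\<Sum>k. X powr q' * (1 / 2) ^ k)"
      by (intro suminf_ennreal2 summable_mult summable_geometric) auto
    also have "(\<Sum>k. X powr q' * (1 / 2) ^ k) = X powr q' * 2"
      by (subst suminf_mult) (auto simp: suminf_geometric)
    also have "ennreal (2 powr (real b * q')) * ennreal (X powr q' * 2) \<le> ennreal ((2 ^ b * 2 * X) powr q')"
    proof -
      have "2 powr (real b * q') * (X powr q' * 2) \<le> 2 powr (real b * q') * (X powr q' * 2 powr q')"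
        using q' powr_mono[of 1 q' 2] by (intro mult_left_mono) auto
      also have "\<dots> = (2 ^ b * 2 * X) powr q'"
        by (simp add: powr_mult powr_realpow[symmetric] powr_powr)
      finally show ?thesis by (simp add: ennreal_mult'[symmetric] ennreal_leI)
    qed
    also have "2 ^ b * 2 * X = C * n0 / m0 powr (1 / q)" by (simp add: X_def C_def)
    finally show "(\<integral>\<^sup>+y\<in>{y. gap z / 2 \<le> cmod (y - z)}. ennreal ((gap z / cmod (y - z)) powr (real b * q')) \<partial>sigma)
    \<le> ennreal ((C * measure nu (tent z (2 * gap z)) / measure mu (tent z (2 * gap z)) powr (1 / q)) powr q')"
      unfolding h_def n0_def m0_def .
  qed
qed

text \<open>A bound by circle means, integrated over the circles of a strip.\<close>

lemma nu_rotation_average_strip: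
  assumes [measurable]: "B \<in> borel_measurable borel"
    and le: "\<And>x. x \<in> collar u - collar v \<Longrightarrow> ennreal a \<le> (\<integral>\<^sup>+t\<in>{0..1}. B (unit_circle t * x) \<partial>lborel)"
  shows "ennreal a * emeasure nu (collar u - collar v) \<le> (\<integral>\<^sup>+x\<in>collar u - collar v. B x \<partial>nu)"
proof -
  let ?S = "collar u - collar v"
  define r where "r = (\<lambda>s. ennreal (n s) * indicator ({1 - u..<1} - {1 - v..}) s)"
  have r [measurable]: "r \<in> borel_measurable borel" unfolding r_def by measurable
  have rS: "r (cmod x) = ennreal (n (cmod x)) * indicator (ball 0 1) x * indicator ?S x" for x :: complex
    by (auto simp: r_def collar_def indicator_def)
  have nuS: "(\<integral>\<^sup>+x\<in>?S. G x \<partial>nu) = (\<integral>\<^sup>+x. r (cmod x) * G x \<partial>area)" if [measurable]: "G \<in> borel_measurable borel" for G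
  proof -
    have "(\<integral>\<^sup>+x\<in>?S. G x \<partial>nu) = (\<integral>\<^sup>+x\<in>ball 0 1. G x * indicator ?S x * ennreal (n (cmod x)) \<partial>area)"
      unfolding nu_eq by (rule nn_integral_disc_measure) measurable
    then show ?thesis by (simp add: rS mult_ac)
  qed
  have "ennreal a * emeasure nu ?S = (\<integral>\<^sup>+x\<in>?S. ennreal a \<partial>nu)"
    by (simp add: nn_integral_cmult_indicator)
  also have "\<dots> = (\<integral>\<^sup>+x. r (cmod x) * ennreal a \<partial>area)"
    by (rule nuS) simp
  also have "\<dots> \<le> (\<integral>\<^sup>+x. r (cmod x) * (\<integral>\<^sup>+t\<in>{0..1}. B (unit_circle t * x) \<partial>lborel) \<partial>area)"
  proof (rule nn_integral_mono)
    fix x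
    show "r (cmod x) * ennreal a \<le> r (cmod x) * (\<integral>\<^sup>+t\<in>{0..1}. B (unit_circle t * x) \<partial>lborel)"
      using le[of x] by (cases "x \<in> ?S") (auto simp: rS intro!: mult_left_mono)
  qed
  also have "\<dots> = (\<integral>\<^sup>+x. r (cmod x) * B x \<partial>area)"
    by (rule nn_integral_area_rotation_average) measurable
  also have "\<dots> = (\<integral>\<^sup>+x\<in>?S. B x \<partial>nu)"
    by (rule nuS[symmetric]) simp
  finally show ?thesis .
qed

text \<open>The key estimate. The kernel \<open>k\<^sup>L\<^sup>+\<^sup>1\<close>, \<open>k = h / |y - z|\<close>, from the subharmonicity of \<open>|f|\<^sup>\<alpha>\<close> is divided between the two factors of
  Hoelder's inequality: \<open>k\<^sup>b\<close> makes the dual integral converge, and \<open>k\<^sup>4\<close> remains with \<open>|f|\<^sup>\<alpha>\<close> and becomes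
  the kernel of the conclusion. The strip \<open>A\<close> avoids the boundary, which is possible because
  the strip carries a fixed proportion of the collar mass.\<close>

lemma pointwise_le_mu_average:
  assumes p: "0 < p"
  obtains C \<delta> where "0 < C" "0 < \<delta>" "\<delta> < 1 / 2" "\<And>f z. f holomorphic_on ball 0 1 \<Longrightarrow> z \<in> ball 0 1 \<Longrightarrow>
    disc_pow f p z * emeasure mu (tent z (2 * gap z)) \<le>
    ennreal C * (\<integral>\<^sup>+x\<in>collar (gap z / 2) - collar (\<delta> * gap z). disc_pow f p x * ennreal ((gap z / cmod (x - z)) powr (4 * q)) \<partial>mu)"
proof -
  obtain b :: nat and Cs where Cs: "0 < Cs" "\<And>z. z \<in> ball 0 1 \<Longrightarrow>
    (\<integral>\<^sup>+y\<in>{y. gap z / 2 \<le> cmod (y - z)}. ennreal ((gap z / cmod (y - z)) powr (real b * q')) \<partial>sigma)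
    \<le> ennreal ((Cs * measure nu (tent z (2 * gap z)) / measure mu (tent z (2 * gap z)) powr (1 / q)) powr q')"
    using sigma_kernel by blast
  obtain \<delta>0 where \<delta>0: "0 < \<delta>0" "\<delta>0 < 1" "\<And>u. 0 < u \<Longrightarrow> u \<le> 1 \<Longrightarrow> N (\<delta>0 * u) \<le> 1 / 2 * N u"
    using N_decay[of "1 / 2"] by auto
  define \<delta> where "\<delta> = \<delta>0 / 2"
  have \<delta>: "0 < \<delta>" "\<delta> < 1 / 2" using \<delta>0 by (auto simp: \<delta>_def)
  obtain D1 where D1: "D1 \<ge> 1" "\<And>z s s'. z \<in> ball 0 1 \<Longrightarrow> 2 * gap z \<le> s \<Longrightarrow> s' \<le> 1 * s \<Longrightarrow>
     measure nu (tent z s') \<le> D1 * (min s 1 * N (s / 2))"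
    using nu_tent_le_collar[of 1] by blast
  obtain D2 where D2: "D2 \<ge> 1" "\<And>u v. 0 < u \<Longrightarrow> v \<le> 2 * u \<Longrightarrow> N v \<le> D2 * N u"
    using N_doubling_le[of 2] by blast
  define L where "L = b + 3"
  define \<alpha> where "\<alpha> = p / q"
  have \<alpha>: "0 < \<alpha>" "\<alpha> * q = p" using p q by (auto simp: \<alpha>_def)
  \<comment> \<open>\<open>4 D1 D2\<close> compares the tent with the strip, \<open>4\<^sup>L\<close> comes from the peaking factor.\<close>
  define C3 where "C3 = 4 * D1 * D2 * 4 ^ L * Cs"
  have C3: "C3 > 0" using D1 D2 Cs by (simp add: C3_def)
  show thesis
  proof (rule that[of "C3 powr q", OF _ \<delta>])
    show "0 < C3 powr q" using C3 by simp
    fix f :: "complex \<Rightarrow> complex" and z :: complex assume f: "f holomorphic_on ball 0 1" and z: "z \<in> ball 0 1"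
    define h where "h = gap z"
    have h: "0 < h" "h \<le> 1" using z by (auto simp: h_def)
    define A where "A = collar (h / 2) - collar (\<delta> * h)"
    have [measurable]: "A \<in> sets borel" by (simp add: A_def)
    have Asub: "A \<subseteq> ball 0 1" by (auto simp: A_def collar_def)
    define m0 where "m0 = measure mu (tent z (2 * h))"
    have m0: "m0 > 0" unfolding m0_def h_def by (rule mu_tent_pos[OF z]) simp
    define n0 where "n0 = measure nu (tent z (2 * h))"
    have n0: "n0 > 0" unfolding n0_def h_def by (rule nu_tent_pos[OF z]) simp
    define k where "k = (\<lambda>y. h / cmod (y - z))"
    have k0: "0 \<le> k y" for y using h by (simp add: k_def)
    have [measurable]: "k \<in> borel_measurable borel" unfolding k_def by measurable
    have far: "h / 2 \<le> cmod (y - z)" if "y \<in> A" for y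
    proof -
      have "1 - h / 2 \<le> cmod y" using that by (auto simp: A_def collar_def)
      then show ?thesis using norm_triangle_ineq2[of y z] unfolding h_def by argo
    qed
    define F where "F = (\<lambda>x. f x * indicator (ball 0 1) x)"
    have [measurable]: "F \<in> borel_measurable borel"
      unfolding F_def by (rule holomorphic_borel_measurable_on_open[OF f]) simp
    have FA: "F x = f x" if "x \<in> A" for x using Asub that by (auto simp: F_def)
    define G where "G = (\<lambda>x. cmod (F x) powr \<alpha> * k x ^ 4 * indicator A x)"
    define H where "H = (\<lambda>x. k x ^ b * indicator A x)"
    have [measurable]: "G \<in> borel_measurable borel" "H \<in> borel_measurable borel"
      unfolding G_def H_def by measurable
    have GH0: "0 \<le> G x" "0 \<le> H x" for x using k0 by (auto simp: G_def H_def)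
    define B where "B = (\<lambda>x. ennreal (4 ^ L / h) * ennreal (cmod (F x) powr \<alpha> * k x ^ (L + 1)))"
    have [measurable]: "B \<in> borel_measurable borel" unfolding B_def by measurable
    have lower: "ennreal (cmod (f z) powr \<alpha>) * emeasure nu A \<le> (\<integral>\<^sup>+x\<in>A. B x \<partial>nu)"
      unfolding A_def
    proof (rule nu_rotation_average_strip)
      fix x assume "x \<in> collar (h / 2) - collar (\<delta> * h)"
      then have xA: "x \<in> A" by (simp add: A_def)
      then have x: "1 - h / 2 \<le> cmod x" "cmod x < 1" by (auto simp: A_def collar_def)
      have zx: "cmod z < cmod x" using x h unfolding h_def by argo
      have "ennreal (cmod (f z) powr \<alpha>) \<le> (\<integral>\<^sup>+ t\<in>{0..1}. ennreal (cmod (f (unit_circle t * x)) powr \<alpha> *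
         (cmod x / cmod (unit_circle t * x - z)) *
         (((cmod x)\<^sup>2 - (cmod z)\<^sup>2) / (cmod x * cmod (unit_circle t * x - z))) ^ L) \<partial>lborel)"
        by (rule subharmonic_rotation_mean[OF f zx x(2) \<alpha>(1)])
      also have "\<dots> \<le> (\<integral>\<^sup>+t\<in>{0..1}. B (unit_circle t * x) \<partial>lborel)"
      proof (intro nn_integral_mono mult_right_mono)
        fix t
        define y where "y = unit_circle t * x"
        have ny: "cmod y = cmod x" by (simp add: y_def norm_mult)
        have yA: "y \<in> A" using xA by (simp add: A_def collar_def ny)
        have d: "0 < cmod (y - z)" using far[OF yA] h by linarith
        have 1: "cmod x / cmod (y - z) \<le> k y / h"
          using x d h by (simp add: k_def divide_right_mono)
        have 2: "((cmod x)\<^sup>2 - (cmod z)\<^sup>2) / (cmod x * cmod (y - z)) \<le> 4 * k y"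
        proof -
          have "(cmod x)\<^sup>2 - (cmod z)\<^sup>2 = (cmod x + cmod z) * (cmod x - cmod z)"
            by (simp add: power2_eq_square algebra_simps)
          also have "\<dots> \<le> (2 * cmod x) * h"
            using zx x(2) by (intro mult_mono) (auto simp: h_def)
          finally have "((cmod x)\<^sup>2 - (cmod z)\<^sup>2) / (cmod x * cmod (y - z)) \<le> ((2 * cmod x) * h) / (cmod x * cmod (y - z))"
            by (intro divide_right_mono) auto
          also have "\<dots> = 2 * k y"
          proof -
            have "cmod x \<noteq> 0" using zx by auto
            then show ?thesis by (simp add: k_def)
          qed
          also have "\<dots> \<le> 4 * k y" using k0[of y] by simp
          finally show ?thesis .
        qed
        have "0 \<le> (cmod x)\<^sup>2 - (cmod z)\<^sup>2" using zx by (simp add: power_mono)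
        then have "cmod (f y) powr \<alpha> * (cmod x / cmod (y - z)) * (((cmod x)\<^sup>2 - (cmod z)\<^sup>2) / (cmod x * cmod (y - z))) ^ L
          \<le> cmod (f y) powr \<alpha> * (k y / h) * (4 * k y) ^ L"
          using 1 2 k0[of y] h by (intro mult_mono power_mono) auto
        also have "\<dots> = 4 ^ L / h * (cmod (F y) powr \<alpha> * k y ^ (L + 1))"
          using FA[OF yA] by (simp add: power_mult_distrib)
        finally have "ennreal (cmod (f y) powr \<alpha> * (cmod x / cmod (y - z)) * (((cmod x)\<^sup>2 - (cmod z)\<^sup>2) / (cmod x * cmod (y - z))) ^ L)
          \<le> ennreal (4 ^ L / h * (cmod (F y) powr \<alpha> * k y ^ (L + 1)))" by (rule ennreal_leI)
        also have "\<dots> = B y" using h unfolding B_def by (intro ennreal_mult') simp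
        finally show "ennreal (cmod (f (unit_circle t * x)) powr \<alpha> *
         (cmod x / cmod (unit_circle t * x - z)) *
         (((cmod x)\<^sup>2 - (cmod z)\<^sup>2) / (cmod x * cmod (unit_circle t * x - z))) ^ L) \<le> B (unit_circle t * x)"
          unfolding y_def .
      qed simp
      finally show "ennreal (cmod (f z) powr \<alpha>) \<le> (\<integral>\<^sup>+t\<in>{0..1}. B (unit_circle t * x) \<partial>lborel)" .
    qed measurable
    have "(\<integral>\<^sup>+x\<in>A. B x \<partial>nu) = (\<integral>\<^sup>+x. ennreal (4 ^ L / h) * ennreal (G x * H x) \<partial>nu)"
      by (intro nn_integral_cong)
         (auto simp: B_def G_def H_def L_def indicator_def power_add mult_ac eval_nat_numeral)
    also have "\<dots> = ennreal (4 ^ L / h) * (\<integral>\<^sup>+x. ennreal (G x * H x) \<partial>nu)"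
      by (rule nn_integral_cmult) measurable
    finally have upper: "(\<integral>\<^sup>+x\<in>A. B x \<partial>nu) = ennreal (4 ^ L / h) * (\<integral>\<^sup>+x. ennreal (G x * H x) \<partial>nu)" .
    have nuA: "n0 \<le> 4 * D1 * D2 * h * measure nu A"
    proof -
      have "\<delta> * h \<le> h / 2" using \<delta> h by simp
      then have "measure nu A = N (h / 2) - N (\<delta> * h)"
        unfolding A_def N_def by (intro nu.finite_measure_Diff collar_mono) auto
      moreover have "N (\<delta> * h) \<le> 1 / 2 * N (h / 2)"
        using \<delta>0(3)[of "h / 2"] h by (simp add: \<delta>_def)
      ultimately have A1: "N (h / 2) \<le> 2 * measure nu A" by simp
      have s2: "2 * gap z \<le> 2 * h" by (simp add: h_def)
      have "n0 \<le> D1 * (min (2 * h) 1 * N h)"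
        unfolding n0_def using D1(2)[OF z s2, of "2 * h"] by simp
      also have "\<dots> \<le> D1 * ((2 * h) * (D2 * N (h / 2)))"
        using D1(1) h D2(2)[of "h / 2" h] by (intro mult_left_mono mult_mono) (auto simp: N_nonneg)
      also have "\<dots> \<le> D1 * ((2 * h) * (D2 * (2 * measure nu A)))"
        using D1(1) D2(1) h A1 by (intro mult_left_mono) auto
      finally show ?thesis by (simp add: mult_ac)
    qed
    have Hint: "(\<integral>\<^sup>+x. ennreal (H x powr q') \<partial>sigma) \<le> ennreal ((Cs * n0 / m0 powr (1 / q)) powr q')"
    proof -
      have "(\<integral>\<^sup>+x. ennreal (H x powr q') \<partial>sigma) \<le>
        (\<integral>\<^sup>+y\<in>{y. gap z / 2 \<le> cmod (y - z)}. ennreal ((gap z / cmod (y - z)) powr (real b * q')) \<partial>sigma)"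
      proof (rule nn_integral_mono)
        fix x
        show "ennreal (H x powr q') \<le> ennreal ((gap z / cmod (x - z)) powr (real b * q')) * indicator {y. gap z / 2 \<le> cmod (y - z)} x"
        proof (cases "x \<in> A")
          case True
          have "0 < cmod (x - z)" using far[OF True] h by linarith
          then have kx: "0 < k x" using h unfolding k_def by (intro divide_pos_pos)
          have "H x powr q' = k x powr (real b * q')"
            using True kx by (simp add: H_def powr_realpow[symmetric] powr_powr)
          then show ?thesis using far[OF True] by (simp add: k_def h_def)
        qed (simp add: H_def)
      qed
      also note Cs(2)[OF z]
      finally show ?thesis by (simp add: n0_def m0_def h_def)
    qed
    define I where "I = (\<integral>\<^sup>+x. ennreal (G x powr q) \<partial>mu)"
    have I_eq: "I = (\<integral>\<^sup>+x\<in>A. disc_pow f p x * ennreal (k x powr (4 * q)) \<partial>mu)"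
      unfolding I_def
    proof (rule nn_integral_cong)
      fix x
      show "ennreal (G x powr q) = disc_pow f p x * ennreal (k x powr (4 * q)) * indicator A x"
      proof (cases "x \<in> A")
        case True
        have "0 < cmod (x - z)" using far[OF True] h by linarith
          then have kx: "0 < k x" using h unfolding k_def by (intro divide_pos_pos)
        have "(k x ^ 4) powr q = k x powr (4 * q)"
          using kx powr_realpow[of "k x" 4] by (metis of_nat_numeral powr_powr)
        then have "G x powr q = cmod (f x) powr p * k x powr (4 * q)"
          using True FA[OF True] k0[of x] \<alpha>(2) by (simp add: G_def powr_mult powr_powr)
        then show ?thesis using True Asub by (auto simp: disc_pow_def ennreal_mult')
      qed (use q in \<open>simp add: G_def\<close>)
    qed
    have "disc_pow f p z * ennreal m0 \<le> ennreal (C3 powr q) * I"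
    proof (cases "I = top")
      case True
      then show ?thesis using C3 by (simp add: ennreal_mult_top)
    next
      case False
      define a where "a = enn2real I"
      have a: "I = ennreal a" "0 \<le> a" using False by (simp_all add: a_def less_top)
      have "(\<integral>\<^sup>+x. ennreal (G x * H x) \<partial>nu) \<le>
        ennreal (a powr (1 / q) * ((Cs * n0 / m0 powr (1 / q)) powr q') powr (1 / q'))"
        by (rule Hoelder) (use GH0 a I_def Hint in auto)
      also have "((Cs * n0 / m0 powr (1 / q)) powr q') powr (1 / q') = Cs * n0 / m0 powr (1 / q)"
        using q' Cs(1) n0 m0 by (simp add: powr_powr)
      finally have hoe: "(\<integral>\<^sup>+x. ennreal (G x * H x) \<partial>nu) \<le> ennreal (a powr (1 / q) * (Cs * n0 / m0 powr (1 / q)))" .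
      have "ennreal (cmod (f z) powr \<alpha>) * emeasure nu A \<le> ennreal (4 ^ L / h) * ennreal (a powr (1 / q) * (Cs * n0 / m0 powr (1 / q)))"
        using lower unfolding upper by (rule order_trans) (intro mult_left_mono hoe, simp)
      then have "cmod (f z) powr \<alpha> * measure nu A \<le> 4 ^ L / h * (a powr (1 / q) * (Cs * n0 / m0 powr (1 / q)))"
        using h Cs(1) n0 by (simp add: nu.emeasure_eq_measure ennreal_mult'[symmetric])
      then have "(4 * D1 * D2 * h) * (cmod (f z) powr \<alpha> * measure nu A) \<le>
          (4 * D1 * D2 * h) * (4 ^ L / h * (a powr (1 / q) * (Cs * n0 / m0 powr (1 / q))))"
        using D1(1) D2(1) h by (intro mult_left_mono) auto
      also have "\<dots> = C3 * a powr (1 / q) / m0 powr (1 / q) * n0"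
        using h by (simp add: C3_def)
      finally have "cmod (f z) powr \<alpha> * (4 * D1 * D2 * h * measure nu A) \<le> C3 * a powr (1 / q) / m0 powr (1 / q) * n0"
        by (simp add: mult_ac)
      moreover have "cmod (f z) powr \<alpha> * n0 \<le> cmod (f z) powr \<alpha> * (4 * D1 * D2 * h * measure nu A)"
        using nuA by (intro mult_left_mono) auto
      ultimately have "cmod (f z) powr \<alpha> * n0 \<le> C3 * a powr (1 / q) / m0 powr (1 / q) * n0" by linarith
      then have "cmod (f z) powr \<alpha> \<le> C3 * a powr (1 / q) / m0 powr (1 / q)"
        by (rule mult_right_le_imp_le[OF _ n0])
      then have "cmod (f z) powr \<alpha> * m0 powr (1 / q) \<le> C3 * a powr (1 / q)"
        using m0 by (simp add: field_simps)
      then have "(cmod (f z) powr \<alpha> * m0 powr (1 / q)) powr q \<le> (C3 * a powr (1 / q)) powr q"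
        using q by (intro powr_mono2) auto
      then have "cmod (f z) powr p * m0 \<le> C3 powr q * a"
        using q \<alpha>(2) m0 a by (simp add: powr_mult powr_powr)
      then show ?thesis
        using z a m0 by (simp add: disc_pow_def ennreal_mult'[symmetric] ennreal_leI)
    qed
    then show "disc_pow f p z * emeasure mu (tent z (2 * gap z)) \<le>
      ennreal (C3 powr q) * (\<integral>\<^sup>+x\<in>collar (gap z / 2) - collar (\<delta> * gap z). disc_pow f p x * ennreal ((gap z / cmod (x - z)) powr (4 * q)) \<partial>mu)"
      unfolding I_eq by (simp add: m0_def h_def A_def k_def mu.emeasure_eq_measure)
  qed
qed

text \<open>Interchange the integrals in the key estimate. If \<open>x\<close> lies in the strip belonging to \<open>z\<close>, the gaps of \<open>x\<close> and
  \<open>z\<close> are comparable, so the inner integral is that of a kernel decaying faster than \<open>|z - x|\<^sup>-\<^sup>2\<close>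
  outside the disc of radius \<open>gap x\<close>.\<close>

lemma V_norm_le_mu_norm:
  assumes p: "0 < p"
  shows "\<exists>C>0. \<forall>f. f holomorphic_on ball 0 1 \<longrightarrow>
    V_norm p f \<le> ennreal C * (\<integral>\<^sup>+x. disc_pow f p x \<partial>mu)"
proof -
  obtain C \<delta> where C: "0 < C" and \<delta>: "0 < \<delta>" "\<delta> < 1 / 2" and le: "\<And>f z. f holomorphic_on ball 0 1 \<Longrightarrow> z \<in> ball 0 1 \<Longrightarrow>
    disc_pow f p z * emeasure mu (tent z (2 * gap z)) \<le>
    ennreal C * (\<integral>\<^sup>+x\<in>collar (gap z / 2) - collar (\<delta> * gap z). disc_pow f p x * ennreal ((gap z / cmod (x - z)) powr (4 * q)) \<partial>mu)"
    using pointwise_le_mu_average[OF p] by blast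
  define t where "t = 4 / (1 - 2 powr (2 - 4 * q))"
  have t: "t > 0" using q by (simp add: t_def powr_less_one)
  define C1 where "C1 = C * (1 / \<delta>) powr (4 * q) * t"
  interpret pair_sigma_finite area mu ..
  show ?thesis
  proof (intro exI[of _ C1] conjI allI impI)
    show "0 < C1" using C \<delta> t by (simp add: C1_def)
    fix f :: "complex \<Rightarrow> complex" assume f: "f holomorphic_on ball 0 1"
    note [measurable] = disc_pow_borel[OF f]
    define S where "S = {w :: complex \<times> complex. cmod (fst w) < 1 \<and> cmod (snd w) < 1 \<and> 1 - gap (fst w) / 2 \<le> cmod (snd w) \<and> cmod (snd w) < 1 - \<delta> * gap (fst w)}"
    have "S \<in> sets (borel \<Otimes>\<^sub>M borel)"
    proof -
      have "S = {w. cmod (fst w) < 1} \<inter> {w. cmod (snd w) < 1} \<inter> {w. 1 - gap (fst w) / 2 \<le> cmod (snd w)} \<inter> {w. cmod (snd w) < 1 - \<delta> * gap (fst w)}"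
        by (auto simp: S_def)
      also have "\<dots> \<in> sets borel"
        by (intro sets.Int borel_open open_Collect_less borel_closed closed_Collect_le continuous_intros) auto
      finally show ?thesis unfolding borel_prod .
    qed
    note [measurable] = this
    define K where "K = (\<lambda>(z::complex) x. disc_pow f p x * (ennreal (C / (gap z)\<^sup>2) * ennreal ((gap z / cmod (x - z)) powr (4 * q)) * indicator S (z, x)))"
    have [measurable]: "case_prod K \<in> borel_measurable (area \<Otimes>\<^sub>M mu)"
      unfolding K_def by measurable
    have "V_norm p f \<le> (\<integral>\<^sup>+z. (\<integral>\<^sup>+x. K z x \<partial>mu) \<partial>area)"
    proof (rule nn_integral_mono)
      fix z
      show "disc_pow f p z * ennreal (V z) \<le> (\<integral>\<^sup>+x. K z x \<partial>mu)"
      proof (cases "z \<in> ball 0 1")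
        case True
        have "ennreal (V z) = ennreal (1 / (gap z)\<^sup>2) * emeasure mu (tent z (2 * gap z))"
          by (simp add: V_def mu.emeasure_eq_measure ennreal_mult'[symmetric])
        then have "disc_pow f p z * ennreal (V z) = ennreal (1 / (gap z)\<^sup>2) * (disc_pow f p z * emeasure mu (tent z (2 * gap z)))"
          by (simp add: mult_ac)
        also have "\<dots> \<le> ennreal (1 / (gap z)\<^sup>2) * (ennreal C * (\<integral>\<^sup>+x\<in>collar (gap z / 2) - collar (\<delta> * gap z).
            disc_pow f p x * ennreal ((gap z / cmod (x - z)) powr (4 * q)) \<partial>mu))"
          by (intro mult_left_mono le f True) simp
        also have "\<dots> = ennreal (C / (gap z)\<^sup>2) * (\<integral>\<^sup>+x\<in>collar (gap z / 2) - collar (\<delta> * gap z).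
            disc_pow f p x * ennreal ((gap z / cmod (x - z)) powr (4 * q)) \<partial>mu)"
          using C by (simp add: mult.assoc[symmetric] ennreal_mult'[symmetric])
        also have "\<dots> = (\<integral>\<^sup>+x. ennreal (C / (gap z)\<^sup>2) * (disc_pow f p x * ennreal ((gap z / cmod (x - z)) powr (4 * q)) *
            indicator (collar (gap z / 2) - collar (\<delta> * gap z)) x) \<partial>mu)"
          by (rule nn_integral_cmult[symmetric]) measurable
        also have "\<dots> = (\<integral>\<^sup>+x. K z x \<partial>mu)"
          using True by (intro nn_integral_cong) (auto simp: K_def S_def collar_def indicator_def mult_ac)
        finally show ?thesis .
      qed (simp add: disc_pow_def)
    qed
    also have "\<dots> = (\<integral>\<^sup>+x. (\<integral>\<^sup>+z. K z x \<partial>area) \<partial>mu)"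
      by (rule Fubini'[symmetric]) simp
    also have "\<dots> \<le> (\<integral>\<^sup>+x. ennreal C1 * disc_pow f p x \<partial>mu)"
    proof (rule nn_integral_mono)
      fix x
      show "(\<integral>\<^sup>+z. K z x \<partial>area) \<le> ennreal C1 * disc_pow f p x"
      proof (cases "x \<in> ball 0 1")
        case True
        define g where "g = gap x"
        have g: "g > 0" using True by (simp add: g_def)
        define c where "c = C / g\<^sup>2 * (1 / \<delta>) powr (4 * q)"
        have c: "c \<ge> 0" using C by (simp add: c_def)
        have K: "K z x \<le> (disc_pow f p x * ennreal c) * (ennreal ((g / cmod (z - x)) powr (4 * q)) * indicator {z. g \<le> cmod (z - x)} z)" for z
        proof (cases "(z, x) \<in> S")
          case True
          then have "cmod z < 1" "1 - gap z / 2 \<le> cmod x" "cmod x < 1 - \<delta> * gap z" by (auto simp: S_def)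
          then have zx: "cmod z < 1" "gap x \<le> gap z / 2" "\<delta> * gap z < gap x" by argo+
          have gz: "g \<le> gap z" "gap z \<le> 1 / \<delta> * g" using zx g \<delta> by (auto simp: g_def field_simps)
          have far: "g \<le> cmod (z - x)"
            using gap_triangle(2)[of z x] zx(2) unfolding g_def norm_minus_commute[of z x] by argo
          have "C / (gap z)\<^sup>2 \<le> C / g\<^sup>2"
            using gz(1) g C by (intro divide_left_mono power_mono) auto
          moreover have "gap z / cmod (z - x) \<le> (1 / \<delta> * g) / cmod (z - x)"
            using gz(2) by (rule divide_right_mono) simp
          then have "(gap z / cmod (x - z)) powr (4 * q) \<le> ((1 / \<delta>) * (g / cmod (z - x))) powr (4 * q)"
            using q zx(1) unfolding norm_minus_commute[of x z]
            by (intro powr_mono2) auto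
          ultimately have "C / (gap z)\<^sup>2 * (gap z / cmod (x - z)) powr (4 * q) \<le> C / g\<^sup>2 * ((1 / \<delta>) * (g / cmod (z - x))) powr (4 * q)"
            using C by (intro mult_mono) auto
          also have "\<dots> = c * (g / cmod (z - x)) powr (4 * q)"
            unfolding powr_mult c_def by simp
          finally have "ennreal (C / (gap z)\<^sup>2) * ennreal ((gap z / cmod (x - z)) powr (4 * q)) \<le> ennreal c * ennreal ((g / cmod (z - x)) powr (4 * q))"
            using C c by (simp add: ennreal_mult'[symmetric] ennreal_leI)
          then have "disc_pow f p x * (ennreal (C / (gap z)\<^sup>2) * ennreal ((gap z / cmod (x - z)) powr (4 * q))) \<le>
            disc_pow f p x * (ennreal c * ennreal ((g / cmod (z - x)) powr (4 * q)))"
            by (rule mult_left_mono) simp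
          then show ?thesis using True far by (simp add: K_def mult.assoc)
        qed (simp add: K_def)
        have "(\<integral>\<^sup>+z. K z x \<partial>area) \<le> (\<integral>\<^sup>+z. (disc_pow f p x * ennreal c) * (ennreal ((g / cmod (z - x)) powr (4 * q)) * indicator {z. g \<le> cmod (z - x)} z) \<partial>area)"
          by (intro nn_integral_mono K)
        also have "\<dots> = (disc_pow f p x * ennreal c) * (\<integral>\<^sup>+z. ennreal ((g / cmod (z - x)) powr (4 * q)) * indicator {z. g \<le> cmod (z - x)} z \<partial>area)"
          by (rule nn_integral_cmult) measurable
        also have "\<dots> \<le> (disc_pow f p x * ennreal c) * ennreal (t * g\<^sup>2)"
          unfolding t_def using g q by (intro mult_left_mono nn_integral_area_kernel_tail) auto
        also have "\<dots> = ennreal (c * (t * g\<^sup>2)) * disc_pow f p x"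
          unfolding ennreal_mult'[OF c] by (simp only: mult_ac)
        also have "c * (t * g\<^sup>2) = C1" using g by (simp add: c_def C1_def)
        finally show ?thesis .
      qed (simp add: K_def disc_pow_def)
    qed
    also have "\<dots> = ennreal C1 * (\<integral>\<^sup>+x. disc_pow f p x \<partial>mu)"
      by (rule nn_integral_cmult) simp
    finally show "V_norm p f \<le> ennreal C1 * (\<integral>\<^sup>+x. disc_pow f p x \<partial>mu)" .
  qed
qed

end

section \<open>Bounding a function by its derivative\<close>

text \<open>The bound on \<open>f'\<close> is the derivative of \<open>M (gap z)\<^sup>e (1 - t |z|)\<^sup>-\<^sup>e / e\<close> along the radius. Taking a
  supremum with the loss \<open>e\<close> in place of an integral makes the later argument the same for all \<open>p > 0\<close>.\<close>

lemma radial_increment_bound: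
  assumes f: "f holomorphic_on ball 0 1" and z: "z \<in> ball 0 1" and e: "0 < e"
    and le: "\<And>t. 0 \<le> t \<Longrightarrow> t \<le> 1 \<Longrightarrow>
      cmod (deriv f (of_real t * z)) * (1 - t * cmod z) \<le> M * (gap z / (1 - t * cmod z)) powr e"
  shows "cmod (f z - f 0) \<le> M / e"
proof -
  define \<phi> where "\<phi> = (\<lambda>t. M * gap z powr e / e * (1 - t * cmod z) powr (- e))"
  have z1: "cmod z < 1" using z by simp
  have pos: "0 < 1 - t * cmod z" if "0 \<le> t" "t \<le> 1" for t
  proof -
    have "t * cmod z \<le> 1 * cmod z" using that by (intro mult_right_mono) auto
    then show ?thesis using z1 by linarith
  qed
  have mem: "of_real t * z \<in> ball 0 1" if "0 \<le> t" "t \<le> 1" for t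
    using pos[OF that] that by (simp add: norm_mult)
  have M: "M \<ge> 0"
  proof -
    have "0 \<le> cmod (deriv f (of_real 0 * z)) * (1 - 0 * cmod z)" by simp
    also have "\<dots> \<le> M * (gap z / (1 - 0 * cmod z)) powr e" by (rule le) auto
    finally show ?thesis using z1 by (simp add: zero_le_mult_iff)
  qed
  have "cmod (f (of_real 1 * z) - f (of_real 0 * z)) \<le> \<phi> 1 - \<phi> 0"
  proof (rule differentiable_bound_general)
    show "(0::real) < 1" by simp
    show "continuous_on {0..1} (\<lambda>t. f (of_real t * z))"
      by (intro continuous_on_compose2[OF holomorphic_on_imp_continuous_on[OF f]] continuous_intros) (use mem in auto)
    show "continuous_on {0..1} \<phi>"
      unfolding \<phi>_def using pos by (intro continuous_intros) (auto simp: less_imp_neq[symmetric])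
    fix t :: real assume t: "0 < t" "t < 1"
    have p: "0 < 1 - t * cmod z" using pos[of t] t by simp
    show "((\<lambda>t. f (of_real t * z)) has_vector_derivative (z * deriv f (of_real t * z))) (at t)"
    proof -
      have "(f has_field_derivative deriv f (of_real t * z)) (at (of_real t * z))"
        using f mem[of t] t by (intro holomorphic_derivI[of f "ball 0 1"]) auto
      moreover have "((\<lambda>t. of_real t * z) has_vector_derivative z) (at t)"
        by (auto intro!: derivative_eq_intros)
      ultimately show ?thesis
        using field_vector_diff_chain_at[of "\<lambda>t. of_real t * z" z t f "deriv f (of_real t * z)"] by (simp add: o_def)
    qed
    show "(\<phi> has_vector_derivative M * gap z powr e * cmod z * (1 - t * cmod z) powr (- e - 1)) (at t)"
      unfolding \<phi>_def has_real_derivative_iff_has_vector_derivative[symmetric]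
      using p e by (auto intro!: derivative_eq_intros simp: field_simps)
    show "cmod (z * deriv f (of_real t * z)) \<le> M * gap z powr e * cmod z * (1 - t * cmod z) powr (- e - 1)"
    proof -
      have "cmod (deriv f (of_real t * z)) * (1 - t * cmod z) \<le> M * (gap z / (1 - t * cmod z)) powr e"
        using t by (intro le) auto
      then have "cmod (deriv f (of_real t * z)) \<le> M * (gap z / (1 - t * cmod z)) powr e / (1 - t * cmod z)"
        using p by (simp add: pos_le_divide_eq)
      also have "\<dots> = M * gap z powr e * (1 - t * cmod z) powr (- e - 1)"
      proof -
        have "(gap z / (1 - t * cmod z)) powr e = gap z powr e / (1 - t * cmod z) powr e"
          by (rule powr_divide)
        then show ?thesis using p by (simp add: powr_diff powr_minus divide_inverse)
      qed
      finally have "cmod z * cmod (deriv f (of_real t * z)) \<le> cmod z * (M * gap z powr e * (1 - t * cmod z) powr (- e - 1))"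
        by (rule mult_left_mono) simp
      then show ?thesis by (simp add: norm_mult mult_ac)
    qed
  qed
  also have "\<phi> 1 - \<phi> 0 \<le> \<phi> 1" using M e by (simp add: \<phi>_def)
  also have "\<phi> 1 = M / e" using z1 by (simp add: \<phi>_def powr_minus)
  finally show ?thesis by simp
qed

text \<open>The pairs \<open>(z, x)\<close> for which \<open>x\<close> is in a nontangential region about the radius from \<open>0\<close> to \<open>z\<close>.\<close>

definition nontangential :: "(complex \<times> complex) set" where
  "nontangential = {w. cmod (fst w - snd w) \<le> 3 * gap (snd w)}"

lemma nontangential_borel [measurable]: "nontangential \<in> sets (borel \<Otimes>\<^sub>M borel)"
proof -
  have "closed nontangential"
    unfolding nontangential_def by (intro closed_Collect_le continuous_intros)
  then show ?thesis unfolding borel_prod by (rule borel_closed)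
qed

text \<open>At each point \<open>w\<close> of the radius, \<open>|f'(w)|\<^sup>p\<close> is bounded by its mean over a hyperbolic disc, which lies
  in the nontangential region, with weights comparable to those of \<open>w\<close>. The resulting bound on \<open>f'\<close> along the radius has the form
  required by the preceding lemma.\<close>

lemma increment_le_nontangential_average:
  assumes p: "0 < p" and \<eta>: "0 < \<eta>"
  obtains C where "0 < C" "\<And>f z. f holomorphic_on ball 0 1 \<Longrightarrow> z \<in> ball 0 1 \<Longrightarrow>
    ennreal (cmod (f z - f 0) powr p) \<le> ennreal C *
      (\<integral>\<^sup>+x. disc_pow (deriv f) p x * (ennreal ((gap x / gap z) powr \<eta> * gap x powr p / (gap x)\<^sup>2) * indicator nontangential (z, x)) \<partial>area)"
proof -
  define c where "c = (1/2) powr (\<eta> + p) / 9"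
  have c: "c > 0" by (simp add: c_def)
  show thesis
  proof (rule that[of "(p / \<eta>) powr p / c"])
    show "0 < (p / \<eta>) powr p / c" using c p \<eta> by simp
    fix f :: "complex \<Rightarrow> complex" and z :: complex assume f: "f holomorphic_on ball 0 1" and z: "z \<in> ball 0 1"
    have f': "deriv f holomorphic_on ball 0 1" using f by (intro holomorphic_deriv) auto
    note [measurable] = disc_pow_borel[OF f']
    define W where "W = (\<lambda>x. (gap x / gap z) powr \<eta> * gap x powr p / (gap x)\<^sup>2)"
    define J where "J = (\<integral>\<^sup>+x. disc_pow (deriv f) p x * (ennreal (W x) * indicator nontangential (z, x)) \<partial>area)"
    have gz: "gap z > 0" using z by simp
    have "ennreal (cmod (f z - f 0) powr p) \<le> ennreal ((p / \<eta>) powr p / c) * J"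
    proof (cases "J = top")
      case True
      then show ?thesis using p \<eta> c by (simp add: ennreal_mult_top)
    next
      case False
      define j where "j = enn2real J"
      have j: "J = ennreal j" "0 \<le> j" using False by (simp_all add: j_def less_top)
      define M where "M = (j / c) powr (1 / p)"
      have "cmod (f z - f 0) \<le> M / (\<eta> / p)"
      proof (rule radial_increment_bound[OF f z])
        show "0 < \<eta> / p" using p \<eta> by simp
        fix t :: real assume t: "0 \<le> t" "t \<le> 1"
        define w where "w = of_real t * z"
        have nw: "cmod w = t * cmod z" using t by (simp add: w_def norm_mult)
        have tz: "t * cmod z \<le> cmod z" using t mult_right_mono[of t 1 "cmod z"] by simp
        have gw: "gap z \<le> gap w" using tz by (simp add: nw)
        have gw0: "gap w > 0" using gw gz by linarith
        have wD: "w \<in> ball 0 1" using gw0 by simp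
        have zw: "cmod (z - w) \<le> gap w"
        proof -
          have "z - w = of_real (1 - t) * z" by (simp add: w_def algebra_simps)
          then have "cmod (z - w) = (1 - t) * cmod z" using t by (simp add: norm_mult del: of_real_diff)
          also have "\<dots> = cmod z - cmod w" by (simp add: nw algebra_simps)
          finally show ?thesis using z by simp
        qed
        define c1 where "c1 = (gap w / 2 / gap z) powr \<eta> * (gap w / 2) powr p / (3 / 2 * gap w)\<^sup>2"
        have c1: "c1 > 0" using gw0 gz by (simp add: c1_def)
        have near: "c1 \<le> W x \<and> (z, x) \<in> nontangential \<and> x \<in> ball 0 1" if "x \<in> ball w (gap w / 2)" for x
        proof -
          have xw: "cmod (x - w) < gap w / 2" using that by (simp add: dist_norm norm_minus_commute)
          have g1: "gap w / 2 \<le> gap x" using gap_triangle(2)[of w x] xw by argo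
          have g2: "gap x \<le> 3 / 2 * gap w" using gap_triangle(1)[of x w] xw by argo
          have gx: "gap x > 0" using g1 gw0 by argo
          have "cmod (z - x) \<le> cmod (z - w) + cmod (x - w)"
            using norm_triangle_ineq4[of "z - w" "x - w"] by simp
          then have "cmod (z - x) \<le> 3 * gap x" using zw xw g1 by argo
          moreover have "c1 \<le> W x"
            unfolding c1_def W_def using g1 g2 gx gw0 gz \<eta> p
            by (intro frac_le mult_mono powr_mono2 power_mono divide_right_mono) auto
          ultimately show ?thesis using gx by (simp add: nontangential_def)
        qed
        have "ennreal (cmod (deriv f w) powr p * (gap w / 2)\<^sup>2) \<le>
          (\<integral>\<^sup>+x\<in>ball w (gap w / 2). ennreal (cmod (deriv f x) powr p) \<partial>area)"
          using gw0 by (intro area_submean p holomorphic_on_subset[OF f'] ball_gap_subset wD) auto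
        then have "ennreal c1 * ennreal (cmod (deriv f w) powr p * (gap w / 2)\<^sup>2) \<le>
          ennreal c1 * (\<integral>\<^sup>+x\<in>ball w (gap w / 2). disc_pow (deriv f) p x \<partial>area)"
        proof (rule order_trans[OF mult_left_mono])
          have "(\<integral>\<^sup>+x\<in>ball w (gap w / 2). ennreal (cmod (deriv f x) powr p) \<partial>area) =
            (\<integral>\<^sup>+x\<in>ball w (gap w / 2). disc_pow (deriv f) p x \<partial>area)"
            using ball_gap_subset[OF wD] by (intro nn_integral_cong) (auto simp: disc_pow_def indicator_def)
          then show "ennreal c1 * (\<integral>\<^sup>+x\<in>ball w (gap w / 2). ennreal (cmod (deriv f x) powr p) \<partial>area) \<le>
            ennreal c1 * (\<integral>\<^sup>+x\<in>ball w (gap w / 2). disc_pow (deriv f) p x \<partial>area)" by simp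
        qed simp
        also have "\<dots> = (\<integral>\<^sup>+x. ennreal c1 * (disc_pow (deriv f) p x * indicator (ball w (gap w / 2)) x) \<partial>area)"
          by (rule nn_integral_cmult[symmetric]) simp
        also have "\<dots> \<le> J"
          unfolding J_def
        proof (rule nn_integral_mono)
          fix x
          show "ennreal c1 * (disc_pow (deriv f) p x * indicator (ball w (gap w / 2)) x) \<le>
            disc_pow (deriv f) p x * (ennreal (W x) * indicator nontangential (z, x))"
          proof (cases "x \<in> ball w (gap w / 2)")
            case True
            then have "disc_pow (deriv f) p x * ennreal c1 \<le> disc_pow (deriv f) p x * ennreal (W x)"
              using near[OF True] by (intro mult_left_mono ennreal_leI) auto
            then show ?thesis using near[OF True] True by (simp add: mult.commute)
          qed simp
        qed
        finally have "c1 * (cmod (deriv f w) powr p * (gap w / 2)\<^sup>2) \<le> j"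
          using c1 j by (simp add: ennreal_mult'[symmetric])
        moreover have "c1 * (cmod (deriv f w) powr p * (gap w / 2)\<^sup>2) =
          c * (gap w / gap z) powr \<eta> * (cmod (deriv f w) * gap w) powr p"
        proof -
          have "(gap w / 2 / gap z) powr \<eta> = (gap w / gap z) powr \<eta> * (1/2) powr \<eta>"
            by (simp only: powr_divide powr_one_eq_one) simp
          moreover have "(gap w / 2) powr p = gap w powr p * (1/2) powr p"
            by (simp only: powr_divide powr_one_eq_one) simp
          moreover have "(gap w / 2)\<^sup>2 / (3 / 2 * gap w)\<^sup>2 = 1 / 9"
          proof -
            have "(3 / 2 * gap w)\<^sup>2 = 9 * (gap w / 2)\<^sup>2"
              by (simp only: power_mult_distrib power_divide) simp
            then show ?thesis using gw0 by simp
          qed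
          moreover have "c1 * (cmod (deriv f w) powr p * (gap w / 2)\<^sup>2) =
            (gap w / 2 / gap z) powr \<eta> * (gap w / 2) powr p * cmod (deriv f w) powr p * ((gap w / 2)\<^sup>2 / (3 / 2 * gap w)\<^sup>2)"
            by (simp add: c1_def)
          ultimately have "c1 * (cmod (deriv f w) powr p * (gap w / 2)\<^sup>2) =
            ((gap w / gap z) powr \<eta> * (1/2) powr \<eta>) * (gap w powr p * (1/2) powr p) * cmod (deriv f w) powr p * (1 / 9)"
            by (simp only:)
          then show ?thesis by (simp add: c_def powr_add powr_mult mult_ac)
        qed
        ultimately have "c * (gap w / gap z) powr \<eta> * (cmod (deriv f w) * gap w) powr p \<le> j" by simp
        moreover have "(gap w / gap z) powr \<eta> * (gap z / gap w) powr \<eta> = 1"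
          using gw0 gz by (simp add: powr_mult[symmetric])
        moreover have "0 < (gap z / gap w) powr \<eta>" using gw0 gz by simp
        ultimately have "(cmod (deriv f w) * gap w) powr p \<le> j / c * (gap z / gap w) powr \<eta>"
          using c mult_right_mono[of "c * (gap w / gap z) powr \<eta> * (cmod (deriv f w) * gap w) powr p" j "(gap z / gap w) powr \<eta>"]
          by (simp add: pos_le_divide_eq mult_ac)
        then have "((cmod (deriv f w) * gap w) powr p) powr (1 / p) \<le> (j / c * (gap z / gap w) powr \<eta>) powr (1 / p)"
          using p by (intro powr_mono2) auto
        moreover have "cmod (deriv f w) * gap w \<le> M * (gap z / gap w) powr (\<eta> / p)"
          if "((cmod (deriv f w) * gap w) powr p) powr (1 / p) \<le> (j / c * (gap z / gap w) powr \<eta>) powr (1 / p)"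
        proof -
          have "(j / c * (gap z / gap w) powr \<eta>) powr (1 / p) = M * (gap z / gap w) powr (\<eta> / p)"
            by (subst powr_mult) (simp add: powr_powr M_def)
          moreover have "((cmod (deriv f w) * gap w) powr p) powr (1 / p) = cmod (deriv f w) * gap w"
            using p gw0 by (simp add: powr_powr)
          ultimately show ?thesis using that by (simp only:)
        qed
        ultimately show "cmod (deriv f (of_real t * z)) * (1 - t * cmod z) \<le> M * (gap z / (1 - t * cmod z)) powr (\<eta> / p)"
          by (simp add: w_def[symmetric] nw)
      qed
      then have "cmod (f z - f 0) powr p \<le> (M / (\<eta> / p)) powr p"
        using p by (intro powr_mono2) auto
      also have "\<dots> = (p / \<eta>) powr p / c * j"
        using p \<eta> j c by (simp add: M_def powr_mult powr_divide powr_powr mult_ac)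
      finally have "ennreal (cmod (f z - f 0) powr p) \<le> ennreal ((p / \<eta>) powr p / c * j)" by (rule ennreal_leI)
      also have "\<dots> = ennreal ((p / \<eta>) powr p / c) * J"
        unfolding j(1) using c by (intro ennreal_mult') simp
      finally show ?thesis .
    qed
    then show "ennreal (cmod (f z - f 0) powr p) \<le> ennreal ((p / \<eta>) powr p / c) *
      (\<integral>\<^sup>+x. disc_pow (deriv f) p x * (ennreal ((gap x / gap z) powr \<eta> * gap x powr p / (gap x)\<^sup>2) * indicator nontangential (z, x)) \<partial>area)"
      unfolding J_def W_def .
  qed
qed

text \<open>For the points \<open>z\<close> whose tent contains \<open>y\<close>, \<open>gap z\<close> is at least about \<open>max (gap y) |z - y|\<close>.\<close>

lemma cone_integral:
  assumes \<eta>: "0 < \<eta>"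
  obtains C where "0 < C" "\<And>y. y \<in> ball 0 1 \<Longrightarrow>
    (\<integral>\<^sup>+z\<in>{z \<in> ball 0 1. cmod (y - z) < 2 * gap z}. ennreal (gap z powr (- 2 - \<eta>)) \<partial>area) \<le> ennreal (C * gap y powr (- \<eta>))"
proof -
  define e where "e = 2 + \<eta>"
  have e: "e > 2" using \<eta> by (simp add: e_def)
  define t where "t = 4 / (1 - 2 powr (2 - e))"
  have t: "t > 0" using e by (simp add: t_def powr_less_one)
  define C where "C = 3 powr e + 2 powr e * t"
  show thesis
  proof (rule that[of C])
    show "0 < C" using t by (simp add: C_def add_pos_pos)
    fix y :: complex assume y: "y \<in> ball 0 1"
    define g where "g = gap y"
    have g: "g > 0" using y by (simp add: g_def)
    have gg: "g powr (- e) * g\<^sup>2 = g powr (- \<eta>)"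
      using g by (simp add: e_def powr_diff powr_minus powr_realpow[symmetric] powr_add field_simps flip: powr_numeral)
    have pw: "ennreal (gap z powr (- 2 - \<eta>)) * indicator {z \<in> ball 0 1. cmod (y - z) < 2 * gap z} z \<le>
       ennreal (3 powr e * g powr (- e)) * indicator (ball y g) z +
       ennreal (2 powr e * g powr (- e)) * (ennreal ((g / cmod (z - y)) powr e) * indicator {z. g \<le> cmod (z - y)} z)" for z
    proof (cases "z \<in> ball 0 1 \<and> cmod (y - z) < 2 * gap z")
      case True
      then have gz: "gap z > 0" and yz: "cmod (y - z) < 2 * gap z" by auto
      have ee: "- 2 - \<eta> = - e" by (simp add: e_def)
      show ?thesis
      proof (cases "cmod (z - y) < g")
        case near: True
        have "g / 3 \<le> gap z" using gap_triangle(1)[of y z] yz unfolding g_def by argo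
        then have "gap z powr (- e) \<le> (g / 3) powr (- e)" using g e by (intro powr_mono2') auto
        also have "\<dots> = 3 powr e * g powr (- e)" using g by (simp add: powr_divide powr_minus field_simps)
        finally have "ennreal (gap z powr (- e)) \<le> ennreal (3 powr e * g powr (- e))" by (rule ennreal_leI)
        then show ?thesis using near True unfolding ee
          by (simp add: dist_norm norm_minus_commute add_increasing2)
      next
        case far: False
        define r where "r = cmod (z - y)"
        have r: "r > 0" using far g unfolding r_def by linarith
        have "r / 2 \<le> gap z" using yz by (simp add: r_def norm_minus_commute)
        then have "gap z powr (- e) \<le> (r / 2) powr (- e)" using r e by (intro powr_mono2') auto
        also have "\<dots> = 2 powr e * g powr (- e) * (g / r) powr e"
          using r g by (simp add: powr_divide powr_minus field_simps)
        finally have "ennreal (gap z powr (- e)) \<le> ennreal (2 powr e * g powr (- e) * (g / r) powr e)" by (rule ennreal_leI)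
        also have "\<dots> = ennreal (2 powr e * g powr (- e)) * ennreal ((g / r) powr e)" by (rule ennreal_mult') simp
        finally show ?thesis using far True unfolding ee r_def
          by (simp add: add_increasing)
      qed
    qed (auto simp: indicator_def)
    have "(\<integral>\<^sup>+z\<in>{z \<in> ball 0 1. cmod (y - z) < 2 * gap z}. ennreal (gap z powr (- 2 - \<eta>)) \<partial>area) \<le>
      (\<integral>\<^sup>+z. ennreal (3 powr e * g powr (- e)) * indicator (ball y g) z +
       ennreal (2 powr e * g powr (- e)) * (ennreal ((g / cmod (z - y)) powr e) * indicator {z. g \<le> cmod (z - y)} z) \<partial>area)"
      by (intro nn_integral_mono pw)
    also have "\<dots> = ennreal (3 powr e * g powr (- e)) * emeasure area (ball y g) +
       ennreal (2 powr e * g powr (- e)) * (\<integral>\<^sup>+z. ennreal ((g / cmod (z - y)) powr e) * indicator {z. g \<le> cmod (z - y)} z \<partial>area)"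
      by (subst nn_integral_add) (simp_all add: nn_integral_cmult nn_integral_cmult_indicator)
    also have "(\<integral>\<^sup>+z. ennreal ((g / cmod (z - y)) powr e) * indicator {z. g \<le> cmod (z - y)} z \<partial>area) \<le>
       ennreal (t * g\<^sup>2)"
      unfolding t_def by (rule nn_integral_area_kernel_tail[OF g e])
    also have "emeasure area (ball y g) = ennreal (g\<^sup>2)" using g by (intro emeasure_area_ball) simp
    also have "ennreal (3 powr e * g powr (- e)) * ennreal (g\<^sup>2) + ennreal (2 powr e * g powr (- e)) * ennreal (t * g\<^sup>2)
       = ennreal (3 powr e * (g powr (- e) * g\<^sup>2) + 2 powr e * t * (g powr (- e) * g\<^sup>2))"
      using t by (simp add: ennreal_mult'[symmetric] ennreal_plus[symmetric] mult_ac del: ennreal_plus)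
    also have "\<dots> = ennreal (C * gap y powr (- \<eta>))"
      unfolding gg by (simp add: C_def g_def algebra_simps)
    finally show "(\<integral>\<^sup>+z\<in>{z \<in> ball 0 1. cmod (y - z) < 2 * gap z}. ennreal (gap z powr (- 2 - \<eta>)) \<partial>area) \<le> ennreal (C * gap y powr (- \<eta>))"
      by (simp add: add_left_mono mult_left_mono)
  qed
qed

section \<open>The Littlewood--Paley estimate\<close>

context bekolle
begin

text \<open>Write \<open>V(z)\<close> as an integral over the tent of \<open>z\<close> and interchange: the cone integral returns \<open>(gap y)\<^sup>-\<^sup>\<eta>\<close>, and the
  points \<open>y\<close> that occur lie in a fixed multiple of the tent of \<open>x\<close>.\<close>

lemma nontangential_V_integral:
  obtains \<eta> C where "0 < \<eta>" "0 < C" "\<And>x. x \<in> ball 0 1 \<Longrightarrow>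
    (\<integral>\<^sup>+z\<in>ball 0 1. ennreal (gap z powr (- \<eta>)) * ennreal (V z) * indicator nontangential (z, x) \<partial>area)
      \<le> ennreal (C * gap x powr (- \<eta>)) * emeasure mu (tent x (2 * gap x))"
proof -
  obtain \<eta> where \<eta>: "0 < \<eta>" and neg: "\<And>R. \<exists>C>0. \<forall>w\<in>ball 0 1.
     (\<integral>\<^sup>+x\<in>tent w (R * gap w). ennreal (gap x powr (- \<eta>)) \<partial>mu)
       \<le> ennreal (C * gap w powr (- \<eta>) * measure mu (tent w (2 * gap w)))"
    using negative_power_integrable by blast
  obtain C1 where C1: "C1 > 0" "\<And>w. w \<in> ball 0 1 \<Longrightarrow>
     (\<integral>\<^sup>+x\<in>tent w (12 * gap w). ennreal (gap x powr (- \<eta>)) \<partial>mu)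
       \<le> ennreal (C1 * gap w powr (- \<eta>) * measure mu (tent w (2 * gap w)))"
    using neg[of 12] by blast
  obtain C2 where C2: "C2 > 0" "\<And>y. y \<in> ball 0 1 \<Longrightarrow>
    (\<integral>\<^sup>+z\<in>{z \<in> ball 0 1. cmod (y - z) < 2 * gap z}. ennreal (gap z powr (- 2 - \<eta>)) \<partial>area) \<le> ennreal (C2 * gap y powr (- \<eta>))"
    using cone_integral[OF \<eta>] by blast
  interpret pair_sigma_finite area mu ..
  define S where "S = {w :: complex \<times> complex. cmod (fst w) < 1 \<and> cmod (snd w) < 1 \<and> cmod (snd w - fst w) < 2 * gap (fst w)}"
  have "S \<in> sets (borel \<Otimes>\<^sub>M borel)"
    unfolding borel_prod S_def by (intro borel_open open_Collect_conj open_Collect_less continuous_intros)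
  note [measurable] = this
  show thesis
  proof (rule that[OF \<eta>, of "C2 * C1"])
    show "0 < C2 * C1" using C1 C2 by simp
    fix x :: complex assume x: "x \<in> ball 0 1"
    define K :: "complex \<Rightarrow> complex \<Rightarrow> ennreal" where
      "K = (\<lambda>z y. ennreal (gap z powr (- 2 - \<eta>)) * indicator nontangential (z, x) * indicator S (z, y))"
    have [measurable]: "case_prod K \<in> borel_measurable (area \<Otimes>\<^sub>M mu)"
      unfolding K_def by measurable
    have "(\<integral>\<^sup>+z\<in>ball 0 1. ennreal (gap z powr (- \<eta>)) * ennreal (V z) * indicator nontangential (z, x) \<partial>area)
      = (\<integral>\<^sup>+z. (\<integral>\<^sup>+y. K z y \<partial>mu) \<partial>area)"
    proof (rule nn_integral_cong)
      fix z
      show "ennreal (gap z powr (- \<eta>)) * ennreal (V z) * indicator nontangential (z, x) * indicator (ball 0 1) z = (\<integral>\<^sup>+y. K z y \<partial>mu)"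
      proof (cases "z \<in> ball 0 1")
        case True
        then have g: "gap z > 0" by simp
        have "gap z powr (- 2 - \<eta>) = gap z powr (- \<eta>) * (1 / (gap z)\<^sup>2)"
        proof -
          have "gap z powr (- 2 - \<eta>) = gap z powr (- \<eta>) * gap z powr (- 2)"
          proof -
            have "- 2 - \<eta> = - \<eta> + (- 2)" by simp
            then show ?thesis by (simp only: powr_add)
          qed
          also have "gap z powr (- 2) = 1 / (gap z)\<^sup>2"
            using g by (simp add: powr_minus divide_inverse)
          finally show ?thesis .
        qed
        then have "ennreal (gap z powr (- \<eta>)) * ennreal (V z) = ennreal (gap z powr (- 2 - \<eta>)) * emeasure mu (tent z (2 * gap z))"
          by (simp add: V_def mu.emeasure_eq_measure ennreal_mult'[symmetric])
        also have "\<dots> = (\<integral>\<^sup>+y. ennreal (gap z powr (- 2 - \<eta>)) * indicator (tent z (2 * gap z)) y \<partial>mu)"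
          by (simp add: nn_integral_cmult_indicator)
        also have "\<dots> * indicator nontangential (z, x) = (\<integral>\<^sup>+y. ennreal (gap z powr (- 2 - \<eta>)) * indicator (tent z (2 * gap z)) y * indicator nontangential (z, x) \<partial>mu)"
          by (rule nn_integral_multc[symmetric]) measurable
        also have "\<dots> = (\<integral>\<^sup>+y. K z y \<partial>mu)"
          using True by (intro nn_integral_cong)
            (auto simp: K_def S_def tent_def indicator_def dist_norm norm_minus_commute)
        finally show ?thesis using True by simp
      qed (simp add: K_def S_def)
    qed
    also have "\<dots> = (\<integral>\<^sup>+y. (\<integral>\<^sup>+z. K z y \<partial>area) \<partial>mu)"
      by (rule Fubini'[symmetric]) simp
    also have "\<dots> \<le> (\<integral>\<^sup>+y. ennreal C2 * (ennreal (gap y powr (- \<eta>)) * indicator (tent x (12 * gap x)) y) \<partial>mu)"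
    proof (rule nn_integral_mono)
      fix y
      show "(\<integral>\<^sup>+z. K z y \<partial>area) \<le> ennreal C2 * (ennreal (gap y powr (- \<eta>)) * indicator (tent x (12 * gap x)) y)"
      proof (cases "y \<in> tent x (12 * gap x)")
        case True
        then have yD: "y \<in> ball 0 1" by (simp add: tent_def)
        have "(\<integral>\<^sup>+z. K z y \<partial>area) \<le> (\<integral>\<^sup>+z\<in>{z \<in> ball 0 1. cmod (y - z) < 2 * gap z}. ennreal (gap z powr (- 2 - \<eta>)) \<partial>area)"
          by (intro nn_integral_mono) (auto simp: K_def S_def indicator_def)
        also have "\<dots> \<le> ennreal (C2 * gap y powr (- \<eta>))" by (rule C2(2)[OF yD])
        finally show ?thesis using True C2(1) by (simp add: ennreal_mult')
      next
        case False
        have "K z y = 0" for z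
        proof (rule ccontr)
          assume "K z y \<noteq> 0"
          then have z: "cmod (z - x) \<le> 3 * gap x" "cmod y < 1" "cmod (y - z) < 2 * gap z"
            by (auto simp: K_def S_def nontangential_def indicator_def split: if_splits)
          have "gap z \<le> 4 * gap x" using gap_triangle(1)[of z x] z(1) by argo
          moreover have "cmod (y - x) \<le> cmod (y - z) + cmod (z - x)" using norm_triangle_ineq[of "y - z" "z - x"] by simp
          moreover have "gap x > 0" using x by simp
          ultimately have "cmod (y - x) < 12 * gap x" using z by argo
          then show False using False z(2) by (simp add: tent_def dist_norm norm_minus_commute)
        qed
        then show ?thesis by simp
      qed
    qed
    also have "\<dots> = ennreal C2 * (\<integral>\<^sup>+y\<in>tent x (12 * gap x). ennreal (gap y powr (- \<eta>)) \<partial>mu)"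
      by (rule nn_integral_cmult) measurable
    also have "\<dots> \<le> ennreal C2 * ennreal (C1 * gap x powr (- \<eta>) * measure mu (tent x (2 * gap x)))"
      by (intro mult_left_mono C1(2) x) simp
    also have "\<dots> = ennreal (C2 * C1 * gap x powr (- \<eta>)) * emeasure mu (tent x (2 * gap x))"
      using C1(1) C2(1) by (simp add: mu.emeasure_eq_measure ennreal_mult'[symmetric] mult_ac)
    finally show "(\<integral>\<^sup>+z\<in>ball 0 1. ennreal (gap z powr (- \<eta>)) * ennreal (V z) * indicator nontangential (z, x) \<partial>area)
      \<le> ennreal (C2 * C1 * gap x powr (- \<eta>)) * emeasure mu (tent x (2 * gap x))" .
  qed
qed

text \<open>The case \<open>f = 1\<close> of the main inequality.\<close>

lemma V_integral_finite: "(\<integral>\<^sup>+z\<in>ball 0 1. ennreal (V z) \<partial>area) < \<infinity>"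
proof -
  obtain C where C: "\<And>f. f holomorphic_on ball 0 1 \<Longrightarrow>
    V_norm 1 f \<le> ennreal C * (\<integral>\<^sup>+x. disc_pow f 1 x \<partial>mu)"
    using V_norm_le_mu_norm[of 1] by auto
  have "(\<integral>\<^sup>+z\<in>ball 0 1. ennreal (V z) \<partial>area) = V_norm 1 (\<lambda>_. 1)"
    by (simp add: disc_pow_def mult.commute)
  also have "\<dots> \<le> ennreal C * (\<integral>\<^sup>+x. disc_pow (\<lambda>_. 1) 1 x \<partial>mu)"
    by (rule C) simp
  also have "(\<integral>\<^sup>+x. disc_pow (\<lambda>_. 1) 1 x \<partial>mu) = ennreal (measure mu (ball 0 1))"
    by (simp add: disc_pow_def mu.emeasure_eq_measure)
  also have "ennreal C * ennreal (measure mu (ball 0 1)) < \<infinity>"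
    by (simp add: ennreal_mult_less_top)
  finally show ?thesis .
qed

text \<open>In the nontangential region \<open>gap z \<le> 4 gap x\<close>, so the power \<open>\<beta>\<close> can be moved to the point \<open>x\<close>.\<close>

lemma weighted_norm_le_derivative_norm:
  assumes p: "0 < p" and \<beta>: "0 \<le> \<beta>"
  shows "\<exists>C>0. \<forall>f. f holomorphic_on ball 0 1 \<longrightarrow>
    V_weighted_norm p \<beta> f \<le>
    ennreal C * (ennreal (cmod (f 0) powr p) +
      V_weighted_norm p (\<beta> + p) (deriv f))"
proof -
  obtain \<eta> C1 where \<eta>: "0 < \<eta>" and C1: "0 < C1" "\<And>x. x \<in> ball 0 1 \<Longrightarrow>
    (\<integral>\<^sup>+z\<in>ball 0 1. ennreal (gap z powr (- \<eta>)) * ennreal (V z) * indicator nontangential (z, x) \<partial>area)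
      \<le> ennreal (C1 * gap x powr (- \<eta>)) * emeasure mu (tent x (2 * gap x))"
    using nontangential_V_integral by blast
  obtain C0 where C0: "0 < C0" "\<And>f z. f holomorphic_on ball 0 1 \<Longrightarrow> z \<in> ball 0 1 \<Longrightarrow>
    ennreal (cmod (f z - f 0) powr p) \<le> ennreal C0 *
      (\<integral>\<^sup>+x. disc_pow (deriv f) p x * (ennreal ((gap x / gap z) powr \<eta> * gap x powr p / (gap x)\<^sup>2) * indicator nontangential (z, x)) \<partial>area)"
    using increment_le_nontangential_average[OF p \<eta>] by blast
  define I where "I = enn2real (\<integral>\<^sup>+z\<in>ball 0 1. ennreal (V z) \<partial>area)"
  have I: "(\<integral>\<^sup>+z\<in>ball 0 1. ennreal (V z) \<partial>area) = ennreal I" "0 \<le> I"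
    using V_integral_finite by (simp_all add: I_def)
  define A where "A = 2 powr p * C0 * 4 powr \<beta> * C1"
  define C where "C = 2 powr p * I + A"
  have A: "A > 0" using C0 C1 by (simp add: A_def)
  interpret aa: pair_sigma_finite area area ..
  show ?thesis
  proof (intro exI[of _ C] conjI allI impI)
    show "0 < C" using A I by (simp add: C_def add_nonneg_pos)
    fix f :: "complex \<Rightarrow> complex" assume f: "f holomorphic_on ball 0 1"
    have f': "deriv f holomorphic_on ball 0 1" using f by (intro holomorphic_deriv) auto
    note [measurable] = disc_pow_borel[OF f'] disc_pow_borel[OF f]
    define U where "U = (\<lambda>z. ennreal (gap z powr \<beta>) * ennreal (V z) * indicator (ball 0 1) z)"
    have [measurable]: "U \<in> borel_measurable borel" unfolding U_def by measurable
    define K where "K = (\<lambda>z x. disc_pow (deriv f) p x * (ennreal ((gap x / gap z) powr \<eta> * gap x powr p / (gap x)\<^sup>2) * indicator nontangential (z, x)))"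
    have [measurable]: "case_prod K \<in> borel_measurable (borel \<Otimes>\<^sub>M borel)"
      unfolding K_def by measurable
    have split: "disc_pow f p z * ennreal (gap z powr \<beta>) * ennreal (V z) \<le>
       ennreal (2 powr p * cmod (f 0) powr p) * U z + ennreal (2 powr p * C0) * (U z * (\<integral>\<^sup>+x. K z x \<partial>area))" for z
    proof (cases "z \<in> ball 0 1")
      case True
      have "cmod (f z) powr p \<le> 2 powr p * cmod (f 0) powr p + 2 powr p * cmod (f z - f 0) powr p"
      proof -
        have "cmod (f z) \<le> cmod (f 0) + cmod (f z - f 0)" using norm_triangle_ineq[of "f 0" "f z - f 0"] by simp
        also have "\<dots> \<le> 2 * max (cmod (f 0)) (cmod (f z - f 0))" by simp
        finally have "cmod (f z) powr p \<le> (2 * max (cmod (f 0)) (cmod (f z - f 0))) powr p"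
          using p by (intro powr_mono2) auto
        also have "\<dots> = 2 powr p * max (cmod (f 0)) (cmod (f z - f 0)) powr p" by (simp add: powr_mult)
        also have "\<dots> \<le> 2 powr p * (cmod (f 0) powr p + cmod (f z - f 0) powr p)"
          by (intro mult_left_mono) (auto simp: max_def)
        finally show ?thesis by (simp add: distrib_left)
      qed
      then have "ennreal (cmod (f z) powr p) \<le> ennreal (2 powr p * cmod (f 0) powr p + 2 powr p * cmod (f z - f 0) powr p)"
        by (rule ennreal_leI)
      also have "\<dots> = ennreal (2 powr p * cmod (f 0) powr p) + ennreal (2 powr p) * ennreal (cmod (f z - f 0) powr p)"
        by (simp add: ennreal_mult')
      also have "\<dots> \<le> ennreal (2 powr p * cmod (f 0) powr p) + ennreal (2 powr p) * (ennreal C0 * (\<integral>\<^sup>+x. K z x \<partial>area))"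
        unfolding K_def by (intro add_left_mono mult_left_mono C0(2) f True) simp
      also have "ennreal (2 powr p) * (ennreal C0 * (\<integral>\<^sup>+x. K z x \<partial>area)) = ennreal (2 powr p * C0) * (\<integral>\<^sup>+x. K z x \<partial>area)"
        using C0(1) by (simp add: ennreal_mult' mult.assoc)
      finally have "ennreal (cmod (f z) powr p) * U z \<le>
        (ennreal (2 powr p * cmod (f 0) powr p) + ennreal (2 powr p * C0) * (\<integral>\<^sup>+x. K z x \<partial>area)) * U z"
        by (rule mult_right_mono) simp
      moreover have "(a + b * k) * u = a * u + b * (u * k)" for a b k u :: ennreal
        unfolding distrib_right by (simp only: mult_ac)
      moreover have "disc_pow f p z * ennreal (gap z powr \<beta>) * ennreal (V z) = ennreal (cmod (f z) powr p) * U z"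
        using True by (simp add: disc_pow_def U_def mult.assoc)
      ultimately show ?thesis by (simp only:)
    qed (simp add: disc_pow_def)
    have "V_weighted_norm p \<beta> f \<le>
      (\<integral>\<^sup>+z. ennreal (2 powr p * cmod (f 0) powr p) * U z + ennreal (2 powr p * C0) * (U z * (\<integral>\<^sup>+x. K z x \<partial>area)) \<partial>area)"
      by (intro nn_integral_mono split)
    also have "\<dots> = ennreal (2 powr p * cmod (f 0) powr p) * (\<integral>\<^sup>+z. U z \<partial>area) +
       ennreal (2 powr p * C0) * (\<integral>\<^sup>+z. U z * (\<integral>\<^sup>+x. K z x \<partial>area) \<partial>area)"
    proof -
      have [measurable]: "(\<lambda>z. \<integral>\<^sup>+x. K z x \<partial>area) \<in> borel_measurable borel"
        by measurable
      show ?thesis by (subst nn_integral_add) (simp_all add: nn_integral_cmult)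
    qed
    also have "(\<integral>\<^sup>+z. U z * (\<integral>\<^sup>+x. K z x \<partial>area) \<partial>area) = (\<integral>\<^sup>+z. (\<integral>\<^sup>+x. U z * K z x \<partial>area) \<partial>area)"
      by (intro nn_integral_cong nn_integral_cmult[symmetric]) simp
    also have "\<dots> = (\<integral>\<^sup>+x. (\<integral>\<^sup>+z. U z * K z x \<partial>area) \<partial>area)"
      by (rule aa.Fubini'[symmetric]) measurable
    also have "\<dots> \<le> (\<integral>\<^sup>+x. ennreal (4 powr \<beta> * C1) * (disc_pow (deriv f) p x * ennreal (gap x powr (\<beta> + p)) * ennreal (V x)) \<partial>area)"
    proof (rule nn_integral_mono)
      fix x
      show "(\<integral>\<^sup>+z. U z * K z x \<partial>area) \<le> ennreal (4 powr \<beta> * C1) * (disc_pow (deriv f) p x * ennreal (gap x powr (\<beta> + p)) * ennreal (V x))"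
      proof (cases "x \<in> ball 0 1")
        case True
        then have gx: "gap x > 0" by simp
        define c where "c = 4 powr \<beta> * gap x powr \<beta> * (gap x powr \<eta> * gap x powr p / (gap x)\<^sup>2)"
        have pw: "U z * K z x \<le> (disc_pow (deriv f) p x * ennreal c) * (ennreal (gap z powr (- \<eta>)) * ennreal (V z) * indicator nontangential (z, x) * indicator (ball 0 1) z)" for z
        proof (cases "z \<in> ball 0 1 \<and> (z, x) \<in> nontangential")
          case zT: True
          then have gz: "gap z > 0" and zx: "cmod (z - x) \<le> 3 * gap x" by (auto simp: nontangential_def)
          have "gap z \<le> 4 * gap x" using gap_triangle(1)[of z x] zx by argo
          then have "gap z powr \<beta> \<le> (4 * gap x) powr \<beta>" using gz \<beta> by (intro powr_mono2) auto
          also have "\<dots> = 4 powr \<beta> * gap x powr \<beta>" by (rule powr_mult)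
          finally have b: "gap z powr \<beta> \<le> 4 powr \<beta> * gap x powr \<beta>" .
          have e: "(gap x / gap z) powr \<eta> * gap x powr p / (gap x)\<^sup>2 = (gap x powr \<eta> * gap x powr p / (gap x)\<^sup>2) * gap z powr (- \<eta>)"
            unfolding powr_divide[of "gap x" "gap z"] by (simp add: powr_minus divide_inverse)
          have "gap z powr \<beta> * ((gap x / gap z) powr \<eta> * gap x powr p / (gap x)\<^sup>2) \<le> c * gap z powr (- \<eta>)"
          proof -
            have "gap z powr \<beta> * ((gap x powr \<eta> * gap x powr p / (gap x)\<^sup>2) * gap z powr (- \<eta>)) \<le>
              (4 powr \<beta> * gap x powr \<beta>) * ((gap x powr \<eta> * gap x powr p / (gap x)\<^sup>2) * gap z powr (- \<eta>))"
              using b by (rule mult_right_mono) simp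
            then show ?thesis unfolding e c_def by (simp only: mult.assoc)
          qed
          then have "ennreal (gap z powr \<beta>) * ennreal ((gap x / gap z) powr \<eta> * gap x powr p / (gap x)\<^sup>2) \<le> ennreal c * ennreal (gap z powr (- \<eta>))"
            by (simp add: ennreal_mult'[symmetric] ennreal_leI c_def)
          then have "(disc_pow (deriv f) p x * ennreal (V z)) * (ennreal (gap z powr \<beta>) * ennreal ((gap x / gap z) powr \<eta> * gap x powr p / (gap x)\<^sup>2)) \<le>
            (disc_pow (deriv f) p x * ennreal (V z)) * (ennreal c * ennreal (gap z powr (- \<eta>)))"
            by (rule mult_left_mono) simp
          then show ?thesis using zT by (simp add: U_def K_def mult_ac)
        qed (auto simp: U_def K_def indicator_def)
        have "(\<integral>\<^sup>+z. U z * K z x \<partial>area) \<le> (\<integral>\<^sup>+z. (disc_pow (deriv f) p x * ennreal c) * (ennreal (gap z powr (- \<eta>)) * ennreal (V z) * indicator nontangential (z, x) * indicator (ball 0 1) z) \<partial>area)"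
          by (intro nn_integral_mono pw)
        also have "\<dots> = (disc_pow (deriv f) p x * ennreal c) * (\<integral>\<^sup>+z\<in>ball 0 1. ennreal (gap z powr (- \<eta>)) * ennreal (V z) * indicator nontangential (z, x) \<partial>area)"
          by (rule nn_integral_cmult) measurable
        also have "\<dots> \<le> (disc_pow (deriv f) p x * ennreal c) * (ennreal (C1 * gap x powr (- \<eta>)) * emeasure mu (tent x (2 * gap x)))"
          by (intro mult_left_mono C1(2) True) simp
        also have "ennreal (C1 * gap x powr (- \<eta>)) * emeasure mu (tent x (2 * gap x)) = ennreal (C1 * gap x powr (- \<eta>) * (gap x)\<^sup>2 * V x)"
          using C1(1) gx by (simp add: V_def mu.emeasure_eq_measure ennreal_mult'[symmetric])
        also have "disc_pow (deriv f) p x * ennreal c * ennreal (C1 * gap x powr (- \<eta>) * (gap x)\<^sup>2 * V x) =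
           disc_pow (deriv f) p x * ennreal (c * (C1 * gap x powr (- \<eta>) * (gap x)\<^sup>2 * V x))"
          by (simp add: ennreal_mult'[symmetric] mult.assoc c_def)
        also have "c * (C1 * gap x powr (- \<eta>) * (gap x)\<^sup>2 * V x) = 4 powr \<beta> * C1 * (gap x powr (\<beta> + p) * V x)"
          using gx by (simp add: c_def powr_add powr_minus)
        also have "disc_pow (deriv f) p x * ennreal (4 powr \<beta> * C1 * (gap x powr (\<beta> + p) * V x)) =
           ennreal (4 powr \<beta> * C1) * (disc_pow (deriv f) p x * ennreal (gap x powr (\<beta> + p)) * ennreal (V x))"
        proof -
          have "ennreal (4 powr \<beta> * C1 * (gap x powr (\<beta> + p) * V x)) =
             ennreal (4 powr \<beta> * C1) * (ennreal (gap x powr (\<beta> + p)) * ennreal (V x))"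
            using C1(1) by (subst ennreal_mult', simp, subst ennreal_mult') simp_all
          then show ?thesis by (simp only: mult_ac)
        qed
        finally show ?thesis .
      qed (simp add: K_def disc_pow_def)
    qed
    also have "\<dots> = ennreal (4 powr \<beta> * C1) * V_weighted_norm p (\<beta> + p) (deriv f)"
      by (rule nn_integral_cmult) measurable
    also have "(\<integral>\<^sup>+z. U z \<partial>area) \<le> ennreal I"
      unfolding I(1)[symmetric]
    proof (rule nn_integral_mono)
      fix z
      have "gap z powr \<beta> \<le> 1" if "z \<in> ball 0 1"
        using that \<beta> by (intro powr_le1) auto
      then have "ennreal (gap z powr \<beta>) * ennreal (V z) \<le> 1 * ennreal (V z)" if "z \<in> ball 0 1"
        using that by (intro mult_right_mono) auto
      then show "U z \<le> ennreal (V z) * indicator (ball 0 1) z"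
        by (auto simp: U_def indicator_def)
    qed
    finally have le: "V_weighted_norm p \<beta> f \<le>
      ennreal (2 powr p * cmod (f 0) powr p) * ennreal I + ennreal (2 powr p * C0) * (ennreal (4 powr \<beta> * C1) *
      V_weighted_norm p (\<beta> + p) (deriv f))"
      (is "_ \<le> _ + _ * (_ * ?J)")
      by (simp add: add_mono mult_left_mono)
    also have "ennreal (2 powr p * cmod (f 0) powr p) * ennreal I = ennreal (2 powr p * I) * ennreal (cmod (f 0) powr p)"
      using I(2) by (simp add: ennreal_mult'[symmetric] mult_ac)
    also have "ennreal (2 powr p * C0) * (ennreal (4 powr \<beta> * C1) * ?J) = ennreal A * ?J"
      using C0(1) C1(1) by (simp add: A_def ennreal_mult'[symmetric] mult.assoc[symmetric])
    also have "ennreal (2 powr p * I) * ennreal (cmod (f 0) powr p) + ennreal A * ?J \<le>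
      ennreal C * ennreal (cmod (f 0) powr p) + ennreal C * ?J"
      using A I(2) by (intro add_mono mult_right_mono ennreal_leI) (auto simp: C_def)
    finally show "V_weighted_norm p \<beta> f \<le>
      ennreal C * (ennreal (cmod (f 0) powr p) + ?J)"
      by (simp add: distrib_left)
  qed
qed

lemma V_norm_le_derivative_norm:
  assumes p: "0 < p"
  shows "\<exists>C>0. \<forall>f. f holomorphic_on ball 0 1 \<longrightarrow>
    V_norm p f \<le>
    ennreal C * (V_weighted_norm p (real k * p) ((deriv ^^ k) f) +
      ennreal (\<Sum>j<k. cmod ((deriv ^^ j) f 0) powr p))"
proof (induction k)
  case 0
  have "disc_pow f p x * ennreal (gap x powr 0) = disc_pow f p x" for f x
    by (cases "x \<in> ball 0 1") (auto simp: disc_pow_def)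
  then show ?case by (intro exI[of _ 1]) auto
next
  case (Suc k)
  then obtain C where C: "0 < C" "\<And>f. f holomorphic_on ball 0 1 \<Longrightarrow>
    V_norm p f \<le>
    ennreal C * (V_weighted_norm p (real k * p) ((deriv ^^ k) f) +
      ennreal (\<Sum>j<k. cmod ((deriv ^^ j) f 0) powr p))"
    by blast
  obtain C' where C': "0 < C'" "\<And>f. f holomorphic_on ball 0 1 \<Longrightarrow>
    V_weighted_norm p (real k * p) f \<le>
    ennreal C' * (ennreal (cmod (f 0) powr p) +
      V_weighted_norm p (real k * p + p) (deriv f))"
    using weighted_norm_le_derivative_norm[OF p, of "real k * p"] p by auto
  show ?case
  proof (intro exI[of _ "C * max 1 C'"] conjI allI impI)
    show "0 < C * max 1 C'" using C(1) by simp
    fix f :: "complex \<Rightarrow> complex" assume f: "f holomorphic_on ball 0 1"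
    have fk: "(deriv ^^ k) f holomorphic_on ball 0 1"
      using f by (rule holomorphic_higher_deriv) simp
    let ?J = "V_weighted_norm p (real (Suc k) * p) ((deriv ^^ Suc k) f)"
    define s where "s = (\<Sum>j<k. cmod ((deriv ^^ j) f 0) powr p)"
    define d where "d = cmod ((deriv ^^ k) f 0) powr p"
    have sd: "0 \<le> s" "0 \<le> d" by (auto simp: s_def d_def intro: sum_nonneg)
    have e: "real (Suc k) * p = real k * p + p" by (simp add: algebra_simps)
    have "V_norm p f \<le>
      ennreal C * (V_weighted_norm p (real k * p) ((deriv ^^ k) f) + ennreal s)"
      unfolding s_def by (rule C(2)[OF f])
    also have "\<dots> \<le> ennreal C * (ennreal C' * (ennreal d + ?J) + ennreal s)"
      using C'(2)[OF fk] unfolding d_def e by (intro mult_left_mono add_right_mono) simp_all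
    also have "\<dots> \<le> ennreal C * (ennreal (max 1 C') * (ennreal d + ?J) + ennreal (max 1 C') * ennreal s)"
    proof (intro mult_left_mono add_mono mult_right_mono)
      have "1 * ennreal s \<le> ennreal (max 1 C') * ennreal s" by (intro mult_right_mono) auto
      then show "ennreal s \<le> ennreal (max 1 C') * ennreal s" by simp
    qed (auto intro: ennreal_leI)
    also have "\<dots> = ennreal (C * max 1 C') * (?J + (ennreal s + ennreal d))"
      using C(1) by (simp add: ennreal_mult' distrib_left mult_ac add_ac)
    also have "ennreal s + ennreal d = ennreal (\<Sum>j<Suc k. cmod ((deriv ^^ j) f 0) powr p)"
      using sd by (simp add: s_def d_def)
    finally show "V_norm p f \<le>
      ennreal (C * max 1 C') * (?J + ennreal (\<Sum>j<Suc k. cmod ((deriv ^^ j) f 0) powr p))" .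
  qed
qed

lemma derivative_norm_le_V_norm:
  assumes p: "0 < p"
  shows "\<exists>C>0. \<forall>f. f holomorphic_on ball 0 1 \<longrightarrow>
    V_weighted_norm p (real k * p) ((deriv ^^ k) f) +
      ennreal (\<Sum>j<k. cmod ((deriv ^^ j) f 0) powr p) \<le>
    ennreal C * V_norm p f"
proof -
  have "\<exists>C>0. \<forall>f. f holomorphic_on ball 0 1 \<longrightarrow>
    ennreal (\<Sum>j<m. cmod ((deriv ^^ j) f 0) powr p) \<le> ennreal C * V_norm p f" for m
  proof (induction m)
    case 0
    show ?case by (intro exI[of _ 1]) auto
  next
    case (Suc m)
    then obtain C where C: "0 < C" "\<And>f. f holomorphic_on ball 0 1 \<Longrightarrow>
      ennreal (\<Sum>j<m. cmod ((deriv ^^ j) f 0) powr p) \<le> ennreal C * V_norm p f" by blast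
    obtain C' where C': "0 < C'" "\<And>f. f holomorphic_on ball 0 1 \<Longrightarrow>
      ennreal (cmod ((deriv ^^ m) f 0) powr p) \<le> ennreal C' * V_norm p f"
      using deriv_at_0_le_V_norm[OF p, of m] by blast
    show ?case
    proof (intro exI[of _ "C + C'"] conjI allI impI)
      show "0 < C + C'" using C C' by simp
      fix f :: "complex \<Rightarrow> complex" assume f: "f holomorphic_on ball 0 1"
      have "ennreal (\<Sum>j<Suc m. cmod ((deriv ^^ j) f 0) powr p) =
        ennreal (\<Sum>j<m. cmod ((deriv ^^ j) f 0) powr p) + ennreal (cmod ((deriv ^^ m) f 0) powr p)"
        by (simp add: sum_nonneg)
      also have "\<dots> \<le> ennreal C * V_norm p f + ennreal C' * V_norm p f"
        by (intro add_mono C(2) C'(2) f)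
      also have "\<dots> = ennreal (C + C') * V_norm p f"
        using C(1) C'(1) by (simp add: distrib_right)
      finally show "ennreal (\<Sum>j<Suc m. cmod ((deriv ^^ j) f 0) powr p) \<le>
        ennreal (C + C') * V_norm p f" .
    qed
  qed
  then obtain C where C: "0 < C" "\<And>f. f holomorphic_on ball 0 1 \<Longrightarrow>
    ennreal (\<Sum>j<k. cmod ((deriv ^^ j) f 0) powr p) \<le> ennreal C * V_norm p f" by blast
  obtain C' where C': "0 < C'" "\<And>f. f holomorphic_on ball 0 1 \<Longrightarrow>
    V_weighted_norm p (real k * p) ((deriv ^^ k) f)
      \<le> ennreal C' * V_norm p f"
    using derivative_le_V_norm[OF p, of k] by blast
  show ?thesis
  proof (intro exI[of _ "C' + C"] conjI allI impI)
    show "0 < C' + C" using C C' by simp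
    fix f :: "complex \<Rightarrow> complex" assume f: "f holomorphic_on ball 0 1"
    have "ennreal (C' + C) * V_norm p f =
      ennreal C' * V_norm p f + ennreal C * V_norm p f"
      using C(1) C'(1) by (simp add: distrib_right)
    then show "V_weighted_norm p (real k * p) ((deriv ^^ k) f) +
        ennreal (\<Sum>j<k. cmod ((deriv ^^ j) f 0) powr p) \<le>
      ennreal (C' + C) * V_norm p f"
      using add_mono[OF C'(2)[OF f] C(2)[OF f]] by simp
  qed
qed

end

section \<open>Borel representatives and the theorem\<close>

lemma comparable_onI:
  assumes "0 < a" "0 < b"
    and X: "\<And>f. f \<in> F \<Longrightarrow> X f \<le> ennreal a * Y f"
    and Y: "\<And>f. f \<in> F \<Longrightarrow> Y f \<le> ennreal b * X f"
  shows "comparable_on F X Y"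
  unfolding comparable_on_def
proof (intro exI[of _ "max a b"] conjI ballI)
  show "0 < max a b" using assms by simp
  fix f assume f: "f \<in> F"
  have "ennreal (inverse (max a b)) * Y f \<le> ennreal (inverse (max a b)) * (ennreal (max a b) * X f)"
    using Y[OF f] by (intro mult_left_mono order_trans[OF Y[OF f]] mult_right_mono ennreal_leI) auto
  also have "\<dots> = X f"
    using assms by (simp add: mult.assoc[symmetric] ennreal_mult'[symmetric])
  finally show "ennreal (inverse (max a b)) * Y f \<le> X f" .
  show "X f \<le> ennreal (max a b) * Y f"
    using X[OF f] by (rule order_trans) (intro mult_right_mono ennreal_leI, auto)
qed

context bekolle
begin

lemma V_comparable_square_mean:
  assumes wt: "\<And>z. z \<in> ball 0 1 \<Longrightarrow> z \<noteq> 0 \<Longrightarrow> wt z = measure mu (carleson_square z) / (gap z)\<^sup>2"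
  obtains C where "C \<ge> 1" "\<And>z. z \<in> ball 0 1 \<Longrightarrow> z \<noteq> 0 \<Longrightarrow> wt z \<le> V z \<and> V z \<le> C * wt z"
proof -
  obtain C where C: "C \<ge> 1" "\<And>z. z \<in> ball 0 1 \<Longrightarrow> z \<noteq> 0 \<Longrightarrow>
     measure mu (tent z (2 * gap z)) \<le> C * measure mu (carleson_square z)"
    using mu_tent_le_square by blast
  show thesis
  proof (rule that[OF C(1)])
    fix z :: complex assume z: "z \<in> ball 0 1" "z \<noteq> 0"
    have "measure mu (carleson_square z) \<le> measure mu (tent z (2 * gap z))"
      by (intro mu.finite_measure_mono carleson_square_subset_tent z) auto
    then have "wt z \<le> V z" unfolding wt[OF z] V_def by (intro divide_right_mono) auto
    moreover have "measure mu (tent z (2 * gap z)) / (gap z)\<^sup>2 \<le> C * measure mu (carleson_square z) / (gap z)\<^sup>2"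
      by (intro divide_right_mono C(2) z) auto
    then have "V z \<le> C * wt z" unfolding wt[OF z] V_def by simp
    ultimately show "wt z \<le> V z \<and> V z \<le> C * wt z" ..
  qed
qed

end

lemma AE_area_measure:
  assumes "AE x in lborel. P x"
  shows "AE x in area_measure. P x"
proof -
  have "AE x in lebesgue. P x" using assms by (simp add: AE_completion)
  then show ?thesis unfolding area_measure_def by (subst AE_density) auto
qed

lemma nn_integral_area_measure:
  assumes [measurable]: "g \<in> borel_measurable borel"
  shows "(\<integral>\<^sup>+x. g x \<partial>area_measure) = (\<integral>\<^sup>+x. g x \<partial>area)"
proof -
  have [measurable]: "g \<in> borel_measurable lebesgue" by (intro measurable_completion) simp
  have "(\<integral>\<^sup>+x. g x \<partial>area_measure) = (\<integral>\<^sup>+x. ennreal (1 / pi) * g x \<partial>lebesgue)"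
    unfolding area_measure_def by (rule nn_integral_density) auto
  also have "\<dots> = (\<integral>\<^sup>+x. ennreal (1 / pi) * g x \<partial>lborel)"
    by (rule nn_integral_completion)
  also have "\<dots> = (\<integral>\<^sup>+x. g x \<partial>area)"
    by (simp add: nn_integral_area nn_integral_cmult)
  finally show ?thesis .
qed

text \<open>Integrals over \<^const>\<open>area_measure\<close> are computed from any Borel representative; the integrand itself may fail to be
  Borel.\<close>

lemma nn_integral_area_measure_AE:
  assumes "g \<in> borel_measurable borel" "AE x in lborel. f x = g x"
  shows "(\<integral>\<^sup>+x. f x \<partial>area_measure) = (\<integral>\<^sup>+x. g x \<partial>area)"
  using nn_integral_cong_AE[OF AE_area_measure[OF assms(2)]] nn_integral_area_measure[OF assms(1)] by simp

lemma AE_lborel_of_area: "AE x in area. P x \<Longrightarrow> AE x in lborel. P x"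
  unfolding area_def by (subst (asm) AE_density) auto

lemma set_integrable_borel_representative:
  assumes int: "set_integrable area_measure (ball 0 1) w" and nn: "\<And>z. z \<in> ball 0 1 \<Longrightarrow> 0 \<le> w z"
  obtains g where "g \<in> borel_measurable borel" "\<And>z. 0 \<le> g z" "AE z in lborel. z \<in> ball 0 1 \<longrightarrow> w z = g z"
    "(\<integral>\<^sup>+x\<in>ball 0 1. ennreal (g x) \<partial>area) < \<infinity>"
proof -
  have "integrable area_measure (\<lambda>x. indicator (ball 0 1) x *\<^sub>R w x)"
    using int by (simp add: set_integrable_def)
  then have fin: "(\<integral>\<^sup>+x. ennreal (norm (indicator (ball 0 1) x *\<^sub>R w x)) \<partial>area_measure) < \<infinity>"
    and "(\<lambda>x. indicator (ball 0 1) x *\<^sub>R w x) \<in> borel_measurable area_measure"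
    by (auto simp: integrable_iff_bounded)
  then have "(\<lambda>x. indicator (ball 0 1) x *\<^sub>R w x) \<in> borel_measurable lebesgue"
    by (simp add: area_measure_def)
  then obtain h where h: "h \<in> borel_measurable borel" "AE x in lborel. indicator (ball 0 1) x *\<^sub>R w x = h x"
    using completion_ex_borel_measurable_real[of _ lborel] by auto
  have [measurable]: "(\<lambda>x. max 0 (h x)) \<in> borel_measurable borel" using h(1) by measurable
  have ae: "AE z in lborel. z \<in> ball 0 1 \<longrightarrow> w z = max 0 (h z)"
    using h(2)
  proof eventually_elim
    case (elim z)
    then show ?case using nn[of z] by (auto simp: indicator_def)
  qed
  have "(\<integral>\<^sup>+x. ennreal (norm (indicator (ball 0 1) x *\<^sub>R w x)) \<partial>area_measure) = (\<integral>\<^sup>+x\<in>ball 0 1. ennreal (max 0 (h x)) \<partial>area)"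
  proof (rule nn_integral_area_measure_AE)
    show "AE x in lborel. ennreal (norm (indicator (ball 0 1) x *\<^sub>R w x)) = ennreal (max 0 (h x)) * indicator (ball 0 1) x"
      using ae by eventually_elim (use nn in \<open>auto simp: indicator_def\<close>)
  qed measurable
  with fin show thesis
    by (intro that[of "\<lambda>x. max 0 (h x)"] ae) auto
qed

lemma weight_mass_eq_measure:
  assumes E: "E \<in> sets borel" "E \<subseteq> ball 0 1" and g: "g \<in> borel_measurable borel" "\<And>z. 0 \<le> g z"
    and ae: "AE z in lborel. z \<in> ball 0 1 \<longrightarrow> w z = g z"
    and nn: "\<And>z. z \<in> ball 0 1 \<Longrightarrow> 0 \<le> w z"
    and int: "set_integrable area_measure (ball 0 1) w"
  shows "weight_mass w E = measure (disc_measure (\<lambda>x. ennreal (g x))) E"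
proof -
  note [measurable] = E(1) g(1)
  have "E \<in> sets area_measure" using E(1) by (simp add: area_measure_def)
  then have "set_integrable area_measure E w"
    by (rule set_integrable_subset[OF int _ E(2)])
  then have m: "(\<lambda>x. indicator E x *\<^sub>R w x) \<in> borel_measurable area_measure"
    unfolding set_integrable_def by (rule borel_measurable_integrable)
  have "weight_mass w E = enn2real (\<integral>\<^sup>+x. ennreal (indicator E x *\<^sub>R w x) \<partial>area_measure)"
    unfolding weight_mass_def set_lebesgue_integral_def
  proof (rule integral_eq_nn_integral[OF m AE_I2])
    fix x show "0 \<le> indicator E x *\<^sub>R w x" using nn[of x] E(2) by (auto simp: indicator_def)
  qed
  also have "(\<integral>\<^sup>+x. ennreal (indicator E x *\<^sub>R w x) \<partial>area_measure) = (\<integral>\<^sup>+x\<in>ball 0 1. indicator E x * ennreal (g x) \<partial>area)"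
  proof (rule nn_integral_area_measure_AE)
    show "AE x in lborel. ennreal (indicator E x *\<^sub>R w x) = indicator E x * ennreal (g x) * indicator (ball 0 1) x"
      using ae by eventually_elim (use E(2) in \<open>auto simp: indicator_def\<close>)
  qed measurable
  also have "\<dots> = emeasure (disc_measure (\<lambda>x. ennreal (g x))) E"
    by (rule emeasure_disc_measure[symmetric]) measurable
  finally show ?thesis by (simp add: measure_def)
qed

text \<open>The profile is modified on a null set of radii. By polar coordinates the points of the disc with such
  moduli also form a null set.\<close>

lemma radial_weight_borel_profile:
  assumes nu: "radial_weight v"
  obtains n where "n \<in> borel_measurable borel" "\<And>r. 0 \<le> n r"
    "(\<integral>\<^sup>+r\<in>{0..<1}. ennreal (n r) \<partial>lborel) < \<infinity>"
    "\<And>r. 0 \<le> r \<Longrightarrow> weight_hat v r = enn2real (\<integral>\<^sup>+s\<in>{r..<1}. ennreal (n s) \<partial>lborel)"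
    "AE z in lborel. z \<in> ball 0 1 \<longrightarrow> v z = n (cmod z)"
proof -
  have nn: "\<And>z. z \<in> ball 0 1 \<Longrightarrow> 0 \<le> v z" and rad: "\<And>z. z \<in> ball 0 1 \<Longrightarrow> v z = v (of_real (cmod z))"
    and int: "set_integrable lebesgue {0..<1} (\<lambda>s::real. v (of_real s))"
    using nu unfolding radial_weight_def weight_def by blast+
  have nnr: "0 \<le> v (of_real s)" if "s \<in> {0..<1}" for s :: real
    using that by (intro nn) auto
  let ?f = "\<lambda>s::real. indicator {0..<1} s *\<^sub>R v (of_real s)"
  have "integrable lebesgue ?f" using int by (simp add: set_integrable_def)
  then have fin: "(\<integral>\<^sup>+s. ennreal (norm (?f s)) \<partial>lebesgue) < \<infinity>" and "?f \<in> borel_measurable lebesgue"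
    by (auto simp: integrable_iff_bounded)
  then obtain h where h: "h \<in> borel_measurable borel" "AE s in lborel. ?f s = h s"
    using completion_ex_borel_measurable_real[of _ lborel] by auto
  define n where "n = (\<lambda>r. max 0 (h r))"
  have [measurable]: "n \<in> borel_measurable borel" using h(1) unfolding n_def by measurable
  have n0: "0 \<le> n r" for r by (simp add: n_def)
  have ae: "AE s in lborel. s \<in> {0..<1} \<longrightarrow> v (of_real s) = n s"
    using h(2)
  proof eventually_elim
    case (elim s)
    then show ?case using nnr[of s] by (auto simp: n_def indicator_def)
  qed
  have nf: "(\<integral>\<^sup>+r\<in>{0..<1}. ennreal (n r) \<partial>lborel) < \<infinity>"
  proof -
    have "(\<integral>\<^sup>+r\<in>{0..<1}. ennreal (n r) \<partial>lborel) = (\<integral>\<^sup>+s. ennreal (norm (?f s)) \<partial>lborel)"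
    proof (rule nn_integral_cong_AE, use ae in eventually_elim)
      case (elim s)
      then show ?case using nnr[of s] by (auto simp: indicator_def)
    qed
    with fin show ?thesis by (simp add: nn_integral_completion)
  qed
  have hat: "weight_hat v r = enn2real (\<integral>\<^sup>+s\<in>{r..<1}. ennreal (n s) \<partial>lborel)" if r: "0 \<le> r" for r
  proof -
    have "set_integrable lebesgue {r..<1} (\<lambda>s::real. v (of_real s))"
      using r by (intro set_integrable_subset[OF int]) auto
    then have m: "(\<lambda>s. indicator {r..<1} s *\<^sub>R v (of_real s)) \<in> borel_measurable lebesgue"
      unfolding set_integrable_def by (rule borel_measurable_integrable)
    have "weight_hat v r = enn2real (\<integral>\<^sup>+s. ennreal (indicator {r..<1} s *\<^sub>R v (of_real s)) \<partial>lebesgue)"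
      unfolding weight_hat_def set_lebesgue_integral_def
    proof (rule integral_eq_nn_integral[OF m AE_I2])
      fix s show "0 \<le> indicator {r..<1} s *\<^sub>R v (of_real s)" using nnr[of s] r by (auto simp: indicator_def)
    qed
    also have "(\<integral>\<^sup>+s. ennreal (indicator {r..<1} s *\<^sub>R v (of_real s)) \<partial>lebesgue) = (\<integral>\<^sup>+s\<in>{r..<1}. ennreal (n s) \<partial>lborel)"
      unfolding nn_integral_completion
    proof (rule nn_integral_cong_AE, use ae in eventually_elim)
      case (elim s)
      then show ?case using r by (auto simp: indicator_def)
    qed
    finally show ?thesis .
  qed
  have "AE z in area. z \<in> ball 0 1 \<longrightarrow> v z = n (cmod z)"
  proof -
    from ae obtain N0 where N0: "N0 \<in> null_sets lborel" "{s. \<not> (s \<in> {0..<1} \<longrightarrow> v (of_real s) = n s)} \<subseteq> N0"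
      by (auto elim!: AE_E simp: null_sets_def)
    have [measurable]: "N0 \<in> sets borel" using N0(1) by auto
    have "(\<integral>\<^sup>+z\<in>ball 0 1. indicator N0 (cmod z) \<partial>area) = (\<integral>\<^sup>+r\<in>{0<..<1}. ennreal (2 * r) * indicator N0 r \<partial>lborel)"
      by (rule nn_integral_area_radial) measurable
    also have "\<dots> = (\<integral>\<^sup>+r. 0 \<partial>(lborel :: real measure))"
    proof (rule nn_integral_cong_AE, use AE_not_in[OF N0(1)] in eventually_elim)
      case (elim r)
      then show ?case by simp
    qed
    finally have zero: "(\<integral>\<^sup>+z\<in>ball 0 1. indicator N0 (cmod z) \<partial>area) = 0" by simp
    have "(\<lambda>z. indicator N0 (cmod z) * indicator (ball 0 1) z :: ennreal) \<in> borel_measurable area"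
      unfolding borel_measurable_area by measurable
    then have "AE z in area. indicator N0 (cmod z) * indicator (ball 0 1) z = (0 :: ennreal)"
      using zero by (simp only: nn_integral_0_iff_AE)
    then show ?thesis
    proof eventually_elim
      case (elim z)
      show ?case
      proof
        assume z: "z \<in> ball 0 1"
        then have "cmod z \<notin> N0" using elim by (auto simp: indicator_def split: if_splits)
        then have "v (of_real (cmod z)) = n (cmod z)" 
        proof -
          have "cmod z \<in> {0..<1}" using z by simp
          then show ?thesis using N0(2) \<open>cmod z \<notin> N0\<close> by blast
        qed
        then show "v z = n (cmod z)" using rad[OF z] by simp
      qed
    qed
  qed
  then have "AE z in lborel. z \<in> ball 0 1 \<longrightarrow> v z = n (cmod z)" by (rule AE_lborel_of_area)
  then show thesis using n0 nf hat by (intro that[of n]) auto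
qed

lemma B_infty_D_bekolle:
  assumes "\<omega> \<in> B_infty_D"
  obtains n om q where "bekolle n om q" "AE z in lborel. z \<in> ball 0 1 \<longrightarrow> \<omega> z = om z"
    "\<And>z. z \<in> ball 0 1 \<Longrightarrow> z \<noteq> 0 \<Longrightarrow> weight_mass \<omega> (carleson_square z) = measure (disc_measure (\<lambda>x. ennreal (om x))) (carleson_square z)"
proof -
  obtain v q where v: "v \<in> D_class" and q: "1 < q" and w: "weight \<omega>" and rB: "ratio_in_Bq q \<omega> v"
    using assms by (auto simp: B_infty_D_def B_infty_def)
  have rv: "radial_weight v" using v by (simp add: D_class_def D_hat_def)
  have wn: "\<And>z. z \<in> ball 0 1 \<Longrightarrow> 0 \<le> \<omega> z" and wi: "set_integrable area_measure (ball 0 1) \<omega>"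
    and wp: "\<And>a. a \<in> ball 0 1 \<Longrightarrow> a \<noteq> 0 \<Longrightarrow> 0 < weight_mass \<omega> (carleson_square a)"
    using w by (auto simp: weight_def)
  have vn: "\<And>z. z \<in> ball 0 1 \<Longrightarrow> 0 \<le> v z" and vi: "set_integrable area_measure (ball 0 1) v"
    and vp: "\<And>a. a \<in> ball 0 1 \<Longrightarrow> a \<noteq> 0 \<Longrightarrow> 0 < weight_mass v (carleson_square a)"
    using rv unfolding radial_weight_def weight_def by blast+
  obtain om where om: "om \<in> borel_measurable borel" "\<And>z. 0 \<le> om z" "AE z in lborel. z \<in> ball 0 1 \<longrightarrow> \<omega> z = om z"
    "(\<integral>\<^sup>+x\<in>ball 0 1. ennreal (om x) \<partial>area) < \<infinity>"
    using set_integrable_borel_representative[OF wi wn] by blast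
  obtain n where n: "n \<in> borel_measurable borel" "\<And>r. 0 \<le> n r"
    "(\<integral>\<^sup>+r\<in>{0..<1}. ennreal (n r) \<partial>lborel) < \<infinity>"
    and hat: "\<And>r. 0 \<le> r \<Longrightarrow> weight_hat v r = enn2real (\<integral>\<^sup>+s\<in>{r..<1}. ennreal (n s) \<partial>lborel)"
    and vae: "AE z in lborel. z \<in> ball 0 1 \<longrightarrow> v z = n (cmod z)"
    using radial_weight_borel_profile[OF rv] by blast
  note [measurable] = om(1) n(1)
  have sq: "carleson_square a \<in> sets borel" "carleson_square a \<subseteq> ball 0 1" if "a \<in> ball 0 1" "a \<noteq> 0" for a
    using carleson_square_borel[OF that] by (auto simp: carleson_square_def)
  have wm: "weight_mass \<omega> (carleson_square a) = measure (disc_measure (\<lambda>x. ennreal (om x))) (carleson_square a)"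
    if "a \<in> ball 0 1" "a \<noteq> 0" for a
    by (rule weight_mass_eq_measure[OF sq[OF that] om(1,2,3) wn wi])
  interpret rp: radial_profile n
    by (rule radial_profile.intro[OF n])
  have vm: "weight_mass v (carleson_square a) = measure rp.nu (carleson_square a)"
    if "a \<in> ball 0 1" "a \<noteq> 0" for a
  proof -
    have "weight_mass v (carleson_square a) = measure (disc_measure (\<lambda>x. ennreal (n (cmod x)))) (carleson_square a)"
      by (rule weight_mass_eq_measure[OF sq[OF that] _ _ vae vn vi]) (use n(2) in auto)
    then show ?thesis by (simp add: disc_measure_def rp.nu_def)
  qed
  have hat_eq: "weight_hat v r = rp.hat r" if "0 \<le> r" for r
    using hat[OF that] by (simp add: rp.hat_def)
  interpret dp: D_profile n
  proof unfold_locales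
    obtain C where "\<And>r. 0 \<le> r \<Longrightarrow> r < 1 \<Longrightarrow> weight_hat v r \<le> C * weight_hat v ((1 + r) / 2)"
      using v by (auto simp: D_class_def D_hat_def)
    then show "\<exists>C. \<forall>r. 0 \<le> r \<and> r < 1 \<longrightarrow> rp.hat r \<le> C * rp.hat ((1 + r) / 2)"
      by (intro exI[of _ C]) (auto simp: hat_eq[symmetric])
    obtain K C where K: "K > 1" and C: "C > 1"
      and dec: "\<And>r. 0 \<le> r \<Longrightarrow> r < 1 \<Longrightarrow> C * weight_hat v (1 - (1 - r) / K) \<le> weight_hat v r"
      using v by (auto simp: D_class_def D_check_def)
    have "0 \<le> 1 - (1 - r) / K" if "0 \<le> r" for r
      using K that by (simp add: divide_le_eq)
    then show "\<exists>K>1. \<exists>C>1. \<forall>r. 0 \<le> r \<and> r < 1 \<longrightarrow> C * rp.hat (1 - (1 - r) / K) \<le> rp.hat r"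
      using dec K C by (intro exI[of _ K] conjI exI[of _ C]) (auto simp: hat_eq[symmetric])
    fix u :: real assume u: "0 < u"
    define a :: complex where "a = of_real (max (1 / 2) (1 - u))"
    have a: "cmod a = max (1 / 2) (1 - u)" unfolding a_def norm_of_real by simp
    have aD: "a \<in> ball 0 1" "a \<noteq> 0" using a u by auto
    have "0 < measure rp.nu (carleson_square a)" using vp[OF aD] vm[OF aD] by simp
    also have "\<dots> \<le> rp.N u"
      unfolding rp.N_def
    proof (rule rp.nu.finite_measure_mono)
      show "carleson_square a \<subseteq> collar u"
        using carleson_square_iff[OF aD] a by (auto simp: collar_def)
    qed simp
    finally show "0 < rp.N u" .
  qed
  have dual: "(\<integral>\<^sup>+z\<in>carleson_square a. dual_integrand q \<omega> v z \<partial>area_measure) =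
      emeasure (disc_measure (dual_integrand q om (\<lambda>z. n (cmod z)))) (carleson_square a)"
    if a: "a \<in> ball 0 1" "a \<noteq> 0" for a
  proof -
    note [measurable] = sq(1)[OF a]
    have [measurable]: "dual_integrand q om (\<lambda>z. n (cmod z)) \<in> borel_measurable borel"
      unfolding dual_integrand_def by measurable
    have "(\<integral>\<^sup>+z\<in>carleson_square a. dual_integrand q \<omega> v z \<partial>area_measure) =
      (\<integral>\<^sup>+z\<in>ball 0 1. indicator (carleson_square a) z * dual_integrand q om (\<lambda>z. n (cmod z)) z \<partial>area)"
    proof (rule nn_integral_area_measure_AE)
      show "AE x in lborel. dual_integrand q \<omega> v x * indicator (carleson_square a) x =
        indicator (carleson_square a) x * dual_integrand q om (\<lambda>z. n (cmod z)) x * indicator (ball 0 1) x"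
        using om(3) vae by eventually_elim (use sq(2)[OF a] in \<open>auto simp: indicator_def dual_integrand_def\<close>)
    qed measurable
    also have "\<dots> = emeasure (disc_measure (dual_integrand q om (\<lambda>z. n (cmod z)))) (carleson_square a)"
      by (rule emeasure_disc_measure[symmetric]) measurable
    finally show ?thesis .
  qed
  have "bekolle n om q"
  proof unfold_locales
    obtain C :: real where C: "\<And>a. a \<in> ball 0 1 - {0} \<Longrightarrow>
        ennreal (weight_mass \<omega> (carleson_square a) powr (1 / q)) *
        ennreal_powr (\<integral>\<^sup>+ z \<in> carleson_square a. dual_integrand q \<omega> v z \<partial>area_measure)
          (1 / (q / (q - 1)))
        \<le> ennreal (C * weight_mass v (carleson_square a))"
      using rB unfolding ratio_in_Bq_def by blast
    show "\<exists>C::real. \<forall>a\<in>ball 0 1 - {0}.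
      ennreal (measure (disc_measure (\<lambda>x. ennreal (om x))) (carleson_square a) powr (1 / q)) *
      ennreal_powr (emeasure (disc_measure (dual_integrand q om (\<lambda>z. n (cmod z)))) (carleson_square a))
        (1 / (q / (q - 1)))
      \<le> ennreal (C * measure rp.nu (carleson_square a))"
    proof (intro exI[of _ C] ballI)
      fix a :: complex assume a: "a \<in> ball 0 1 - {0}"
      then have a': "a \<in> ball 0 1" "a \<noteq> 0" by auto
      show "ennreal (measure (disc_measure (\<lambda>x. ennreal (om x))) (carleson_square a) powr (1 / q)) *
        ennreal_powr (emeasure (disc_measure (dual_integrand q om (\<lambda>z. n (cmod z)))) (carleson_square a))
          (1 / (q / (q - 1))) \<le> ennreal (C * measure rp.nu (carleson_square a))"
        using C[OF a] unfolding wm[OF a'] vm[OF a'] dual[OF a'] .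
    qed
    fix a :: complex assume a: "a \<in> ball 0 1" "a \<noteq> 0"
    show "0 < measure (disc_measure (\<lambda>x. ennreal (om x))) (carleson_square a)"
      using wp[OF a] wm[OF a] by simp
  qed (use om q in auto)
  then show thesis using om(3) wm by (rule that)
qed

theorem theorem4:
  fixes p :: real and k :: nat and \<omega> :: "complex \<Rightarrow> real"
  assumes "0 < p" and "1 \<le> k" and "\<omega> \<in> B_infty_D"
  shows "comparable_on {f. f holomorphic_on unit_disc}
           (bergman_norm_pow p \<omega>) (bergman_norm_pow p (weight_tilde \<omega>)) \<and>
         comparable_on {f. f holomorphic_on unit_disc}
           (bergman_norm_pow p (weight_tilde \<omega>)) (derivative_norm_pow p k (weight_tilde \<omega>))"
proof -
  note p = assms(1)
  obtain n om q where bek: "bekolle n om q" and ae: "AE z in lborel. z \<in> ball 0 1 \<longrightarrow> \<omega> z = om z"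
    and mass: "\<And>z. z \<in> ball 0 1 \<Longrightarrow> z \<noteq> 0 \<Longrightarrow> weight_mass \<omega> (carleson_square z) = measure (disc_measure (\<lambda>x. ennreal (om x))) (carleson_square z)"
    using B_infty_D_bekolle[OF assms(3)] by blast
  interpret bekolle n om q by (rule bek)
  let ?wt = "weight_tilde \<omega>"
  define XV where "XV = (\<lambda>f. V_norm p f)"
  define DV where "DV = (\<lambda>f. V_weighted_norm p (real k * p) ((deriv ^^ k) f) +
      ennreal (\<Sum>j<k. cmod ((deriv ^^ j) f 0) powr p))"
  have "?wt z = measure mu (carleson_square z) / (gap z)\<^sup>2" if "z \<in> ball 0 1" "z \<noteq> 0" for z
    using mass[OF that] by (simp add: weight_tilde_def mu_def)
  then obtain C where C: "C \<ge> 1" "\<And>z. z \<in> ball 0 1 \<Longrightarrow> z \<noteq> 0 \<Longrightarrow> ?wt z \<le> V z \<and> V z \<le> C * ?wt z"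
    using V_comparable_square_mean by blast
  have sandwich: "(\<integral>\<^sup>+z. h z * ennreal (?wt z) \<partial>area_measure) \<le> (\<integral>\<^sup>+z. h z * ennreal (V z) \<partial>area)"
      "(\<integral>\<^sup>+z. h z * ennreal (V z) \<partial>area) \<le> ennreal C * (\<integral>\<^sup>+z. h z * ennreal (?wt z) \<partial>area_measure)"
    if h: "h \<in> borel_measurable borel" and supp: "\<And>z. z \<notin> ball 0 1 \<Longrightarrow> h z = 0" for h :: "complex \<Rightarrow> ennreal"
  proof -
    note [measurable] = h
    have n0: "AE z in area_measure. z \<noteq> 0"
      by (rule AE_area_measure) (rule AE_lborel_singleton)
    have eqV: "(\<integral>\<^sup>+z. h z * ennreal (V z) \<partial>area_measure) = (\<integral>\<^sup>+z. h z * ennreal (V z) \<partial>area)"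
      by (rule nn_integral_area_measure) measurable
    have "(\<integral>\<^sup>+z. h z * ennreal (?wt z) \<partial>area_measure) \<le> (\<integral>\<^sup>+z. h z * ennreal (V z) \<partial>area_measure)"
    proof (rule nn_integral_mono_AE, use n0 in eventually_elim)
      case (elim z)
      then show ?case
        using C(2)[of z] supp[of z] by (cases "z \<in> ball 0 1") (auto intro!: mult_left_mono ennreal_leI)
    qed
    then show "(\<integral>\<^sup>+z. h z * ennreal (?wt z) \<partial>area_measure) \<le> (\<integral>\<^sup>+z. h z * ennreal (V z) \<partial>area)"
      unfolding eqV .
    \<comment> \<open>The constant is moved onto the side of \<open>V\<close>, whose integrand is measurable.\<close>
    have "(\<integral>\<^sup>+z. ennreal (1 / C) * (h z * ennreal (V z)) \<partial>area_measure) \<le> (\<integral>\<^sup>+z. h z * ennreal (?wt z) \<partial>area_measure)"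
    proof (rule nn_integral_mono_AE, use n0 in eventually_elim)
      case (elim z)
      show ?case
      proof (cases "z \<in> ball 0 1")
        case True
        then have "1 / C * V z \<le> ?wt z" using C(1) C(2)[of z] elim by (simp add: field_simps)
        then have "ennreal (1 / C) * ennreal (V z) \<le> ennreal (?wt z)"
          using C(1) by (simp add: ennreal_mult'[symmetric] ennreal_leI)
        then have "h z * (ennreal (1 / C) * ennreal (V z)) \<le> h z * ennreal (?wt z)" by (rule mult_left_mono) simp
        then show ?thesis by (simp add: mult_ac)
      qed (use supp in simp)
    qed
    also have "(\<integral>\<^sup>+z. ennreal (1 / C) * (h z * ennreal (V z)) \<partial>area_measure) = ennreal (1 / C) * (\<integral>\<^sup>+z. h z * ennreal (V z) \<partial>area)"
      using nn_integral_area_measure[of "\<lambda>z. ennreal (1 / C) * (h z * ennreal (V z))"] by (simp add: nn_integral_cmult)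
    finally have "ennreal C * (ennreal (1 / C) * (\<integral>\<^sup>+z. h z * ennreal (V z) \<partial>area)) \<le> ennreal C * (\<integral>\<^sup>+z. h z * ennreal (?wt z) \<partial>area_measure)"
      by (rule mult_left_mono) simp
    then show "(\<integral>\<^sup>+z. h z * ennreal (V z) \<partial>area) \<le> ennreal C * (\<integral>\<^sup>+z. h z * ennreal (?wt z) \<partial>area_measure)"
      using C(1) by (simp add: mult.assoc[symmetric] ennreal_mult'[symmetric])
  qed
  have X0: "bergman_norm_pow p \<omega> f = (\<integral>\<^sup>+x. disc_pow f p x \<partial>mu)" if f: "f holomorphic_on ball 0 1" for f
  proof -
    note [measurable] = disc_pow_borel[OF f]
    have "bergman_norm_pow p \<omega> f = (\<integral>\<^sup>+x\<in>ball 0 1. disc_pow f p x * ennreal (om x) \<partial>area)"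
      unfolding bergman_norm_pow_def
    proof (rule nn_integral_area_measure_AE)
      show "AE x in lborel. ennreal (cmod (f x) powr p * \<omega> x) * indicator unit_disc x =
         disc_pow f p x * ennreal (om x) * indicator (ball 0 1) x"
        using ae by eventually_elim (auto simp: disc_pow_def indicator_def ennreal_mult')
    qed measurable
    also have "\<dots> = (\<integral>\<^sup>+x. disc_pow f p x \<partial>mu)"
      unfolding mu_def by (rule nn_integral_disc_measure[symmetric]) measurable
    finally show ?thesis .
  qed
  have X1: "bergman_norm_pow p ?wt f \<le> XV f" "XV f \<le> ennreal C * bergman_norm_pow p ?wt f"
    if f: "f holomorphic_on ball 0 1" for f
  proof -
    have "bergman_norm_pow p ?wt f = (\<integral>\<^sup>+z. disc_pow f p z * ennreal (?wt z) \<partial>area_measure)"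
      unfolding bergman_norm_pow_def
      by (intro nn_integral_cong) (auto simp: disc_pow_def indicator_def ennreal_mult')
    then show "bergman_norm_pow p ?wt f \<le> XV f" "XV f \<le> ennreal C * bergman_norm_pow p ?wt f"
      unfolding XV_def using sandwich[OF disc_pow_borel[OF f]] by (simp_all add: disc_pow_def)
  qed
  have D1: "derivative_norm_pow p k ?wt f \<le> DV f" "DV f \<le> ennreal C * derivative_norm_pow p k ?wt f"
    if f: "f holomorphic_on ball 0 1" for f
  proof -
    have fk: "(deriv ^^ k) f holomorphic_on ball 0 1"
      using f by (rule holomorphic_higher_deriv) simp
    note [measurable] = disc_pow_borel[OF fk]
    define h where "h = (\<lambda>z. disc_pow ((deriv ^^ k) f) p z * ennreal (gap z powr (real k * p)))"
    have [measurable]: "h \<in> borel_measurable borel" unfolding h_def by measurable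
    have supp: "h z = 0" if "z \<notin> ball 0 1" for z using that by (simp add: h_def disc_pow_def)
    define s where "s = ennreal (\<Sum>j<k. cmod ((deriv ^^ j) f 0) powr p)"
    have eq: "derivative_norm_pow p k ?wt f = (\<integral>\<^sup>+z. h z * ennreal (?wt z) \<partial>area_measure) + s"
      unfolding derivative_norm_pow_def s_def
      by (intro arg_cong2[of _ _ _ _ "(+)"] nn_integral_cong refl)
         (auto simp: h_def disc_pow_def indicator_def ennreal_mult')
    have DVh: "DV f = (\<integral>\<^sup>+z. h z * ennreal (V z) \<partial>area) + s"
      by (simp add: DV_def h_def s_def)
    have hm: "h \<in> borel_measurable borel" by measurable
    show "derivative_norm_pow p k ?wt f \<le> DV f"
      unfolding eq DVh by (intro add_right_mono sandwich(1)[OF hm supp])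
    have "1 * s \<le> ennreal C * s" using C(1) by (intro mult_right_mono) auto
    then have "DV f \<le> ennreal C * (\<integral>\<^sup>+z. h z * ennreal (?wt z) \<partial>area_measure) + ennreal C * s"
      unfolding DVh by (intro add_mono sandwich(2)[OF hm supp]) auto
    then show "DV f \<le> ennreal C * derivative_norm_pow p k ?wt f"
      unfolding eq by (simp add: distrib_left)
  qed
  obtain C1 where C1: "0 < C1" "\<And>f. f holomorphic_on ball 0 1 \<Longrightarrow> (\<integral>\<^sup>+x. disc_pow f p x \<partial>mu) \<le> ennreal C1 * XV f"
    using mu_norm_le_V_norm[OF p] unfolding XV_def by blast
  obtain C2 where C2: "0 < C2" "\<And>f. f holomorphic_on ball 0 1 \<Longrightarrow> XV f \<le> ennreal C2 * (\<integral>\<^sup>+x. disc_pow f p x \<partial>mu)"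
    using V_norm_le_mu_norm[OF p] unfolding XV_def by blast
  obtain C3 where C3: "0 < C3" "\<And>f. f holomorphic_on ball 0 1 \<Longrightarrow> XV f \<le> ennreal C3 * DV f"
    using V_norm_le_derivative_norm[OF p, of k] unfolding XV_def DV_def by blast
  obtain C4 where C4: "0 < C4" "\<And>f. f holomorphic_on ball 0 1 \<Longrightarrow> DV f \<le> ennreal C4 * XV f"
    using derivative_norm_le_V_norm[OF p, of k] unfolding XV_def DV_def by blast
  have chain: "A \<le> ennreal (a * b) * D" if "A \<le> ennreal a * B" "B \<le> ennreal b * D" "0 < a" for A B D :: ennreal and a b
  proof -
    have "A \<le> ennreal a * (ennreal b * D)" using that(1) by (rule order_trans) (intro mult_left_mono that, simp)
    then show ?thesis using that(3) by (simp add: ennreal_mult' mult.assoc)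
  qed
  have C0: "0 < C" using C(1) by simp
  show ?thesis
  proof
    show "comparable_on {f. f holomorphic_on unit_disc} (bergman_norm_pow p \<omega>) (bergman_norm_pow p ?wt)"
    proof (rule comparable_onI)
      show "0 < C1 * C" "0 < C2" using C1 C2 C0 by auto
      fix f assume "f \<in> {f. f holomorphic_on unit_disc}"
      then have f: "f holomorphic_on ball 0 1" by simp
      show "bergman_norm_pow p \<omega> f \<le> ennreal (C1 * C) * bergman_norm_pow p ?wt f"
        unfolding X0[OF f] by (rule chain[OF C1(2)[OF f] X1(2)[OF f] C1(1)])
      show "bergman_norm_pow p ?wt f \<le> ennreal C2 * bergman_norm_pow p \<omega> f"
        unfolding X0[OF f] using X1(1)[OF f] C2(2)[OF f] by (rule order_trans)
    qed
    show "comparable_on {f. f holomorphic_on unit_disc} (bergman_norm_pow p ?wt) (derivative_norm_pow p k ?wt)"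
    proof (rule comparable_onI)
      show "0 < C3 * C" "0 < C4 * C" using C3 C4 C0 by auto
      fix f assume "f \<in> {f. f holomorphic_on unit_disc}"
      then have f: "f holomorphic_on ball 0 1" by simp
      show "bergman_norm_pow p ?wt f \<le> ennreal (C3 * C) * derivative_norm_pow p k ?wt f"
        using X1(1)[OF f] chain[OF C3(2)[OF f] D1(2)[OF f] C3(1)] by (rule order_trans)
      show "derivative_norm_pow p k ?wt f \<le> ennreal (C4 * C) * bergman_norm_pow p ?wt f"
        using D1(1)[OF f] chain[OF C4(2)[OF f] X1(2)[OF f] C4(1)] by (rule order_trans)
    qed
  qed
qed

end
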